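(* Let $n\ge1$ be an integer and $\alpha\in(\tfrac12,1)$. The generalized Navier–Stokes equations on $\mathbb R^n$ $$u_t+(u\cdot\nabla)u+(-\Delta)^\alpha u+\nabla p=0,\qquad \nabla\cdot u=0,\qquad u(0)=u_0,$$ have a unique small global (mild) solution in $GX$ for all divergence-free initial data which are small in $\mathcal B$. That is, there exist $\varepsilon>0$ and $\delta>0$ such that for every $\mathbb R^n$-valued $u_0\in\mathcal B$ with $\nabla\cdot u_0=0$ and $\|u_0\|_{\mathcal B}\le\varepsilon$ there is exactly one $u\in GX$ with $\|u\|_{GX}\le\delta$ satisfying $$u(x,t)=S(t)u_0(x)-\big(V\nabla\Pi(u\otimes u)\big)(x,t)\qquad (x\in\mathbb R^n,\ t>0).$$
   Context: $S(t)=e^{-t(-\Delta)^\alpha}$, $t>0$, is the Fourier multiplier with symbol $e^{-t|\xi|^{2\alpha}}$, i.e. convolution with $\Phi(t,\cdot)=\mathcal F^{-1}(e^{-t|\xi|^{2\alpha}})$; it acts componentwise on vector fields. $\Pi$ is the Leray projection onto divergence-free vector fields, the matrix Fourier multiplier with symbol $m_{ij}(\xi)=\delta_{ij}-\xi_i\xi_j/|\xi|^2$. For a matrix-valued function $f=(f_{jk})$ on $\mathbb R^n\times(0,\infty)$, $V\nabla\Pi f$ is the vector field with components $$(V\nabla\Pi f)_i(x,t)=\int_0^t\sum_{j,k}\big(\Pi_{ij}\partial_kS(t-s)f_{jk}(\cdot,s)\big)(x)\,ds,$$ where $\Pi_{ij}\partial_kS(\tau)$ is the convolution operator with kernel $\mathcal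 F^{-1}(m_{ij}(\xi)\,i\xi_k\,e^{-\tau|\xi|^{2\alpha}})\in L^1(\mathbb R^n)$ (so $V\nabla\Pi f$ is the mild solution of $w_t+(-\Delta)^\alpha w=\Pi\,\nabla\cdot f$, $w(0)=0$). A mild solution is a solution of the displayed fixed-point equation. $GX$ is the space of ($\mathbb R^n$-valued) functions on $\mathbb R^n\times(0,\infty)$ with finite norm $\|u\|_{GX}=\sup_{t>0}t^{1-\frac1{2\alpha}}\|u(\cdot,t)\|_{L^\infty(\mathbb R^n)}$. $\mathcal B=\dot B^{1-2\alpha,\infty}_\infty(\mathbb R^n)$, the homogeneous Besov space of $f\in\mathcal S'(\mathbb R^n)$ with $\|\theta(\lambda D)f\|_{L^\infty}\to0$ as $\lambda\to\infty$ for all $\theta\in C_c^\infty(\mathbb R^n)$ (where $\theta(\lambda D)$ has symbol $\theta(\lambda\xi)$) and $\sup_{j\in\mathbb Z}2^{j(1-2\alpha)}\|P_jf\|_{L^\infty}<\infty$ ($P_j$ the Littlewood–Paley projections to $|\xi|\sim2^j$). Its norm $\|\cdot\|_{\mathcal B}$ may be taken, up to equivalence, to be $\|f\|_{\mathcal B}=\sup_{t>0}t^{1-\frac1{2\alpha}}\|S(t)f\|_{L^\infty}$. *)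

theory Defs
  imports "HOL-Analysis.Analysis" "HOL-Probability.Essential_Supremum"
begin

section \<open>Test functions and tempered distributions\<close>

definition partial ::
    "'n::finite \<Rightarrow> (real^'n \<Rightarrow> 'b::real_normed_vector) \<Rightarrow> real^'n \<Rightarrow> 'b" where
  "partial k f x = frechet_derivative f (at x) (axis k 1)"

primrec partials ::
    "'n::finite list \<Rightarrow> (real^'n \<Rightarrow> 'b::real_normed_vector) \<Rightarrow> real^'n \<Rightarrow> 'b" where
  "partials [] f = f"
| "partials (k # ks) f = partial k (partials ks f)"

definition smooth :: "(real^'n::finite \<Rightarrow> 'b::real_normed_vector) \<Rightarrow> bool" where
  "smooth f \<longleftrightarrow> (\<forall>ks x. partials ks f differentiable (at x))"

definition test_function :: "(real^'n::finite \<Rightarrow> 'b::real_normed_vector) \<Rightarrow> bool" where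
  "test_function f \<longleftrightarrow> smooth f \<and> compact (closure {x. f x \<noteq> 0})"

definition schwartz :: "(real^'n::finite \<Rightarrow> complex) set" where
  "schwartz = {f. smooth f \<and>
     (\<forall>N ks. \<exists>C. \<forall>x. (1 + norm x) ^ N * norm (partials ks f x) \<le> C)}"

definition schwartz_seminorm :: "nat \<Rightarrow> (real^'n::finite \<Rightarrow> complex) \<Rightarrow> real" where
  "schwartz_seminorm N f =
     (SUP (ks, x) \<in> {ks. length ks \<le> N} \<times> UNIV. (1 + norm x) ^ N * norm (partials ks f x))"

text \<open>A tempered distribution is a function on all of \<^typ>\<open>real^'n \<Rightarrow> complex\<close>, of which only the
  restriction to \<open>schwartz\<close> is ever used.\<close>

type_synonym 'n distr = "(real^'n \<Rightarrow> complex) \<Rightarrow> complex"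

definition tempered :: "'n::finite distr \<Rightarrow> bool" where
  "tempered T \<longleftrightarrow>
     (\<forall>f\<in>schwartz. \<forall>g\<in>schwartz. T (\<lambda>x. f x + g x) = T f + T g) \<and>
     (\<forall>c. \<forall>f\<in>schwartz. T (\<lambda>x. c * f x) = c * T f) \<and>
     (\<exists>C N. \<forall>f\<in>schwartz. norm (T f) \<le> C * schwartz_seminorm N f)"

definition real_distr :: "'n::finite distr \<Rightarrow> bool" where
  "real_distr T \<longleftrightarrow> (\<forall>f\<in>schwartz. (\<forall>x. f x \<in> \<real>) \<longrightarrow> T f \<in> \<real>)"

text \<open>The distributional divergence vanishes; the sign of \<open>(\<partial>\<^sub>k T) f = - T (\<partial>\<^sub>k f)\<close> is immaterial.\<close>

definition divergence_free :: "('n::finite distr)^'n \<Rightarrow> bool" where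
  "divergence_free U \<longleftrightarrow> (\<forall>f\<in>schwartz. (\<Sum>k\<in>UNIV. (U $ k) (partial k f)) = 0)"


section \<open>Fourier multipliers\<close>

text \<open>Normalisation: \<open>(\<F> f)(\<xi>) = \<integral> exp (- i x \<bullet> \<xi>) f(x) dx\<close>, so that \<open>\<partial>\<^sub>k\<close> has symbol \<open>i \<xi>\<^sub>k\<close>.\<close>

definition inv_fourier :: "(real^'n::finite \<Rightarrow> complex) \<Rightarrow> real^'n \<Rightarrow> complex" where
  "inv_fourier m x =
     complex_of_real (1 / (2 * pi) ^ CARD('n)) * (LINT \<xi>|lborel. cis (x \<bullet> \<xi>) * m \<xi>)"

definition convolution ::
    "(real^'n::finite \<Rightarrow> complex) \<Rightarrow> (real^'n \<Rightarrow> complex) \<Rightarrow> real^'n \<Rightarrow> complex" where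
  "convolution K g x = (LINT y|lborel. K y * g (x - y))"

text \<open>For a symbol \<open>m\<close> in \<open>C\<^sub>c\<^sup>\<infinity>\<close> and a tempered distribution \<open>T\<close>, \<open>m(D) T\<close> is the smooth function
  \<open>T * \<F>\<^sup>-\<^sup>1 m\<close>, the convolution of \<open>T\<close> with a Schwartz function.\<close>

definition fourier_multiplier ::
    "(real^'n::finite \<Rightarrow> complex) \<Rightarrow> 'n distr \<Rightarrow> real^'n \<Rightarrow> complex" where
  "fourier_multiplier m T x = T (\<lambda>y. inv_fourier m (x - y))"

definition Linf_norm :: "(real^'n::finite \<Rightarrow> 'b::real_normed_vector) \<Rightarrow> ennreal" where
  "Linf_norm f = esssup lborel (\<lambda>x. ennreal (norm (f x)))"


section \<open>Littlewood--Paley decomposition and the Besov space\<close>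

definition littlewood_paley :: "(real^'n::finite \<Rightarrow> real) \<Rightarrow> bool" where
  "littlewood_paley \<psi> \<longleftrightarrow>
     test_function \<psi> \<and>
     (\<forall>\<xi>. \<psi> \<xi> \<noteq> 0 \<longrightarrow> 1 / 2 \<le> norm \<xi> \<and> norm \<xi> \<le> 2) \<and>
     (\<forall>\<xi> \<eta>. norm \<xi> = norm \<eta> \<longrightarrow> \<psi> \<xi> = \<psi> \<eta>) \<and>
     (\<forall>\<xi>. \<xi> \<noteq> 0 \<longrightarrow> ((\<lambda>j::int. \<psi> ((2 powi (- j)) *\<^sub>R \<xi>)) has_sum 1) UNIV)"

definition LP_proj ::
    "(real^'n::finite \<Rightarrow> real) \<Rightarrow> int \<Rightarrow> 'n distr \<Rightarrow> real^'n \<Rightarrow> complex" where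
  "LP_proj \<psi> j = fourier_multiplier (\<lambda>\<xi>. complex_of_real (\<psi> ((2 powi (- j)) *\<^sub>R \<xi>)))"

definition besov :: "(real^'n::finite \<Rightarrow> real) \<Rightarrow> real \<Rightarrow> 'n distr set" where
  "besov \<psi> \<alpha> = {T. tempered T \<and>
     (\<forall>\<theta>::real^'n \<Rightarrow> complex. test_function \<theta> \<longrightarrow>
        ((\<lambda>r::real. Linf_norm (fourier_multiplier (\<lambda>\<xi>. \<theta> (r *\<^sub>R \<xi>)) T)) \<longlongrightarrow> 0) at_top) \<and>
     (SUP j::int. ennreal (2 powr (of_int j * (1 - 2 * \<alpha>))) * Linf_norm (LP_proj \<psi> j T)) < \<infinity>}"


section \<open>The semigroup\<close>

definition heat_kernel :: "real \<Rightarrow> real \<Rightarrow> real^'n::finite \<Rightarrow> complex" where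
  "heat_kernel \<alpha> t = inv_fourier (\<lambda>\<xi>. complex_of_real (exp (- t * norm \<xi> powr (2 * \<alpha>))))"

text \<open>The symbol of \<open>S(t)\<close> is not smooth at the origin, so convolution with the heat kernel is not
  defined on all tempered distributions. For \<open>T\<close> in \<open>besov \<psi> \<alpha>\<close> one has \<open>T = \<Sum>\<^sub>j P\<^sub>j T\<close> (by the
  low-frequency condition) with every \<open>P\<^sub>j T\<close> a bounded function, so that \<open>S(t) P\<^sub>j T\<close> is an honest
  convolution with an integrable kernel. The series of these converges absolutely and uniformly
  in \<open>x\<close> when \<open>\<alpha> > 1/2\<close>, and its sum does not depend on \<open>\<psi>\<close>.\<close>

definition semigroup_at ::
    "(real^'n::finite \<Rightarrow> real) \<Rightarrow> real \<Rightarrow> real \<Rightarrow> 'n distr \<Rightarrow> real^'n \<Rightarrow> complex" where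
  "semigroup_at \<psi> \<alpha> t T x = (\<Sum>\<^sub>\<infinity>j::int. convolution (heat_kernel \<alpha> t) (LP_proj \<psi> j T) x)"

definition semigroup_vec ::
    "(real^'n::finite \<Rightarrow> real) \<Rightarrow> real \<Rightarrow> real \<Rightarrow> ('n distr)^'n \<Rightarrow> real^'n \<Rightarrow> complex^'n" where
  "semigroup_vec \<psi> \<alpha> t U x = (\<chi> i. semigroup_at \<psi> \<alpha> t (U $ i) x)"

definition besov_norm ::
    "(real^'n::finite \<Rightarrow> real) \<Rightarrow> real \<Rightarrow> ('n distr)^'n \<Rightarrow> ennreal" where
  "besov_norm \<psi> \<alpha> U =
     (SUP t\<in>{0<..}. ennreal (t powr (1 - 1 / (2 * \<alpha>))) * Linf_norm (semigroup_vec \<psi> \<alpha> t U))"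


section \<open>The solution space and the Duhamel operator\<close>

text \<open>A function on \<open>\<real>\<^sup>n \<times> (0,\<infinity>)\<close> is represented by its extension with the value \<^const>\<open>undefined\<close>
  for \<open>t \<le> 0\<close>, so that equality in \<open>GX\<close> is equality on \<open>\<real>\<^sup>n \<times> (0,\<infinity>)\<close>.\<close>

definition spacetime :: "((real^'n::finite) \<times> real) set" where
  "spacetime = UNIV \<times> {0<..}"

definition GX_norm :: "real \<Rightarrow> ((real^'n::finite) \<times> real \<Rightarrow> real^'n) \<Rightarrow> ennreal" where
  "GX_norm \<alpha> u =
     (SUP t\<in>{0<..}. ennreal (t powr (1 - 1 / (2 * \<alpha>))) * Linf_norm (\<lambda>x. u (x, t)))"

definition GX :: "real \<Rightarrow> ((real^'n::finite) \<times> real \<Rightarrow> real^'n) set" where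
  "GX \<alpha> = {u \<in> extensional spacetime.
     u \<in> borel_measurable (restrict_space borel spacetime) \<and> GX_norm \<alpha> u < \<infinity>}"

text \<open>At \<open>\<xi> = 0\<close> the quotient is \<open>0\<close> by convention; the value on this null set is irrelevant.\<close>

definition leray_symbol :: "'n::finite \<Rightarrow> 'n \<Rightarrow> real^'n \<Rightarrow> real" where
  "leray_symbol i j \<xi> = (if i = j then 1 else 0) - \<xi> $ i * \<xi> $ j / (norm \<xi>)\<^sup>2"

text \<open>The kernel of \<open>\<Pi>\<^sub>i\<^sub>j \<partial>\<^sub>k S(\<tau>)\<close>.\<close>

definition leray_kernel ::
    "real \<Rightarrow> real \<Rightarrow> 'n::finite \<Rightarrow> 'n \<Rightarrow> 'n \<Rightarrow> real^'n \<Rightarrow> complex" where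
  "leray_kernel \<alpha> \<tau> i j k = inv_fourier (\<lambda>\<xi>. complex_of_real (leray_symbol i j \<xi>) *
     (\<i> * complex_of_real (\<xi> $ k)) * complex_of_real (exp (- \<tau> * norm \<xi> powr (2 * \<alpha>))))"

definition V_nabla_Pi ::
    "real \<Rightarrow> ((real^'n::finite) \<times> real \<Rightarrow> real^'n^'n) \<Rightarrow> (real^'n) \<times> real \<Rightarrow> complex^'n" where
  "V_nabla_Pi \<alpha> f = (\<lambda>(x, t). \<chi> i. LINT s:{0<..<t}|lborel. \<Sum>j\<in>UNIV. \<Sum>k\<in>UNIV.
     convolution (leray_kernel \<alpha> (t - s) i j k) (\<lambda>y. complex_of_real (f (y, s) $ j $ k)) x)"

definition tensor_square :: "((real^'n::finite) \<times> real \<Rightarrow> real^'n) \<Rightarrow> (real^'n) \<times> real \<Rightarrow> real^'n^'n" where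
  "tensor_square u z = (\<chi> j k. u z $ j * u z $ k)"

text \<open>Both terms on the right are real-valued for real data, but are computed in \<open>\<complex>\<close> by the Fourier
  integrals; the equation is imposed in \<open>\<complex>\<^sup>n\<close>.\<close>

definition mild_solution ::
    "(real^'n::finite \<Rightarrow> real) \<Rightarrow> real \<Rightarrow> ('n distr)^'n \<Rightarrow> ((real^'n) \<times> real \<Rightarrow> real^'n) \<Rightarrow> bool" where
  "mild_solution \<psi> \<alpha> U u \<longleftrightarrow> (\<forall>x. \<forall>t>0.
     (\<chi> i. complex_of_real (u (x, t) $ i)) =
       semigroup_vec \<psi> \<alpha> t U x - V_nabla_Pi \<alpha> (tensor_square u) (x, t))"

end

theory Submission
  imports Defs "HOL-Probability.Sinc_Integral" "HOL-Probability.Characteristic_Functions"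
    "HOL-Complex_Analysis.Complex_Analysis" "HOL-Real_Asymp.Real_Asymp"
begin

text \<open>
  The solution is the fixed point of \<open>u \<mapsto> S(t) u\<^sub>0 - V\<nabla>\<Pi>(u \<otimes> u)\<close> in a small ball of \<open>GX\<close>. Put
  \<open>\<beta> = 1 - 1/(2\<alpha>)\<close>. If the kernel of \<open>\<Pi>\<^sub>i\<^sub>j \<partial>\<^sub>k S(\<tau>)\<close> has \<open>L\<^sup>1\<close> norm at most \<open>C \<tau>\<^bsup>-1/(2\<alpha>)\<^esup>\<close>, then
  the bilinear term is bounded by the Beta integral \<open>\<integral>\<^sub>0\<^sup>t (t-s)\<^bsup>-1/(2\<alpha>)\<^esup> s\<^bsup>-2\<beta>\<^esup> ds\<close>, a constant times
  \<open>t\<^bsup>-\<beta>\<^esup>\<close>, and the map is a contraction; the linear term is controlled by the Besov norm itself.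

  By scaling, the kernel bound reduces to the integrability of the inverse Fourier transform at \<open>\<tau> = 1\<close>,
  where the symbol is not smooth at the origin. Gaussian symbols are harmless, since the Fourier transform
  preserves the Schwartz space, and \<open>1/|\<xi>|\<^sup>2\<close> and \<open>1/(|\<xi>|\<^sup>2 - z)\<close> with \<open>Re z < 0\<close> are Laplace
  integrals of Gaussians; so the symbol \<open>m\<^sub>i\<^sub>j \<xi>\<^sub>k / (|\<xi>|\<^sup>2 - z)\<close> has \<open>L\<^sup>1\<close> norm \<open>O(|Re z|\<^bsup>-1/2\<^esup>)\<close>.
  Finally \<open>exp(-r\<^sup>\<alpha>)\<close> is a Cauchy integral \<open>1/(2\<pi>i) \<integral> exp(-z\<^sup>\<alpha>) / (z - r) dz\<close> along the two rays
  \<open>arg z = \<plusminus>\<theta>\<close> with \<open>\<pi>/2 < \<theta> < \<pi>/(2\<alpha>)\<close>: there \<open>Re z < 0\<close>, while \<open>exp(-z\<^sup>\<alpha>)\<close> still decays.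
\<close>

text \<open>The substitution \<open>z = exp w\<close> turns the rays into the lines Im w =
  +-\<theta> and z^\<alpha> into \<open>exp (\<alpha> * w)\<close>, which is entire: no branch cut
  appears, and the Cauchy integral becomes a residue at \<open>ln r\<close> in growing rectangles.
  The derivative is what makes the estimates converge. A Gaussian of parameter s with a homogeneous
  factor of degree d has a kernel of L1 norm of order s^(-d/2). For d = 3 the Laplace integral
  producing 1/|\<xi>|^2 has a finite bound; for d = 2, the projection alone, the bound would
  diverge. Likewise |Re z|^(-1/2) against |dz| leaves exp(x/2), integrable as x tends to minus
  infinity. The resolvent symbols decay in general only like 1/|\<xi>|, so they are not integrable.
  They are therefore damped by a factor \<open>gauss \<epsilon>\<close>; the bounds do not depend on
  \<epsilon> and pass to the limit by Fatou's lemma. The norm of \<open>GX\<close> sees only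
  essential suprema, whereas the equation is imposed at every point. The Duhamel term converts
  bounds almost everywhere into bounds at every point, which lets the iteration converge
  pointwise.\<close>

unbundle no Formal_Power_Series.fps_syntax
hide_const (open) Convolution.convolution
hide_fact (open) Convolution.convolution_def

lemmas integrable_dominated = Bochner_Integration.integrable_bound

section \<open>Affine substitutions and integrable weights\<close>

lemma lborel_nn_integral_affine:
  fixes f :: "'a::euclidean_space \<Rightarrow> ennreal"
  assumes [measurable]: "f \<in> borel_measurable borel" and "c \<noteq> 0"
  shows "(\<integral>\<^sup>+x. f x \<partial>lborel) = ennreal (\<bar>c\<bar> ^ DIM('a)) * (\<integral>\<^sup>+x. f (t + c *\<^sub>R x) \<partial>lborel)"
  using assms(2)
  by (subst lborel_affine[OF assms(2), of t])
     (simp add: nn_integral_density nn_integral_distr nn_integral_cmult ennreal_power)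

lemma lborel_integral_affine:
  fixes f :: "'a::euclidean_space \<Rightarrow> 'b::{banach, second_countable_topology}"
  assumes [measurable]: "f \<in> borel_measurable borel" and c: "c \<noteq> 0"
  shows "(\<integral>x. f x \<partial>lborel) = \<bar>c\<bar> ^ DIM('a) *\<^sub>R (\<integral>x. f (t + c *\<^sub>R x) \<partial>lborel)"
  using c
  by (subst lborel_affine[OF c, of t])
     (simp add: integral_density integral_distr)

lemma integrable_lborel_affine:
  fixes f :: "'a::euclidean_space \<Rightarrow> 'b::{banach, second_countable_topology}"
  assumes f: "integrable lborel f" and c: "c \<noteq> 0"
  shows "integrable lborel (\<lambda>x. f (t + c *\<^sub>R x))"
proof -
  have [measurable]: "f \<in> borel_measurable borel"
    using borel_measurable_integrable[OF f] by simp
  have "(\<integral>\<^sup>+x. norm (f x) \<partial>lborel) = ennreal (\<bar>c\<bar> ^ DIM('a)) * (\<integral>\<^sup>+x. norm (f (t + c *\<^sub>R x)) \<partial>lborel)"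
    by (rule lborel_nn_integral_affine) (use c in auto)
  moreover have "(\<integral>\<^sup>+x. norm (f x) \<partial>lborel) < \<infinity>"
    using f by (simp add: integrable_iff_bounded)
  ultimately show ?thesis
    using c by (auto simp: integrable_iff_bounded ennreal_mult_less_top)
qed

text \<open>Each factor 1 + (x . b)^2 is at most (1 + |x|)^2, one square per coordinate, so the
  weight lies below a product of functions of one variable and the integral factorises.\<close>

lemma integrable_inverse_weight:
  "integrable lborel (\<lambda>x::real^'n::finite. inverse ((1 + norm x) ^ (2 * CARD('n))))"
proof (rule integrableI_bounded)
  let ?h = "\<lambda>t::real. inverse (1 + t\<^sup>2)"
  have le: "inverse ((1 + norm x) ^ (2 * CARD('n))) \<le> (\<Prod>b\<in>Basis. ?h (x \<bullet> b))" for x :: "real^'n"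
  proof -
    have "(\<Prod>b\<in>Basis. 1 + (x \<bullet> b)\<^sup>2) \<le> (\<Prod>b\<in>(Basis::(real^'n) set). (1 + norm x)\<^sup>2)"
    proof (intro prod_mono conjI)
      fix b :: "real^'n" assume "b \<in> Basis"
      then have "(x \<bullet> b)\<^sup>2 \<le> (norm x)\<^sup>2"
        using Basis_le_norm[of b x] by (metis abs_le_square_iff abs_norm_cancel)
      then show "1 + (x \<bullet> b)\<^sup>2 \<le> (1 + norm x)\<^sup>2"
        using norm_ge_zero[of x] by (simp only: power2_sum one_power2)
    qed (simp add: add_nonneg_nonneg)
    also have "\<dots> = (1 + norm x) ^ (2 * CARD('n))"
      by (simp add: power_mult)
    finally have "inverse ((1 + norm x) ^ (2 * CARD('n))) \<le> inverse (\<Prod>b\<in>Basis. 1 + (x \<bullet> b)\<^sup>2)"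
      by (intro le_imp_inverse_le prod_pos) (auto intro!: add_pos_nonneg)
    then show ?thesis
      by (simp add: prod_inversef[symmetric] comp_def)
  qed
  have "integrable lborel ?h"
    using integrable_inverse_1_plus_square by (simp add: set_integrable_def)
  then have fin: "(\<integral>\<^sup>+t. ?h t \<partial>lborel) < \<infinity>"
    by (auto simp: integrable_iff_bounded)
  have "(\<integral>\<^sup>+x. norm (inverse ((1 + norm (x::real^'n)) ^ (2 * CARD('n)))) \<partial>lborel)
      \<le> (\<integral>\<^sup>+x. (\<Prod>b\<in>(Basis::(real^'n) set). ennreal (?h (x \<bullet> b))) \<partial>lborel)"
    by (intro nn_integral_mono) (simp add: prod_ennreal ennreal_leI le)
  also have "\<dots> = (\<Prod>b\<in>(Basis::(real^'n) set). (\<integral>\<^sup>+t. ?h t \<partial>lborel))"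
    by (rule nn_integral_lborel_prod) auto
  also have "\<dots> < \<infinity>"
    using fin by (simp add: less_top[symmetric] ennreal_prod_eq_top power_eq_top_ennreal)
  finally show "(\<integral>\<^sup>+x. norm (inverse ((1 + norm (x::real^'n)) ^ (2 * CARD('n)))) \<partial>lborel) < \<infinity>" .
qed measurable

lemma integrable_rapid_decay:
  fixes f :: "real^'n::finite \<Rightarrow> 'b::{banach, second_countable_topology}"
  assumes [measurable]: "f \<in> borel_measurable borel"
    and C: "\<And>x. (1 + norm x) ^ (2 * CARD('n)) * norm (f x) \<le> C"
  shows "integrable lborel f"
proof (rule integrable_dominated)
  show "integrable lborel (\<lambda>x::real^'n. C * inverse ((1 + norm x) ^ (2 * CARD('n))))"
    by (intro integrable_mult_right integrable_inverse_weight)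
  have "norm (f x) \<le> C * inverse ((1 + norm x) ^ (2 * CARD('n)))" for x
    using C[of x] by (simp add: field_simps add_pos_nonneg)
  then show "AE x in lborel. norm (f x) \<le> norm (C * inverse ((1 + norm x) ^ (2 * CARD('n))))"
    by (intro AE_I2) (metis abs_ge_self order_trans real_norm_def)
qed simp

section \<open>Schwartz functions\<close>

lemma partial_eqI: "(f has_derivative f') (at x) \<Longrightarrow> partial k f x = f' (axis k 1)"
  unfolding partial_def by (metis frechet_derivative_at)

lemma has_derivative_partial:
  fixes f :: "real^'n::finite \<Rightarrow> 'b::real_normed_vector"
  assumes "f differentiable at x"
  shows "(f has_derivative (\<lambda>h. \<Sum>k\<in>UNIV. (h $ k) *\<^sub>R partial k f x)) (at x)"
proof -
  have d: "(f has_derivative frechet_derivative f (at x)) (at x)"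
    using assms frechet_derivative_works by blast
  interpret linear "frechet_derivative f (at x)"
    using d has_derivative_linear by blast
  have "frechet_derivative f (at x) h = (\<Sum>k\<in>UNIV. (h $ k) *\<^sub>R partial k f x)" for h
  proof -
    have "h = (\<Sum>k\<in>UNIV. (h $ k) *\<^sub>R axis k 1)"
      using basis_expansion[of h] by (simp add: scalar_mult_eq_scaleR)
    then have "frechet_derivative f (at x) h = frechet_derivative f (at x) (\<Sum>k\<in>UNIV. (h $ k) *\<^sub>R axis k 1)"
      by simp
    also have "\<dots> = (\<Sum>k\<in>UNIV. (h $ k) *\<^sub>R partial k f x)"
      by (simp add: sum scale partial_def)
    finally show ?thesis .
  qed
  then have "frechet_derivative f (at x) = (\<lambda>h. \<Sum>k\<in>UNIV. (h $ k) *\<^sub>R partial k f x)" by auto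
  with d show ?thesis by simp
qed

lemma sum_axis_partial: "(\<Sum>j\<in>UNIV. (axis k 1 $ j) *\<^sub>R partial j f x) = partial k f x"
  by (subst sum.remove[of _ k]) (auto simp: axis_def intro!: sum.neutral)

lemma partials_append: "partials (ks @ ls) f = partials ks (partials ls f)"
  by (induction ks) auto

text \<open>Coinduction: the Schwartz space is the largest class of differentiable, rapidly decreasing functions
  that is closed under partial derivatives.\<close>

lemma schwartz_coinduct:
  assumes f: "f \<in> S"
    and diff: "\<And>g x. g \<in> S \<Longrightarrow> g differentiable at x"
    and decay: "\<And>g N. g \<in> S \<Longrightarrow> \<exists>C. \<forall>x. (1 + norm x) ^ N * norm (g x) \<le> C"
    and closed: "\<And>g k. g \<in> S \<Longrightarrow> partial k g \<in> S"
  shows "f \<in> schwartz"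
proof -
  have "partials ks f \<in> S" for ks
    by (induction ks) (auto intro: f closed)
  then show ?thesis
    unfolding schwartz_def smooth_def using diff decay by blast
qed

lemma schwartz_differentiable: "f \<in> schwartz \<Longrightarrow> f differentiable at x"
  unfolding schwartz_def smooth_def mem_Collect_eq by (metis partials.simps(1))

lemma schwartz_decay: "f \<in> schwartz \<Longrightarrow> \<exists>C. \<forall>x. (1 + norm x) ^ N * norm (f x) \<le> C"
  unfolding schwartz_def mem_Collect_eq by (metis partials.simps(1))

lemma schwartz_partial: "f \<in> schwartz \<Longrightarrow> partial k f \<in> schwartz"
proof -
  assume f: "f \<in> schwartz"
  have "partials ks (partial k f) = partials (ks @ [k]) f" for ks
    by (simp add: partials_append)
  then show ?thesis using f unfolding schwartz_def smooth_def by auto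
qed

lemma schwartz_continuous: "f \<in> schwartz \<Longrightarrow> continuous_on A f"
  by (meson continuous_at_imp_continuous_on differentiable_imp_continuous_within schwartz_differentiable)

lemma schwartz_measurable: "f \<in> schwartz \<Longrightarrow> f \<in> borel_measurable borel"
  by (simp add: borel_measurable_continuous_onI schwartz_continuous)

lemma schwartz_integrable:
  assumes "f \<in> schwartz" shows "integrable lborel f"
  using schwartz_decay[OF assms] schwartz_measurable[OF assms] integrable_rapid_decay by metis

text \<open>A Gaussian alone is not closed under differentiation, but its derivatives are polynomial
  multiples of it. The hull collects exactly such combinations, so that a coinduction set may be as
  small as a singleton.\<close>

inductive_set schwartz_hull :: "(real^'n::finite \<Rightarrow> complex) set \<Rightarrow> (real^'n \<Rightarrow> complex) set" for S where
  base: "f \<in> S \<Longrightarrow> f \<in> schwartz_hull S"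
| coord: "f \<in> schwartz_hull S \<Longrightarrow> (\<lambda>x. complex_of_real (x $ l) * f x) \<in> schwartz_hull S"
| comb: "f \<in> schwartz_hull S \<Longrightarrow> g \<in> schwartz_hull S \<Longrightarrow> (\<lambda>x. a * f x + b * g x) \<in> schwartz_hull S"

text \<open>Coinduction up to polynomial combinations.\<close>

lemma schwartz_coinduct_upto:
  assumes f: "f \<in> schwartz_hull S"
    and diff: "\<And>g x. g \<in> S \<Longrightarrow> g differentiable at x"
    and decay: "\<And>g N. g \<in> S \<Longrightarrow> \<exists>C. \<forall>x. (1 + norm x) ^ N * norm (g x) \<le> C"
    and closed: "\<And>g k. g \<in> S \<Longrightarrow> partial k g \<in> schwartz_hull S"
  shows "f \<in> schwartz"
proof -
  have props: "(\<forall>x. f differentiable at x) \<and> (\<forall>N. \<exists>C. \<forall>x. (1 + norm x) ^ N * norm (f x) \<le> C)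
    \<and> (\<forall>k. partial k f \<in> schwartz_hull S)" if "f \<in> schwartz_hull S" for f
    using that
  proof induction
    case (base f)
    then show ?case using diff decay closed by blast
  next
    case (coord f l)
    have cd: "((\<lambda>x::real^'a. complex_of_real (x $ l)) has_derivative (\<lambda>h. complex_of_real (h $ l))) (at x)" for x
      by (intro bounded_linear_imp_has_derivative bounded_linear_compose[OF bounded_linear_of_real bounded_linear_vec_nth])
    have D: "((\<lambda>x. complex_of_real (x $ l) * f x) has_derivative
        (\<lambda>h. complex_of_real (x $ l) * (\<Sum>k\<in>UNIV. (h $ k) *\<^sub>R partial k f x) + complex_of_real (h $ l) * f x)) (at x)" for x
      by (intro has_derivative_mult cd has_derivative_partial) (use coord in blast)
    have "\<exists>C. \<forall>x. (1 + norm x) ^ N * norm (complex_of_real (x $ l) * f x) \<le> C" for N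
    proof -
      obtain C where C: "\<And>x. (1 + norm x) ^ (Suc N) * norm (f x) \<le> C" using coord by metis
      have "(1 + norm x) ^ N * norm (complex_of_real (x $ l) * f x) \<le> C" for x
      proof -
        have "(1 + norm x) ^ N * norm (complex_of_real (x $ l) * f x) \<le> (1 + norm x) ^ N * ((1 + norm x) * norm (f x))"
          using component_le_norm_cart[of x l]
          by (intro mult_left_mono) (auto simp: norm_mult intro!: mult_right_mono)
        also have "\<dots> \<le> C" using C[of x] by (simp add: mult_ac)
        finally show ?thesis .
      qed
      then show ?thesis by blast
    qed
    moreover have "partial k (\<lambda>x. complex_of_real (x $ l) * f x) \<in> schwartz_hull S" for k
    proof -
      have "partial k (\<lambda>x. complex_of_real (x $ l) * f x)
          = (\<lambda>x. 1 * (complex_of_real (x $ l) * partial k f x) + (if k = l then 1 else 0) * f x)"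
        by (rule ext, subst partial_eqI[OF D], simp only: sum_axis_partial) (auto simp: axis_def)
      then show ?thesis using coord by (simp only: schwartz_hull.comb schwartz_hull.coord)
    qed
    ultimately show ?case using D unfolding differentiable_def by blast
  next
    case (comb f g a b)
    have D: "((\<lambda>x. a * f x + b * g x) has_derivative
        (\<lambda>h. a * (\<Sum>k\<in>UNIV. (h $ k) *\<^sub>R partial k f x) + b * (\<Sum>k\<in>UNIV. (h $ k) *\<^sub>R partial k g x))) (at x)" for x
      by (intro has_derivative_add has_derivative_mult_right has_derivative_partial) (use comb in blast)+
    have "\<exists>C. \<forall>x. (1 + norm x) ^ N * norm (a * f x + b * g x) \<le> C" for N
    proof -
      obtain C where C: "\<And>x. (1 + norm x) ^ N * norm (f x) \<le> C" using comb by metis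
      obtain D where D: "\<And>x. (1 + norm x) ^ N * norm (g x) \<le> D" using comb by metis
      have "(1 + norm x) ^ N * norm (a * f x + b * g x) \<le> norm a * C + norm b * D" for x
      proof -
        have "(1 + norm x) ^ N * norm (a * f x + b * g x) \<le> (1 + norm x) ^ N * (norm a * norm (f x) + norm b * norm (g x))"
          by (intro mult_left_mono norm_triangle_le) (auto simp: norm_mult)
        also have "\<dots> = norm a * ((1 + norm x) ^ N * norm (f x)) + norm b * ((1 + norm x) ^ N * norm (g x))"
          by (simp add: algebra_simps)
        also have "\<dots> \<le> norm a * C + norm b * D"
          by (intro add_mono mult_left_mono C D) auto
        finally show ?thesis .
      qed
      then show ?thesis by blast
    qed
    moreover have "partial k (\<lambda>x. a * f x + b * g x) \<in> schwartz_hull S" for k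
    proof -
      have "partial k (\<lambda>x. a * f x + b * g x) = (\<lambda>x. a * partial k f x + b * partial k g x)"
        by (rule ext, subst partial_eqI[OF D]) (simp only: sum_axis_partial)
      then show ?thesis using comb by (simp only: schwartz_hull.comb)
    qed
    ultimately show ?case using D unfolding differentiable_def by blast
  qed
  show ?thesis
    by (rule schwartz_coinduct[OF f]) (use props in blast)+
qed

lemma schwartz_affine_combination:
  assumes "f \<in> schwartz" "g \<in> schwartz"
  shows "(\<lambda>x. a * f x + b * g x) \<in> schwartz"
  by (rule schwartz_coinduct_upto[where S = schwartz])
    (intro schwartz_hull.intros assms schwartz_differentiable schwartz_decay schwartz_partial; assumption)+

lemma schwartz_diff: "f \<in> schwartz \<Longrightarrow> g \<in> schwartz \<Longrightarrow> (\<lambda>x. f x - g x) \<in> schwartz"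
  using schwartz_affine_combination[of f g 1 "-1"] by simp

lemma schwartz_cmult: "f \<in> schwartz \<Longrightarrow> (\<lambda>x. a * f x) \<in> schwartz"
  using schwartz_affine_combination[of f f a 0] by simp

lemma schwartz_coord:
  assumes "f \<in> schwartz"
  shows "(\<lambda>x. complex_of_real (x $ l) * f x) \<in> schwartz"
  by (rule schwartz_coinduct_upto[where S = schwartz])
    (intro schwartz_hull.intros assms schwartz_differentiable schwartz_decay schwartz_partial; assumption)+

text \<open>Peetre's inequality: a weight moves from one point to another at the price of a weight
  in the difference.\<close>

lemma weight_triangle:
  fixes x y :: "'a::real_normed_vector"
  shows "(1 + norm y) ^ N \<le> (1 + norm x) ^ N * (1 + norm (x - y)) ^ N"
proof -
  have "1 + norm y \<le> (1 + norm x) + norm (x - y)"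
    using norm_triangle_sub[of y x] by (simp add: norm_minus_commute)
  also have "\<dots> \<le> (1 + norm x) * (1 + norm (x - y))" by (simp add: algebra_simps)
  finally show ?thesis
    by (metis power_mono power_mult_distrib norm_ge_zero add_nonneg_nonneg zero_le_one)
qed

lemma norm_lebesgue_integral_le:
  fixes f :: "'a \<Rightarrow> 'b::{banach, second_countable_topology}"
  assumes g: "integrable M g" and le: "AE x in M. norm (f x) \<le> g x"
  shows "norm (LINT x|M. f x) \<le> (LINT x|M. g x)"
proof (cases "integrable M f")
  case True
  have "norm (LINT x|M. f x) \<le> (LINT x|M. norm (f x))" by (rule integral_norm_bound)
  also have "\<dots> \<le> (LINT x|M. g x)"
    by (intro integral_mono_AE integrable_norm True g le)
  finally show ?thesis .
next
  case False
  have "0 \<le> (LINT x|M. g x)"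
    by (rule integral_nonneg_AE) (use le in eventually_elim, use norm_ge_zero order_trans in blast)
  then show ?thesis using False by (simp add: not_integrable_integral_eq)
qed

text \<open>Mean value inequality along the segment from \<open>x\<close> to \<open>x + h\<close>.
  The derivative decays at the intermediate point; Peetre's inequality moves that decay back to
  \<open>x\<close> and costs the factor \<open>(1 + norm h) ^ N\<close>. The result dominates
  difference quotients and makes translation continuous in every seminorm.\<close>

lemma schwartz_difference:
  fixes f :: "real^'n::finite \<Rightarrow> complex"
  assumes f: "f \<in> schwartz"
  obtains C where "C \<ge> 0"
    and "\<And>x h. (1 + norm x) ^ N * norm (f (x + h) - f x) \<le> C * (1 + norm h) ^ N * norm h"
proof -
  have "\<exists>C. \<forall>x. (1 + norm x) ^ N * norm (partial k f x) \<le> C" for k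
    using schwartz_decay schwartz_partial[OF f] by blast
  then obtain D where D: "\<And>k x. (1 + norm x) ^ N * norm (partial k f x) \<le> D k" by metis
  define C where "C = (\<Sum>k\<in>UNIV. D k)"
  have D0: "D k \<ge> 0" for k
    by (rule order_trans[OF _ D[where x=0]]) simp
  have C0: "C \<ge> 0" unfolding C_def by (intro sum_nonneg D0)
  have "(1 + norm x) ^ N * norm (f (x + h) - f x) \<le> C * (1 + norm h) ^ N * norm h" for x h
  proof -
    define B where "B = C * (1 + norm h) ^ N / (1 + norm x) ^ N"
    have pos: "(1 + norm x) ^ N > 0" by (intro zero_less_power add_pos_nonneg) auto
    have "norm (f (x + h) - f x) \<le> norm h * B"
    proof (rule differentiable_bound_segment[where G = UNIV])
      show "(f has_derivative (\<lambda>h. \<Sum>k\<in>UNIV. (h $ k) *\<^sub>R partial k f z)) (at z)" for z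
        by (rule has_derivative_partial[OF schwartz_differentiable[OF f]])
      fix s :: real assume s: "s \<in> {0..1}"
      define z where "z = x + s *\<^sub>R h"
      have "onorm (\<lambda>h. \<Sum>k\<in>UNIV. (h $ k) *\<^sub>R partial k f z) \<le> B"
      proof (rule onorm_bound)
        show "0 \<le> B" unfolding B_def using C0 pos by simp
        fix v :: "real^'n"
        have "(1 + norm x) ^ N \<le> (1 + norm z) ^ N * (1 + norm (z - x)) ^ N" by (rule weight_triangle)
        also have "\<dots> \<le> (1 + norm z) ^ N * (1 + norm h) ^ N"
          using s by (intro mult_left_mono power_mono) (auto simp: z_def mult_left_le_one_le)
        finally have z: "(1 + norm x) ^ N \<le> (1 + norm z) ^ N * (1 + norm h) ^ N" .
        have posz: "(1 + norm z) ^ N > 0" by (intro zero_less_power add_pos_nonneg) auto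
        have "norm (\<Sum>k\<in>UNIV. (v $ k) *\<^sub>R partial k f z) \<le> (\<Sum>k\<in>UNIV. norm v * (D k / (1 + norm z) ^ N))"
        proof (rule sum_norm_le)
          fix k
          have "norm (partial k f z) \<le> D k / (1 + norm z) ^ N"
            using D[of z k] posz by (simp add: field_simps)
          then show "norm ((v $ k) *\<^sub>R partial k f z) \<le> norm v * (D k / (1 + norm z) ^ N)"
            unfolding norm_scaleR using component_le_norm_cart[of v k] by (intro mult_mono) auto
        qed
        also have "\<dots> = norm v * (C / (1 + norm z) ^ N)"
          by (simp add: C_def sum_distrib_left sum_divide_distrib)
        finally have le: "norm (\<Sum>k\<in>UNIV. (v $ k) *\<^sub>R partial k f z) \<le> norm v * (C / (1 + norm z) ^ N)" .
        have "C / (1 + norm z) ^ N \<le> B"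
        proof -
          have "C * (1 + norm x) ^ N \<le> C * ((1 + norm z) ^ N * (1 + norm h) ^ N)"
            by (intro mult_left_mono z C0)
          then show ?thesis unfolding B_def using pos posz by (simp add: field_simps)
        qed
        then show "norm (\<Sum>k\<in>UNIV. (v $ k) *\<^sub>R partial k f z) \<le> B * norm v"
          using le mult_left_mono[of "C / (1 + norm z) ^ N" B "norm v"] by (simp add: mult.commute)
      qed
      then show "onorm (\<lambda>v. \<Sum>k\<in>UNIV. (v $ k) *\<^sub>R partial k f (x + s *\<^sub>R h)) \<le> B"
        by (simp add: z_def)
    qed simp
    then have "(1 + norm x) ^ N * norm (f (x + h) - f x) \<le> (1 + norm x) ^ N * (norm h * B)"
      using pos by (intro mult_left_mono) auto
    also have "\<dots> = C * (1 + norm h) ^ N * norm h"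
      unfolding B_def using norm_ge_zero[of x] by (simp add: mult_ac add_nonneg_eq_0_iff)
    finally show ?thesis .
  qed
  with C0 that show thesis by blast
qed

section \<open>The inverse Fourier transform on the Schwartz space\<close>

lemma continuous_on_cis_inner: "continuous_on A (\<lambda>\<xi>. cis (x \<bullet> \<xi>))"
  unfolding cis_conv_exp by (intro continuous_intros)

lemma borel_measurable_cis_inner [measurable]: "(\<lambda>\<xi>. cis (x \<bullet> \<xi>)) \<in> borel_measurable borel"
  by (intro borel_measurable_continuous_onI continuous_on_cis_inner)

lemma integrable_cis_mult:
  assumes "integrable lborel m"
  shows "integrable lborel (\<lambda>\<xi>::real^'n::finite. cis (x \<bullet> \<xi>) * m \<xi>)"
  by (rule integrable_dominated[OF assms])
     (use borel_measurable_integrable[OF assms] in \<open>auto simp: norm_mult\<close>)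

lemma norm_inv_fourier_le:
  fixes m :: "real^'n::finite \<Rightarrow> complex"
  shows "norm (inv_fourier m x) \<le> (1 / (2 * pi) ^ CARD('n)) * (LINT \<xi>|lborel. norm (m \<xi>))"
proof -
  have "norm (LINT \<xi>|lborel. cis (x \<bullet> \<xi>) * m \<xi>) \<le> (LINT \<xi>|lborel. norm (cis (x \<bullet> \<xi>) * m \<xi>))"
    by (rule integral_norm_bound)
  then show ?thesis
    unfolding inv_fourier_def by (simp add: norm_mult norm_divide norm_power divide_right_mono)
qed

lemma inv_fourier_cmult: "inv_fourier (\<lambda>\<xi>. c * m \<xi>) x = c * inv_fourier m x"
proof -
  have "(\<lambda>\<xi>. cis (x \<bullet> \<xi>) * (c * m \<xi>)) = (\<lambda>\<xi>. c * (cis (x \<bullet> \<xi>) * m \<xi>))" by (auto simp: algebra_simps)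
  then show ?thesis unfolding inv_fourier_def by simp
qed

lemma inv_fourier_add:
  assumes "integrable lborel m" "integrable lborel m'"
  shows "inv_fourier (\<lambda>\<xi>. m \<xi> + m' \<xi>) x = inv_fourier m x + inv_fourier m' x"
  unfolding inv_fourier_def
  using integrable_cis_mult[OF assms(1)] integrable_cis_mult[OF assms(2)]
  by (simp add: distrib_left)

text \<open>The linear part is subtracted under the integral sign. What remains is |e^(ib) - 1 - ib|
  \<le> b^2 with b = (y - x) . \<xi>, so the error is quadratic in y - x, with the second moment
  \<open>I\<close> of \<open>m\<close> as constant.\<close>

lemma inv_fourier_has_derivative:
  fixes m :: "real^'n::finite \<Rightarrow> complex"
  assumes m: "m \<in> schwartz"
  shows "(inv_fourier m has_derivative
    (\<lambda>h. \<Sum>k\<in>UNIV. (h $ k) *\<^sub>R inv_fourier (\<lambda>\<xi>. \<i> * (complex_of_real (\<xi> $ k) * m \<xi>)) x)) (at x)"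
    (is "(_ has_derivative ?D) _")
proof -
  define c where "c = 1 / (2 * pi) ^ CARD('n)"
  have c0: "c \<ge> 0" unfolding c_def by simp
  define I where "I = (LINT \<xi>|lborel. (norm \<xi>)\<^sup>2 * norm (m \<xi>))"
  have mk: "(\<lambda>\<xi>. \<i> * (complex_of_real (\<xi> $ k) * m \<xi>)) \<in> schwartz" for k
    by (intro schwartz_cmult schwartz_coord m)
  have i2: "integrable lborel (\<lambda>\<xi>. (norm \<xi>)\<^sup>2 * norm (m \<xi>))"
  proof -
    have "(\<lambda>\<xi>. complex_of_real (\<xi> $ k) * (complex_of_real (\<xi> $ k) * m \<xi>)) \<in> schwartz" for k
      by (intro schwartz_coord m)
    from integrable_norm[OF schwartz_integrable[OF this]]
    have "integrable lborel (\<lambda>\<xi>. (\<xi> $ k)\<^sup>2 * norm (m \<xi>))" for k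
      by (simp add: norm_mult power2_eq_square abs_mult_self_eq flip: mult.assoc)
    then have "integrable lborel (\<lambda>\<xi>. \<Sum>k\<in>UNIV. (\<xi> $ k)\<^sup>2 * norm (m \<xi>))" by auto
    then show ?thesis
      by (simp add: norm_eq_sqrt_inner inner_vec_def power2_eq_square sum_distrib_right sum_nonneg flip: real_sqrt_mult)
  qed
  have key: "norm (inv_fourier m y - inv_fourier m x - ?D (y - x)) \<le> c * I * (norm (y - x))\<^sup>2" for y
  proof -
    let ?S = "\<lambda>\<xi>. \<Sum>k\<in>UNIV. complex_of_real ((y - x) $ k) * (cis (x \<bullet> \<xi>) * (\<i> * (complex_of_real (\<xi> $ k) * m \<xi>)))"
    let ?L = "\<lambda>\<xi>. \<i> * complex_of_real ((y - x) \<bullet> \<xi>) * cis (x \<bullet> \<xi>) * m \<xi>"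
    have SL: "?S = ?L"
      by (rule ext) (simp add: inner_vec_def sum_distrib_left sum_distrib_right algebra_simps)
    define r where "r \<xi> = (cis (y \<bullet> \<xi>) - cis (x \<bullet> \<xi>) - \<i> * complex_of_real ((y - x) \<bullet> \<xi>) * cis (x \<bullet> \<xi>)) * m \<xi>" for \<xi>
    have "?D (y - x) = (\<Sum>k\<in>UNIV. complex_of_real c *
        (LINT \<xi>|lborel. complex_of_real ((y - x) $ k) * (cis (x \<bullet> \<xi>) * (\<i> * (complex_of_real (\<xi> $ k) * m \<xi>)))))"
      unfolding inv_fourier_def c_def[symmetric] integral_mult_right_zero scaleR_conv_of_real
      by (rule sum.cong[OF refl]) (simp only: mult.left_commute)
    also have "\<dots> = complex_of_real c * integral\<^sup>L lborel ?S"
      unfolding sum_distrib_left[symmetric]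
      by (rule arg_cong[where f = "\<lambda>z. complex_of_real c * z"], rule Bochner_Integration.integral_sum[symmetric])
         (intro integrable_mult_right integrable_cis_mult schwartz_integrable mk)
    also note SL
    finally have D: "?D (y - x) = complex_of_real c * (LINT \<xi>|lborel. ?L \<xi>)" .
    have "integrable lborel ?S"
      by (intro Bochner_Integration.integrable_sum integrable_mult_right integrable_cis_mult schwartz_integrable mk)
    then have iD: "integrable lborel ?L" unfolding SL .
    note im = integrable_cis_mult[OF schwartz_integrable[OF m]]
    have "inv_fourier m y - inv_fourier m x - ?D (y - x) = complex_of_real c * (LINT \<xi>|lborel. r \<xi>)"
      unfolding D r_def left_diff_distrib
      by (subst Bochner_Integration.integral_diff, intro Bochner_Integration.integrable_diff im, rule iD,
          subst Bochner_Integration.integral_diff, rule im, rule im)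
         (simp add: inv_fourier_def c_def algebra_simps)
    then have "norm (inv_fourier m y - inv_fourier m x - ?D (y - x)) = c * norm (LINT \<xi>|lborel. r \<xi>)"
      using c0 by (simp add: norm_mult)
    also have "norm (LINT \<xi>|lborel. r \<xi>) \<le> (LINT \<xi>|lborel. (norm (y - x))\<^sup>2 * ((norm \<xi>)\<^sup>2 * norm (m \<xi>)))"
    proof (rule norm_lebesgue_integral_le[OF _ AE_I2])
      show "integrable lborel (\<lambda>\<xi>. (norm (y - x))\<^sup>2 * ((norm \<xi>)\<^sup>2 * norm (m \<xi>)))"
        by (intro integrable_mult_right i2)
      fix \<xi>
      define b where "b = (y - x) \<bullet> \<xi>"
      have "cis (y \<bullet> \<xi>) = cis (x \<bullet> \<xi>) * cis b"
        by (simp add: b_def cis_mult inner_diff_left)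
      then have "r \<xi> = cis (x \<bullet> \<xi>) * (cis b - 1 - \<i> * complex_of_real b) * m \<xi>"
        unfolding r_def b_def[symmetric] by (simp add: algebra_simps)
      then have "norm (r \<xi>) = norm (cis b - 1 - \<i> * complex_of_real b) * norm (m \<xi>)"
        by (simp add: norm_mult)
      also have "norm (cis b - 1 - \<i> * complex_of_real b) \<le> b\<^sup>2"
      proof -
        have "2 * norm (cis b - 1 - \<i> * complex_of_real b) \<le> b\<^sup>2"
          using iexp_approx1[of b 1] by (simp add: cis_conv_exp power2_eq_square diff_diff_add)
        then show ?thesis using norm_ge_zero[of "cis b - 1 - \<i> * complex_of_real b"] by linarith
      qed
      also have "b\<^sup>2 \<le> (norm (y - x) * norm \<xi>)\<^sup>2"
        unfolding b_def using Cauchy_Schwarz_ineq2[of "y - x" \<xi>] by (simp add: abs_le_square_iff[symmetric])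
      finally show "norm (r \<xi>) \<le> (norm (y - x))\<^sup>2 * ((norm \<xi>)\<^sup>2 * norm (m \<xi>))"
        by (simp add: mult_right_mono power_mult_distrib mult.assoc)
    qed
    also have "\<dots> = I * (norm (y - x))\<^sup>2" by (simp add: I_def)
    finally show ?thesis using c0 by (simp add: mult_left_mono mult.assoc)
  qed
  show ?thesis
  proof (rule has_derivativeI_sandwich[where e = 1 and H = "\<lambda>y. c * I * norm (y - x)"])
    show "bounded_linear ?D"
      by (intro bounded_linear_sum bounded_linear_scaleR_const bounded_linear_vec_nth)
    show "((\<lambda>y. c * I * norm (y - x)) \<longlongrightarrow> 0) (at x)"
      by (rule tendsto_eq_intros | simp)+
    fix y assume "y \<noteq> x"
    then show "norm (inv_fourier m y - inv_fourier m x - ?D (y - x)) / norm (y - x) \<le> c * I * norm (y - x)"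
      using key[of y] by (simp add: field_simps power2_eq_square)
  qed simp
qed

lemma partial_inv_fourier:
  assumes "m \<in> schwartz"
  shows "partial k (inv_fourier m) = inv_fourier (\<lambda>\<xi>. \<i> * (complex_of_real (\<xi> $ k) * m \<xi>))"
  by (rule ext, subst partial_eqI[OF inv_fourier_has_derivative[OF assms]])
     (subst sum.remove[of _ k], auto simp: axis_def intro!: sum.neutral)

text \<open>Integration by parts without boundary terms: a difference quotient has integral 0 by
  translation invariance, and dominated convergence carries this to the derivative.\<close>

lemma integral_partial_schwartz:
  fixes f :: "real^'n::finite \<Rightarrow> complex"
  assumes f: "f \<in> schwartz"
  shows "(LINT x|lborel. partial k f x) = 0"
proof -
  define e :: "real^'n" where "e = axis k 1"
  define h where "h j = 1 / real (Suc j)" for j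
  define q where "q j x = (f (x + h j *\<^sub>R e) - f x) /\<^sub>R h j" for j x
  have h: "0 < h j" "h j \<le> 1" for j by (auto simp: h_def)
  have ne: "norm e = 1" by (simp add: e_def)
  note [measurable] = schwartz_measurable[OF f] schwartz_measurable[OF schwartz_partial[OF f]]
  have shift: "integrable lborel (\<lambda>x. f (x + h j *\<^sub>R e))" "(LINT x|lborel. f (x + h j *\<^sub>R e)) = (LINT x|lborel. f x)" for j
    using integrable_lborel_affine[OF schwartz_integrable[OF f], of 1 "h j *\<^sub>R e"]
      lborel_integral_affine[OF schwartz_measurable[OF f], of 1 "h j *\<^sub>R e"]
    by (simp_all add: add.commute)
  have "(LINT x|lborel. q j x) = 0" for j
    unfolding q_def using shift schwartz_integrable[OF f] by simp
  moreover obtain C where C: "C \<ge> 0"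
    "\<And>x h. (1 + norm x) ^ (2 * CARD('n)) * norm (f (x + h) - f x) \<le> C * (1 + norm h) ^ (2 * CARD('n)) * norm h"
    using schwartz_difference[OF f, of "2 * CARD('n)"] by metis
  have "(\<lambda>j. LINT x|lborel. q j x) \<longlonglongrightarrow> (LINT x|lborel. partial k f x)"
  proof (rule integral_dominated_convergence)
    \<comment> \<open>The power of 2 bounds the factor in the increment: the steps satisfy
      \<open>h j \<le> 1\<close>, so 1 + |h_j e| is at most 2.\<close>
    show "integrable lborel (\<lambda>x::real^'n. C * 2 ^ (2 * CARD('n)) * inverse ((1 + norm x) ^ (2 * CARD('n))))"
      by (intro integrable_mult_right integrable_inverse_weight)
    show "AE x in lborel. norm (q j x) \<le> C * 2 ^ (2 * CARD('n)) * inverse ((1 + norm x) ^ (2 * CARD('n)))" for j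
    proof (rule AE_I2)
      fix x :: "real^'n"
      have "(1 + norm x) ^ (2 * CARD('n)) * norm (f (x + h j *\<^sub>R e) - f x) \<le> C * (1 + norm (h j *\<^sub>R e)) ^ (2 * CARD('n)) * norm (h j *\<^sub>R e)"
        by (rule C)
      also have "\<dots> \<le> C * 2 ^ (2 * CARD('n)) * h j"
        using h[of j] C(1) by (intro mult_mono mult_left_mono power_mono) (auto simp: ne)
      finally have le: "(1 + norm x) ^ (2 * CARD('n)) * norm (f (x + h j *\<^sub>R e) - f x) \<le> C * 2 ^ (2 * CARD('n)) * h j" .
      have q: "norm (q j x) = norm (f (x + h j *\<^sub>R e) - f x) / h j"
        unfolding q_def norm_scaleR using h[of j] by (simp add: divide_inverse_commute)
      show "norm (q j x) \<le> C * 2 ^ (2 * CARD('n)) * inverse ((1 + norm x) ^ (2 * CARD('n)))"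
        using h[of j] le by (simp add: q field_simps add_pos_nonneg)
    qed
    show "AE x in lborel. (\<lambda>j. q j x) \<longlonglongrightarrow> partial k f x"
    proof (rule AE_I2)
      fix x
      have "((\<lambda>t. x + t *\<^sub>R e) has_derivative (\<lambda>t. t *\<^sub>R e)) (at 0)"
        by (auto intro!: derivative_eq_intros)
      from has_derivative_compose[OF this, of f "\<lambda>h. \<Sum>k\<in>UNIV. (h $ k) *\<^sub>R partial k f x"]
      have "((\<lambda>t. f (x + t *\<^sub>R e)) has_derivative (\<lambda>t. \<Sum>k\<in>UNIV. (t *\<^sub>R e) $ k *\<^sub>R partial k f x)) (at 0)"
        using has_derivative_partial[OF schwartz_differentiable[OF f, of x]] by simp
      moreover have "(\<Sum>k\<in>UNIV. (t *\<^sub>R e) $ k *\<^sub>R partial k f x) = t *\<^sub>R partial k f x" for t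
        unfolding e_def using sum_axis_partial[of k f x] by (simp flip: scaleR_scaleR scaleR_right.sum)
      ultimately have "((\<lambda>t. f (x + t *\<^sub>R e)) has_vector_derivative partial k f x) (at 0)"
        by (simp add: has_vector_derivative_def)
      then have "((\<lambda>t. norm (f (x + t *\<^sub>R e) - f x - t *\<^sub>R partial k f x) / norm t) \<longlongrightarrow> 0) (at 0)"
        by (simp add: has_vector_derivative_def has_derivative_at)
      moreover have "\<forall>\<^sub>F t in at 0. norm (f (x + t *\<^sub>R e) - f x - t *\<^sub>R partial k f x) / norm t
          = norm ((f (x + t *\<^sub>R e) - f x) /\<^sub>R t - partial k f x)"
      proof (rule eventually_at_filter[THEN iffD2], rule always_eventually, intro allI impI)
        fix t :: real assume "t \<noteq> 0"
        then have "(f (x + t *\<^sub>R e) - f x) /\<^sub>R t - partial k f x = (f (x + t *\<^sub>R e) - f x - t *\<^sub>R partial k f x) /\<^sub>R t"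
          by (simp add: scaleR_diff_right)
        then show "norm (f (x + t *\<^sub>R e) - f x - t *\<^sub>R partial k f x) / norm t
          = norm ((f (x + t *\<^sub>R e) - f x) /\<^sub>R t - partial k f x)"
          by (simp add: divide_inverse_commute)
      qed
      ultimately have "((\<lambda>t. norm ((f (x + t *\<^sub>R e) - f x) /\<^sub>R t - partial k f x)) \<longlongrightarrow> 0) (at 0)"
        by (rule Lim_transform_eventually)
      then have lim: "((\<lambda>t. (f (x + t *\<^sub>R e) - f x) /\<^sub>R t) \<longlongrightarrow> partial k f x) (at 0)"
        using Lim_null tendsto_norm_zero_iff by blast
      have "filterlim h (at 0) sequentially"
        unfolding h_def filterlim_at using LIMSEQ_inverse_real_of_nat by (auto simp: inverse_eq_divide)
      then show "(\<lambda>j. q j x) \<longlonglongrightarrow> partial k f x"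
        unfolding q_def using filterlim_compose[OF lim] by blast
    qed
  qed (auto simp: q_def)
  ultimately have "(\<lambda>j::nat. 0) \<longlonglongrightarrow> (LINT x|lborel. partial k f x)" by simp
  then show ?thesis by (simp add: LIMSEQ_const_iff)
qed

text \<open>For fixed \<open>x\<close>, the modulated Schwartz functions form a class closed under
  derivatives, because differentiating the oscillating factor only multiplies by the constant i x_k.
  The factor 1 in the second formula gives it the shape of
  \<open>schwartz_affine_combination\<close>.\<close>

lemma schwartz_modulate:
  fixes f :: "real^'n::finite \<Rightarrow> complex"
  assumes "f \<in> schwartz"
  shows "(\<lambda>\<xi>. cis (x \<bullet> \<xi>) * f \<xi>) \<in> schwartz"
    and "partial k (\<lambda>\<xi>. cis (x \<bullet> \<xi>) * f \<xi>) = (\<lambda>\<xi>. cis (x \<bullet> \<xi>) * (\<i> * complex_of_real (x $ k) * f \<xi> + 1 * partial k f \<xi>))"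
proof -
  let ?S = "{\<lambda>\<xi>. cis (x \<bullet> \<xi>) * f \<xi> | f. f \<in> schwartz}"
  have cis: "((\<lambda>\<xi>. cis (x \<bullet> \<xi>)) has_derivative (\<lambda>h. cis (x \<bullet> \<xi>) * (\<i> * complex_of_real (x \<bullet> h)))) (at \<xi>)" for \<xi>
  proof -
    have "((\<lambda>\<xi>. \<i> * complex_of_real (x \<bullet> \<xi>)) has_derivative (\<lambda>h. \<i> * complex_of_real (x \<bullet> h))) (at \<xi>)"
      by (intro has_derivative_mult_right has_derivative_of_real has_derivative_inner_right has_derivative_ident)
    from has_derivative_compose[OF this DERIV_exp[unfolded has_field_derivative_def]]
    show ?thesis by (simp add: cis_conv_exp)
  qed
  have D: "((\<lambda>\<xi>. cis (x \<bullet> \<xi>) * f \<xi>) has_derivative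
     (\<lambda>h. cis (x \<bullet> \<xi>) * (\<Sum>k\<in>UNIV. (h $ k) *\<^sub>R partial k f \<xi>) + cis (x \<bullet> \<xi>) * (\<i> * complex_of_real (x \<bullet> h)) * f \<xi>)) (at \<xi>)"
    if "f \<in> schwartz" for f \<xi>
    by (intro has_derivative_mult cis has_derivative_partial schwartz_differentiable that)
  have P: "partial k (\<lambda>\<xi>. cis (x \<bullet> \<xi>) * f \<xi>) = (\<lambda>\<xi>. cis (x \<bullet> \<xi>) * (\<i> * complex_of_real (x $ k) * f \<xi> + 1 * partial k f \<xi>))"
    if "f \<in> schwartz" for f k
    by (rule ext, subst partial_eqI[OF D[OF that]], simp only: sum_axis_partial)
       (simp add: cart_eq_inner_axis algebra_simps)
  have SI: "(\<lambda>\<xi>. cis (x \<bullet> \<xi>) * f \<xi>) \<in> ?S" if "f \<in> schwartz" for f using that by blast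
  show "partial k (\<lambda>\<xi>. cis (x \<bullet> \<xi>) * f \<xi>) = (\<lambda>\<xi>. cis (x \<bullet> \<xi>) * (\<i> * complex_of_real (x $ k) * f \<xi> + 1 * partial k f \<xi>))"
    by (rule P[OF assms])
  show "(\<lambda>\<xi>. cis (x \<bullet> \<xi>) * f \<xi>) \<in> schwartz"
  proof (rule schwartz_coinduct)
    show "(\<lambda>\<xi>. cis (x \<bullet> \<xi>) * f \<xi>) \<in> ?S" by (rule SI[OF assms])
    show "h differentiable at \<xi>" if h: "h \<in> ?S" for h \<xi>
      using h D unfolding differentiable_def by blast
    show "\<exists>C. \<forall>\<xi>. (1 + norm \<xi>) ^ N * norm (h \<xi>) \<le> C" if h: "h \<in> ?S" for h N
      using h schwartz_decay by (auto simp: norm_mult)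
    show "partial k h \<in> ?S" if h: "h \<in> ?S" for h k
    proof -
      obtain f where f: "f \<in> schwartz" "h = (\<lambda>\<xi>. cis (x \<bullet> \<xi>) * f \<xi>)" using h by blast
      show ?thesis
        unfolding f(2) P[OF f(1)] by (rule SI) (intro schwartz_affine_combination f schwartz_partial)
    qed
  qed
qed

text \<open>The derivative of \<open>cis (x \<bullet> \<xi>) * f \<xi>\<close> has integral 0, and
  the product rule splits this integral into the two sides.\<close>

lemma coord_mult_inv_fourier:
  fixes f :: "real^'n::finite \<Rightarrow> complex"
  assumes f: "f \<in> schwartz"
  shows "complex_of_real (x $ k) * inv_fourier f x = inv_fourier (\<lambda>\<xi>. \<i> * partial k f \<xi>) x"
proof -
  note i = integrable_cis_mult[OF schwartz_integrable[OF f]] integrable_cis_mult[OF schwartz_integrable[OF schwartz_partial[OF f]]]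
  have "0 = (LINT \<xi>|lborel. cis (x \<bullet> \<xi>) * (\<i> * complex_of_real (x $ k) * f \<xi> + 1 * partial k f \<xi>))"
    using integral_partial_schwartz[OF schwartz_modulate(1)[OF f]] schwartz_modulate(2)[OF f] by metis
  also have "\<dots> = (LINT \<xi>|lborel. (\<i> * complex_of_real (x $ k)) * (cis (x \<bullet> \<xi>) * f \<xi>) + cis (x \<bullet> \<xi>) * partial k f \<xi>)"
    by (simp add: algebra_simps)
  also have "\<dots> = (\<i> * complex_of_real (x $ k)) * (LINT \<xi>|lborel. cis (x \<bullet> \<xi>) * f \<xi>) + (LINT \<xi>|lborel. cis (x \<bullet> \<xi>) * partial k f \<xi>)"
    using i by (subst Bochner_Integration.integral_add) auto
  finally have "\<i> * ((\<i> * complex_of_real (x $ k)) * (LINT \<xi>|lborel. cis (x \<bullet> \<xi>) * f \<xi>) + (LINT \<xi>|lborel. cis (x \<bullet> \<xi>) * partial k f \<xi>)) = 0"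
    by simp
  then have "complex_of_real (x $ k) * (LINT \<xi>|lborel. cis (x \<bullet> \<xi>) * f \<xi>) = \<i> * (LINT \<xi>|lborel. cis (x \<bullet> \<xi>) * partial k f \<xi>)"
    by (simp add: algebra_simps)
  then have "complex_of_real (x $ k) * inv_fourier f x = \<i> * inv_fourier (partial k f) x"
    unfolding inv_fourier_def by (simp add: mult.left_commute)
  then show ?thesis by (simp add: inv_fourier_cmult)
qed

text \<open>Each power of the weight is traded for one derivative of the symbol, after 1 + |x| is
  bounded by 1 plus the sum of the |x_k|. The symbol changes in each step, hence the induction over
  arbitrary \<open>f\<close>.\<close>

lemma inv_fourier_decay:
  fixes f :: "real^'n::finite \<Rightarrow> complex"
  assumes "f \<in> schwartz"
  shows "\<exists>C. \<forall>x. (1 + norm x) ^ N * norm (inv_fourier f x) \<le> C"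
  using assms
proof (induction N arbitrary: f)
  case 0
  then show ?case using norm_inv_fourier_le[of f] by auto
next
  case (Suc N)
  have "\<exists>C. \<forall>x. (1 + norm x) ^ N * norm (inv_fourier (\<lambda>\<xi>. \<i> * partial k f \<xi>) x) \<le> C" for k
    by (intro Suc.IH schwartz_cmult schwartz_partial Suc.prems)
  then obtain D where D: "\<And>k x. (1 + norm x) ^ N * norm (inv_fourier (\<lambda>\<xi>. \<i> * partial k f \<xi>) x) \<le> D k" by metis
  obtain C where C: "\<And>x. (1 + norm x) ^ N * norm (inv_fourier f x) \<le> C" using Suc by metis
  have "(1 + norm x) ^ Suc N * norm (inv_fourier f x) \<le> C + (\<Sum>k\<in>UNIV. D k)" for x
  proof -
    have "(1 + norm x) * norm (inv_fourier f x) \<le> (1 + (\<Sum>k\<in>UNIV. \<bar>x $ k\<bar>)) * norm (inv_fourier f x)"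
      using norm_le_l1_cart[of x] by (intro mult_right_mono) auto
    also have "\<dots> = norm (inv_fourier f x) + (\<Sum>k\<in>UNIV. norm (complex_of_real (x $ k) * inv_fourier f x))"
      by (simp add: norm_mult sum_distrib_right distrib_right)
    also have "\<dots> = norm (inv_fourier f x) + (\<Sum>k\<in>UNIV. norm (inv_fourier (\<lambda>\<xi>. \<i> * partial k f \<xi>) x))"
      by (simp only: coord_mult_inv_fourier[OF Suc.prems])
    finally have "(1 + norm x) ^ N * ((1 + norm x) * norm (inv_fourier f x)) \<le>
       (1 + norm x) ^ N * (norm (inv_fourier f x) + (\<Sum>k\<in>UNIV. norm (inv_fourier (\<lambda>\<xi>. \<i> * partial k f \<xi>) x)))"
      by (intro mult_left_mono) auto
    also have "\<dots> \<le> C + (\<Sum>k\<in>UNIV. D k)"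
      unfolding distrib_left sum_distrib_left by (intro add_mono C sum_mono D)
    finally show ?thesis by (simp add: mult_ac)
  qed
  then show ?case by blast
qed

text \<open>The image of the Schwartz space is itself a valid coinduction set: a derivative of a
  transform is the transform of a coordinate multiple, which is again Schwartz.\<close>

theorem schwartz_inv_fourier:
  assumes "f \<in> schwartz"
  shows "inv_fourier f \<in> schwartz"
proof (rule schwartz_coinduct)
  show "inv_fourier f \<in> inv_fourier ` schwartz" using assms by blast
  fix g assume "g \<in> inv_fourier ` (schwartz :: (real^'a \<Rightarrow> complex) set)"
  then obtain f where f: "f \<in> schwartz" "g = inv_fourier f" by blast
  show "g differentiable at x" for x
    using inv_fourier_has_derivative[OF f(1)] f(2) unfolding differentiable_def by blast
  show "\<exists>C. \<forall>x. (1 + norm x) ^ N * norm (g x) \<le> C" for N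
    unfolding f(2) by (rule inv_fourier_decay[OF f(1)])
  show "partial k g \<in> inv_fourier ` schwartz" for k
    unfolding f(2) partial_inv_fourier[OF f(1)] by (intro imageI schwartz_cmult schwartz_coord f(1))
qed

section \<open>Test functions, Gaussians, and translates paired with tempered distributions\<close>

lemma compose_affine_has_derivative:
  fixes f :: "real^'n::finite \<Rightarrow> 'b::real_normed_vector"
  assumes "f differentiable at (a + c *\<^sub>R x)"
  shows "((\<lambda>x. f (a + c *\<^sub>R x)) has_derivative
    (\<lambda>h. \<Sum>k\<in>UNIV. (h $ k) *\<^sub>R (c *\<^sub>R partial k f (a + c *\<^sub>R x)))) (at x)"
proof -
  have "((\<lambda>x. a + c *\<^sub>R x) has_derivative (\<lambda>h. c *\<^sub>R h)) (at x)"
    by (auto intro!: derivative_eq_intros)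
  from has_derivative_compose[OF this has_derivative_partial[OF assms]]
  show ?thesis by (simp add: mult.commute)
qed

lemma partials_zero_outside_support:
  assumes "x \<notin> closure {x. f x \<noteq> 0}"
  shows "partials ks f x = 0"
  using assms
proof (induction ks arbitrary: x)
  case Nil
  then show ?case using closure_subset[of "{x. f x \<noteq> 0}"] by auto
next
  case (Cons k ks)
  have "((\<lambda>_. 0) has_derivative (\<lambda>_. 0)) (at x)" by simp
  then have "(partials ks f has_derivative (\<lambda>_. 0)) (at x)"
    by (rule has_derivative_transform_within_open[where s = "- closure {x. f x \<noteq> 0}"])
       (use Cons in auto)
  then show ?case by (simp add: partial_eqI)
qed

text \<open>The coinduction set consists of scalar multiples of dilated iterated derivatives; the
  scalar collects the powers of \<open>c\<close> from the chain rule. Decay holds because every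
  derivative is continuous and vanishes off one compact set.\<close>

lemma test_function_schwartz:
  fixes \<psi> :: "real^'n::finite \<Rightarrow> real"
  assumes \<psi>: "test_function \<psi>" and c: "c \<noteq> 0"
  shows "(\<lambda>\<xi>. complex_of_real (\<psi> (c *\<^sub>R \<xi>))) \<in> schwartz"
proof (rule schwartz_coinduct)
  let ?S = "{\<lambda>\<xi>. complex_of_real (a * partials ks \<psi> (0 + c *\<^sub>R \<xi>)) | a ks. True}"
  have "(\<lambda>\<xi>. complex_of_real (1 * partials [] \<psi> (0 + c *\<^sub>R \<xi>))) \<in> ?S" by blast
  then show "(\<lambda>\<xi>. complex_of_real (\<psi> (c *\<^sub>R \<xi>))) \<in> ?S" by simp
  have diff: "partials ks \<psi> differentiable (at x)" for ks x
    using \<psi> unfolding test_function_def smooth_def by blast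
  fix h assume "h \<in> ?S"
  then obtain a ks where h: "h = (\<lambda>\<xi>. complex_of_real (a * partials ks \<psi> (0 + c *\<^sub>R \<xi>)))" by blast
  have D: "(h has_derivative (\<lambda>v. complex_of_real (a * (\<Sum>k\<in>UNIV. (v $ k) *\<^sub>R (c *\<^sub>R partial k (partials ks \<psi>) (0 + c *\<^sub>R \<xi>)))))) (at \<xi>)" for \<xi>
    unfolding h by (intro has_derivative_of_real has_derivative_mult_right compose_affine_has_derivative diff)
  show "h differentiable at x" for x
    using D unfolding differentiable_def by blast
  show "partial k h \<in> ?S" for k
  proof -
    have "partial k h = (\<lambda>\<xi>. complex_of_real ((a * c) * partials (k # ks) \<psi> (0 + c *\<^sub>R \<xi>)))"
      by (rule ext, subst partial_eqI[OF D]) (subst sum.remove[of _ k], auto simp: axis_def intro!: sum.neutral)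
    then show ?thesis by blast
  qed
  show "\<exists>C. \<forall>\<xi>. (1 + norm \<xi>) ^ N * norm (h \<xi>) \<le> C" for N
  proof -
    let ?K = "closure {x. \<psi> x \<noteq> 0}"
    have K: "compact ?K" using \<psi> by (simp add: test_function_def)
    obtain R where R: "\<And>x. x \<in> ?K \<Longrightarrow> norm x \<le> R"
      using compact_imp_bounded[OF K] bounded_iff by metis
    have "continuous_on ?K (partials ks \<psi>)"
      by (meson continuous_at_imp_continuous_on diff differentiable_imp_continuous_within)
    then have "bounded (partials ks \<psi> ` ?K)"
      using compact_continuous_image[OF _ K] compact_imp_bounded by blast
    then obtain B where B: "\<And>x. x \<in> ?K \<Longrightarrow> norm (partials ks \<psi> x) \<le> B"
      unfolding bounded_iff by blast
    \<comment> \<open>If the support is empty, \<open>R\<close> and \<open>B\<close> are arbitrary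
      and may be negative; hence the absolute values.\<close>
    have "(1 + norm \<xi>) ^ N * norm (h \<xi>) \<le> (1 + \<bar>R\<bar> / \<bar>c\<bar>) ^ N * (\<bar>a\<bar> * \<bar>B\<bar>)" for \<xi>
    proof (cases "c *\<^sub>R \<xi> \<in> ?K")
      case True
      have "norm \<xi> \<le> \<bar>R\<bar> / \<bar>c\<bar>"
        using R[OF True] c by (simp add: field_simps)
      moreover have "norm (h \<xi>) \<le> \<bar>a\<bar> * \<bar>B\<bar>"
        using B[OF True] unfolding h by (simp add: norm_mult abs_mult mult_left_mono del: of_real_mult)
      ultimately show ?thesis
        by (intro mult_mono power_mono) auto
    next
      case False
      then show ?thesis by (simp add: h partials_zero_outside_support)
    qed
    then show ?thesis by blast
  qed
qed

lemma one_plus_power_le_exp: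
  fixes r :: real
  assumes "r \<ge> 0"
  shows "(1 + r) ^ N \<le> exp (real N * r)"
  using power_mono[OF exp_ge_add_one_self[of r], of N] assms by (simp add: exp_of_nat_mult)

lemma gaussian_schwartz: "(\<lambda>x::real^'n::finite. complex_of_real (exp (- (norm x)\<^sup>2))) \<in> schwartz"
proof -
  let ?g = "\<lambda>x::real^'n. complex_of_real (exp (- (norm x)\<^sup>2))"
  have D: "(?g has_derivative (\<lambda>h. complex_of_real (exp (- (norm x)\<^sup>2) * - (2 * (x \<bullet> h))))) (at x)" for x
  proof -
    have "((\<lambda>x. - (x \<bullet> x)) has_derivative (\<lambda>h. - (2 * (x \<bullet> h)))) (at x)"
      by (auto intro!: derivative_eq_intros simp: inner_commute)
    from has_derivative_compose[OF this DERIV_exp[unfolded has_field_derivative_def]]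
    show ?thesis unfolding power2_norm_eq_inner by (rule has_derivative_of_real)
  qed
  have decay: "\<exists>C. \<forall>x. (1 + norm x) ^ N * norm (?g x) \<le> C" for N
  proof -
    have "(1 + norm x) ^ N * norm (?g x) \<le> exp ((real N)\<^sup>2)" for x
    proof -
      have "(1 + norm x) ^ N * norm (?g x) \<le> exp (real N * norm x) * exp (- (norm x)\<^sup>2)"
        by (simp add: one_plus_power_le_exp)
      also have "\<dots> = exp (real N * norm x - (norm x)\<^sup>2)"
        by (simp add: exp_add[symmetric])
      also have "\<dots> \<le> exp ((real N)\<^sup>2)"
      proof -
        \<comment> \<open>Expanded, this is N r - r^2 \<le> N^2 with r = |x|.\<close>
        have "0 \<le> (real N - norm x)\<^sup>2 + real N * norm x" by (intro add_nonneg_nonneg) auto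
        then show ?thesis by (simp add: power2_diff)
      qed
      finally show ?thesis .
    qed
    then show ?thesis by blast
  qed
  have closed: "partial k ?g \<in> schwartz_hull {?g}" for k
  proof -
    \<comment> \<open>The vanishing summand brings the derivative into the shape of the rule
      \<open>comb\<close> of the hull.\<close>
    have "partial k ?g = (\<lambda>x. (- 2) * (complex_of_real (x $ k) * ?g x) + 0 * ?g x)"
      by (rule ext, subst partial_eqI[OF D]) (simp add: cart_eq_inner_axis)
    then show ?thesis by (simp only: schwartz_hull.intros singletonI)
  qed
  have diff: "?g differentiable at x" for x
    using D unfolding differentiable_def by blast
  show ?thesis
    by (rule schwartz_coinduct_upto[where S = "{?g}"])
      (auto simp only: singleton_iff intro: schwartz_hull.base[OF singletonI] diff decay closed)
qed

text \<open>These are the functions to which \<open>fourier_multiplier\<close> applies a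
  distribution. Written as \<open>x + (- 1) *\<^sub>R y\<close> the reflection is an affine map,
  each derivative contributes a sign, and Peetre's inequality carries the decay over from
  \<open>f\<close>.\<close>

lemma schwartz_reflect_translate:
  fixes f :: "real^'n::finite \<Rightarrow> complex"
  assumes f: "f \<in> schwartz"
  shows "(\<lambda>y. f (x - y)) \<in> schwartz"
    and "partials ks (\<lambda>y. f (x - y)) y = (- 1) ^ length ks * partials ks f (x - y)"
proof -
  let ?S = "{\<lambda>y. a * f (x + (- 1) *\<^sub>R y) | a f. f \<in> schwartz}"
  have D: "((\<lambda>y. a * f (x + (- 1) *\<^sub>R y)) has_derivative
      (\<lambda>v. a * (\<Sum>k\<in>UNIV. (v $ k) *\<^sub>R ((- 1) *\<^sub>R partial k f (x + (- 1) *\<^sub>R y))))) (at y)"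
    if "f \<in> schwartz" for f y a
    by (intro has_derivative_mult_right compose_affine_has_derivative schwartz_differentiable that)
  have P: "partial k (\<lambda>y. a * f (x + (- 1) *\<^sub>R y)) = (\<lambda>y. (- a) * partial k f (x + (- 1) *\<^sub>R y))"
    if "f \<in> schwartz" for k f a
    by (rule ext, subst partial_eqI[OF D[OF that]]) (subst sum.remove[of _ k], auto simp: axis_def intro!: sum.neutral)
  have "(\<lambda>y. 1 * f (x + (- 1) *\<^sub>R y)) \<in> schwartz"
  proof (rule schwartz_coinduct)
    show "(\<lambda>y. 1 * f (x + (- 1) *\<^sub>R y)) \<in> ?S" using f by blast
    fix h assume "h \<in> ?S"
    then obtain a f where f: "f \<in> schwartz" and h: "h = (\<lambda>y. a * f (x + (- 1) *\<^sub>R y))" by blast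
    show "h differentiable at y" for y
      unfolding h using D[OF f] unfolding differentiable_def by blast
    show "partial k h \<in> ?S" for k
      unfolding h P[OF f] using schwartz_partial[OF f] by blast
    show "\<exists>C. \<forall>y. (1 + norm y) ^ N * norm (h y) \<le> C" for N
    proof -
      obtain C where C: "\<And>x. (1 + norm x) ^ N * norm (f x) \<le> C" using schwartz_decay[OF f] by metis
      have "(1 + norm y) ^ N * norm (h y) \<le> (1 + norm x) ^ N * (norm a * C)" for y
      proof -
        have "(1 + norm y) ^ N * norm (h y) \<le> (1 + norm x) ^ N * (1 + norm (x - y)) ^ N * norm (h y)"
          by (intro mult_right_mono weight_triangle) auto
        also have "\<dots> = (1 + norm x) ^ N * (norm a * ((1 + norm (x - y)) ^ N * norm (f (x - y))))"
          by (simp add: h norm_mult)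
        also have "\<dots> \<le> (1 + norm x) ^ N * (norm a * C)"
          by (intro mult_left_mono C) auto
        finally show ?thesis .
      qed
      then show ?thesis by blast
    qed
  qed
  then show "(\<lambda>y. f (x - y)) \<in> schwartz" by simp
  have ps: "partials ks f \<in> schwartz" for ks
    by (induction ks) (auto intro: f schwartz_partial)
  have "partials ks (\<lambda>y. 1 * f (x + (- 1) *\<^sub>R y)) = (\<lambda>y. (- 1) ^ length ks * partials ks f (x + (- 1) *\<^sub>R y))"
    by (induction ks) (simp_all only: partials.simps P[OF ps] list.size power.simps, simp_all)
  then show "partials ks (\<lambda>y. f (x - y)) y = (- 1) ^ length ks * partials ks f (x - y)"
    by simp
qed

lemma schwartz_partials: "f \<in> schwartz \<Longrightarrow> partials ks f \<in> schwartz"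
  by (induction ks) (auto intro: schwartz_partial)

lemma partials_diff:
  assumes "f \<in> schwartz" "g \<in> schwartz"
  shows "partials ks (\<lambda>x. f x - g x) = (\<lambda>x. partials ks f x - partials ks g x)"
proof (induction ks)
  case (Cons k ks)
  have "partial k (\<lambda>x. F x - G x) x = partial k F x - partial k G x" if "F \<in> schwartz" "G \<in> schwartz" for F G x
    by (subst partial_eqI[OF has_derivative_diff[OF has_derivative_partial has_derivative_partial]])
       (auto intro: that schwartz_differentiable simp: sum_axis_partial)
  from this[OF schwartz_partials[OF assms(1)] schwartz_partials[OF assms(2)]] show ?case
    by (simp only: partials.simps Cons.IH)
qed simp

text \<open>Temperedness bounds \<open>T\<close> by derivatives of order at most \<open>N\<close>,
  of which there are finitely many, and for each of them the weighted effect of a shift by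
  \<open>h\<close> is of order |h|. Continuity is what makes the Littlewood-Paley pieces of a
  distribution measurable.\<close>

lemma tempered_translate_continuous:
  fixes f :: "real^'n::finite \<Rightarrow> complex"
  assumes T: "tempered T" and f: "f \<in> schwartz"
  shows "continuous_on UNIV (\<lambda>x. T (\<lambda>y. f (x - y)))"
proof -
  obtain C N where CN: "\<And>f. f \<in> schwartz \<Longrightarrow> norm (T f) \<le> C * schwartz_seminorm N f"
    using T unfolding tempered_def by blast
  have T_add: "T (\<lambda>x. f x + g x) = T f + T g" if "f \<in> schwartz" "g \<in> schwartz" for f g
    using T that unfolding tempered_def by blast
  have T_cmult: "T (\<lambda>x. c * f x) = c * T f" if "f \<in> schwartz" for f c
    using T that unfolding tempered_def by blast
  have "\<exists>B\<ge>0. \<forall>x h. (1 + norm x) ^ N * norm (partials ks f (x + h) - partials ks f x) \<le> B * (1 + norm h) ^ N * norm h" for ks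
    using schwartz_difference[OF schwartz_partials[OF f]] by metis
  then obtain B where B: "\<And>ks. B ks \<ge> 0"
    "\<And>ks x h. (1 + norm x) ^ N * norm (partials ks f (x + h) - partials ks f x) \<le> B ks * (1 + norm h) ^ N * norm h"
    by metis
  let ?L = "{ks::'n list. length ks \<le> N}"
  have fin: "finite ?L" using finite_lists_length_le[of "UNIV::'n set" N] by simp
  define M where "M = (\<Sum>ks\<in>?L. B ks)"
  have BM: "B ks \<le> M" if "ks \<in> ?L" for ks
    unfolding M_def using fin that B(1) by (intro member_le_sum) auto
  have bound: "norm (T (\<lambda>y. f (x' + h - y)) - T (\<lambda>y. f (x' - y)))
      \<le> \<bar>C\<bar> * ((1 + norm x') ^ N * (M * (1 + norm h) ^ N * norm h))" for x' h
  proof -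
    let ?g = "\<lambda>y. f (x' + h - y)" and ?g' = "\<lambda>y. f (x' - y)"
    have g: "?g \<in> schwartz" "?g' \<in> schwartz" by (intro schwartz_reflect_translate f)+
    have d: "(\<lambda>y. ?g y - ?g' y) \<in> schwartz" by (intro schwartz_diff g)
    have "T (\<lambda>y. ?g y + (- 1) * ?g' y) = T ?g + T (\<lambda>y. (- 1) * ?g' y)"
      by (rule T_add[OF g(1) schwartz_cmult[OF g(2)]])
    also have "T (\<lambda>y. (- 1) * ?g' y) = (- 1) * T ?g'"
      by (rule T_cmult[OF g(2)])
    finally have "T ?g - T ?g' = T (\<lambda>y. ?g y - ?g' y)" by simp
    then have "norm (T ?g - T ?g') \<le> C * schwartz_seminorm N (\<lambda>y. ?g y - ?g' y)"
      using CN[OF d] by simp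
    moreover have "schwartz_seminorm N (\<lambda>y. ?g y - ?g' y) \<le> (1 + norm x') ^ N * (M * (1 + norm h) ^ N * norm h)"
      and "0 \<le> schwartz_seminorm N (\<lambda>y. ?g y - ?g' y)"
    proof -
      have le: "(1 + norm y) ^ N * norm (partials ks (\<lambda>y. ?g y - ?g' y) y) \<le> (1 + norm x') ^ N * (M * (1 + norm h) ^ N * norm h)"
        if "length ks \<le> N" for ks y
      proof -
        have "partials ks (\<lambda>y. ?g y - ?g' y) y = (- 1) ^ length ks * (partials ks f ((x' - y) + h) - partials ks f (x' - y))"
          unfolding partials_diff[OF g] schwartz_reflect_translate(2)[OF f] by (simp add: algebra_simps)
        then have n: "norm (partials ks (\<lambda>y. ?g y - ?g' y) y) = norm (partials ks f ((x' - y) + h) - partials ks f (x' - y))"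
          by (simp add: norm_mult norm_power)
        have "(1 + norm y) ^ N * norm (partials ks (\<lambda>y. ?g y - ?g' y) y)
            \<le> (1 + norm x') ^ N * (1 + norm (x' - y)) ^ N * norm (partials ks f ((x' - y) + h) - partials ks f (x' - y))"
          unfolding n by (intro mult_right_mono weight_triangle) auto
        also have "\<dots> \<le> (1 + norm x') ^ N * (B ks * (1 + norm h) ^ N * norm h)"
          unfolding mult.assoc[of "(1 + norm x') ^ N"] by (intro mult_left_mono B) auto
        also have "\<dots> \<le> (1 + norm x') ^ N * (M * (1 + norm h) ^ N * norm h)"
          using BM[of ks] that by (intro mult_left_mono mult_right_mono) auto
        finally show ?thesis .
      qed
      then show "schwartz_seminorm N (\<lambda>y. ?g y - ?g' y) \<le> (1 + norm x') ^ N * (M * (1 + norm h) ^ N * norm h)"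
        unfolding schwartz_seminorm_def by (intro cSUP_least) (auto intro!: exI[of _ "[]"])
      \<comment> \<open>\<open>C\<close> may be negative, so replacing it by
        \<open>\<bar>C\<bar>\<close> needs a nonnegative seminorm. The seminorm is a supremum of
        reals and dominates its value at \<open>([], 0)\<close> only once boundedness is
        known.\<close>
      have "bdd_above ((\<lambda>(ks, y). (1 + norm y) ^ N * norm (partials ks (\<lambda>y. ?g y - ?g' y) y)) ` ({ks. length ks \<le> N} \<times> UNIV))"
        by (rule bdd_aboveI2) (use le in auto)
      then have "(\<lambda>(ks, y). (1 + norm y) ^ N * norm (partials ks (\<lambda>y. ?g y - ?g' y) y)) ([], 0) \<le> schwartz_seminorm N (\<lambda>y. ?g y - ?g' y)"
        unfolding schwartz_seminorm_def by (rule cSUP_upper[rotated]) auto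
      then show "0 \<le> schwartz_seminorm N (\<lambda>y. ?g y - ?g' y)"
        by (rule order_trans[rotated]) auto
    qed
    ultimately show ?thesis
      by (meson abs_ge_self abs_ge_zero mult_mono order_trans)
  qed
  have "((\<lambda>h. T (\<lambda>y. f (x + h - y))) \<longlongrightarrow> T (\<lambda>y. f (x - y))) (at 0)" for x
  proof (rule Lim_null_comparison[THEN Lim_null[THEN iffD2]])
    show "\<forall>\<^sub>F h in at 0. norm (T (\<lambda>y. f (x + h - y)) - T (\<lambda>y. f (x - y)))
        \<le> \<bar>C\<bar> * ((1 + norm x) ^ N * (M * (1 + norm h) ^ N * norm h))"
      by (intro always_eventually allI bound)
    show "((\<lambda>h::real^'n. \<bar>C\<bar> * ((1 + norm x) ^ N * (M * (1 + norm h) ^ N * norm h))) \<longlongrightarrow> 0) (at 0)"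
      by (rule tendsto_eq_intros refl | simp)+
  qed
  then show ?thesis
    unfolding continuous_on_eq_continuous_at[OF open_UNIV] isCont_iff by blast
qed

text \<open>Conjugation followed by the substitution of -\<xi> for \<xi> reproduces the same
  integral.\<close>

lemma inv_fourier_real:
  fixes m :: "real^'n::finite \<Rightarrow> complex"
  assumes [measurable]: "m \<in> borel_measurable borel" and sym: "\<And>\<xi>. cnj (m \<xi>) = m (- \<xi>)"
  shows "inv_fourier m x \<in> \<real>"
proof -
  let ?I = "LINT \<xi>|lborel. cis (x \<bullet> \<xi>) * m \<xi>"
  have "cnj ?I = (LINT \<xi>|lborel. cnj (cis (x \<bullet> \<xi>) * m \<xi>))"
    by (rule Bochner_Integration.integral_cnj[symmetric])
  also have "\<dots> = (LINT \<xi>|lborel. cis (x \<bullet> (0 + (- 1) *\<^sub>R \<xi>)) * m (0 + (- 1) *\<^sub>R \<xi>))"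
    by (simp add: sym cis_cnj)
  also have "\<dots> = ?I"
    using lborel_integral_affine[of "\<lambda>\<xi>. cis (x \<bullet> \<xi>) * m \<xi>" "- 1" 0] by simp
  finally have "?I \<in> \<real>" by (simp add: complex_eq_iff complex_is_Real_iff)
  then show ?thesis unfolding inv_fourier_def by (intro Reals_mult Reals_of_real)
qed

section \<open>The contour representation of exp (-r^\<alpha>)\<close>

lemma contour_integral_linepath_same_Im:
  assumes "a < b"
  shows "contour_integral (linepath (Complex a c) (Complex b c)) f = integral {a..b} (\<lambda>x. f (Complex x c))"
proof -
  have l: "linepath (Complex a c) (Complex b c) x = linepath (of_real a) (of_real b) x + Complex 0 c" for x
    by (simp add: linepath_def complex_eq_iff algebra_simps)
  have d: "Complex b c - Complex a c = of_real b - of_real a"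
    by (simp add: complex_eq_iff)
  have "contour_integral (linepath (Complex a c) (Complex b c)) f
      = contour_integral (linepath (of_real a) (of_real b)) (\<lambda>w. f (w + Complex 0 c))"
    by (simp add: contour_integral_integral l d)
  also have "\<dots> = integral {a..b} (\<lambda>x. f (of_real x + Complex 0 c))"
    using assms by (subst contour_integral_linepath_Reals_eq) auto
  also have "\<dots> = integral {a..b} (\<lambda>x. f (Complex x c))"
    by (intro integral_cong arg_cong[where f = f]) (auto simp: complex_eq_iff)
  finally show ?thesis .
qed

text \<open>This is exp (-z^\<alpha>) dz in the coordinate \<open>z = exp w\<close>; the second
  factor is the Jacobian dz/dw.\<close>

definition hankel :: "real \<Rightarrow> complex \<Rightarrow> complex" where
  "hankel \<alpha> w = exp (- exp (of_real \<alpha> * w)) * exp w"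

text \<open>The majorant on a line Im w = +-\<theta>, with c = cos (\<alpha> \<theta>). Of the
  Jacobian exp x only exp (x/2) remains, since the denominator, or equally the resolvent bound,
  absorbs the other half.\<close>

definition hankel_bound :: "real \<Rightarrow> real \<Rightarrow> real \<Rightarrow> real" where
  "hankel_bound \<alpha> c x = exp (- c * exp (\<alpha> * x)) * exp (x / 2)"

abbreviation hankel_quotient :: "real \<Rightarrow> complex \<Rightarrow> real \<Rightarrow> complex" where
  "hankel_quotient \<alpha> w r \<equiv> hankel \<alpha> w / (exp w - of_real r)"

text \<open>The real part of z^\<alpha> is exp (\<alpha> Re w) cos (\<alpha> Im w), and the cosine
  decreases on [0, pi], so the worst case lies on the edge of the strip. A bound on the whole strip
  serves the vertical sides of the rectangle as well.\<close>

lemma norm_hankel_le: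
  assumes "0 < \<alpha>" "\<bar>Im w\<bar> \<le> \<theta>" "\<alpha> * \<theta> \<le> pi"
  shows "norm (hankel \<alpha> w) \<le> exp (- cos (\<alpha> * \<theta>) * exp (\<alpha> * Re w)) * exp (Re w)"
proof -
  have "\<alpha> * \<bar>Im w\<bar> \<le> \<alpha> * \<theta>" using assms by (intro mult_left_mono) auto
  then have "cos (\<alpha> * \<theta>) \<le> cos (\<alpha> * \<bar>Im w\<bar>)"
    using assms by (intro cos_monotone_0_pi_le) auto
  also have "\<alpha> * \<bar>Im w\<bar> = \<bar>\<alpha> * Im w\<bar>" using assms by (simp add: abs_mult)
  finally have "cos (\<alpha> * \<theta>) \<le> cos (\<alpha> * Im w)" by simp
  then have "cos (\<alpha> * \<theta>) * exp (\<alpha> * Re w) \<le> exp (\<alpha> * Re w) * cos (\<alpha> * Im w)"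
    by (simp add: mult.commute)
  then show ?thesis
    by (simp add: hankel_def norm_mult Re_exp)
qed

text \<open>To the left the factor exp (x/2) decays. To the right e^(-y) \<le> 2/y^2 with y = c exp
  (\<alpha> x) gives at least exp (-x), because 2\<alpha> \<ge> 1, and this beats exp (x/2). On both
  sides the majorant is of order exp (-|x|/2).\<close>

lemma hankel_bound_integrable:
  assumes "c > 0" "1 / 2 \<le> \<alpha>"
  shows "integrable lborel (hankel_bound \<alpha> c)"
proof (rule integrable_dominated)
  \<comment> \<open>The 8 comes from exp (-|x|/2) \<le> 8/(1 + x^2); the bracket adds the constants
    1 and 2/c^2 of the two half-lines.\<close>
  let ?K = "8 * (1 + 2 / c\<^sup>2)"
  show "integrable lborel (\<lambda>x. ?K * inverse (1 + x\<^sup>2))"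
    using integrable_inverse_1_plus_square by (simp add: set_integrable_def)
  show "AE x in lborel. norm (hankel_bound \<alpha> c x) \<le> norm (?K * inverse (1 + x\<^sup>2))"
  proof (rule AE_I2)
    fix x :: real
    have "1 + \<bar>x\<bar> / 2 + (\<bar>x\<bar> / 2)\<^sup>2 / 2 \<le> exp (\<bar>x\<bar> / 2)"
      by (intro exp_lower_Taylor_quadratic) auto
    then have "(1 + x\<^sup>2) / 8 \<le> exp (\<bar>x\<bar> / 2)"
      by (simp add: power_divide)
    moreover have "1 + x\<^sup>2 > 0" by (simp add: add_pos_nonneg)
    ultimately have dec: "exp (- \<bar>x\<bar> / 2) \<le> 8 * inverse (1 + x\<^sup>2)"
      by (simp add: exp_minus field_simps)
    have "hankel_bound \<alpha> c x \<le> (1 + 2 / c\<^sup>2) * exp (- \<bar>x\<bar> / 2)"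
    proof (cases "x \<le> 0")
      case True
      have "hankel_bound \<alpha> c x \<le> 1 * exp (x / 2)"
        unfolding hankel_bound_def using assms by (intro mult_right_mono) auto
      also have "\<dots> \<le> (1 + 2 / c\<^sup>2) * exp (- \<bar>x\<bar> / 2)"
        using True by (intro mult_mono) auto
      finally show ?thesis .
    next
      case False
      define y where "y = c * exp (\<alpha> * x)"
      have y: "y > 0" using assms by (simp add: y_def)
      have "y\<^sup>2 / 2 \<le> exp y" using exp_lower_Taylor_quadratic[of y] y by linarith
      then have "exp (- y) \<le> 2 / y\<^sup>2" using y by (simp add: exp_minus field_simps)
      also have "\<dots> = 2 / c\<^sup>2 * exp (- (2 * \<alpha> * x))"
        using assms by (simp add: y_def power_mult_distrib exp_minus field_simps exp_of_nat_mult[symmetric] flip: exp_double)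
      also have "\<dots> \<le> 2 / c\<^sup>2 * exp (- x)"
        using assms False by (intro mult_left_mono) auto
      finally have "hankel_bound \<alpha> c x \<le> 2 / c\<^sup>2 * exp (- x) * exp (x / 2)"
        unfolding hankel_bound_def y_def by (intro mult_right_mono) auto
      also have "\<dots> = 2 / c\<^sup>2 * exp (- \<bar>x\<bar> / 2)"
        using False by (simp flip: exp_add)
      also have "\<dots> \<le> (1 + 2 / c\<^sup>2) * exp (- \<bar>x\<bar> / 2)"
        by (intro mult_right_mono) auto
      finally show ?thesis .
    qed
    also have "\<dots> \<le> (1 + 2 / c\<^sup>2) * (8 * inverse (1 + x\<^sup>2))"
      by (intro mult_left_mono dec) auto
    also have "\<dots> = ?K * inverse (1 + x\<^sup>2)" by (simp only: mult_ac)
    also have "\<dots> \<le> norm (?K * inverse (1 + x\<^sup>2))" by simp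
    finally show "norm (hankel_bound \<alpha> c x) \<le> norm (?K * inverse (1 + x\<^sup>2))"
      by (simp only: real_norm_def abs_of_nonneg hankel_bound_def mult_nonneg_nonneg exp_ge_zero)
  qed
qed (unfold hankel_bound_def, measurable)

text \<open>A point with real part -a < 0 has distance at least a + r from r \<ge> 0. The product
  form follows from the inequality of arithmetic and geometric means and separates \<open>r\<close>
  from \<open>w\<close>: with r = |\<xi>|^2 it bounds the quotient by a multiple of 1/|\<xi>|, a
  singularity that a symbol of size |\<xi>| cancels.\<close>

lemma norm_exp_minus_real_ge:
  assumes "cos (Im w) < 0" "r \<ge> 0"
  shows "sqrt (r * \<bar>cos (Im w)\<bar>) * exp (Re w / 2) \<le> norm (exp w - of_real r)"
    and "\<bar>cos (Im w)\<bar> * exp (Re w) + r \<le> norm (exp w - of_real r)"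
proof -
  define a where "a = \<bar>cos (Im w)\<bar> * exp (Re w)"
  have a: "a \<ge> 0" by (simp add: a_def)
  have "Re (exp w - of_real r) = - (a + r)"
    using assms by (simp add: a_def Re_exp abs_of_neg)
  then have "a + r = \<bar>Re (exp w - of_real r)\<bar>" using a assms by linarith
  also have "\<dots> \<le> norm (exp w - of_real r)" by (rule abs_Re_le_cmod)
  finally show 1: "a + r \<le> norm (exp w - of_real r)" .
  have "exp (Re w / 2) = sqrt (exp (Re w))"
    by (rule real_sqrt_unique[symmetric]) (auto simp: power2_eq_square simp flip: exp_add)
  then have "sqrt (r * \<bar>cos (Im w)\<bar>) * exp (Re w / 2) = sqrt (r * a)"
    by (simp only: a_def real_sqrt_mult[symmetric] mult.assoc)
  also have "\<dots> \<le> (r + a) / 2"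
    by (rule arith_geo_mean_sqrt[OF assms(2) a])
  also have "\<dots> \<le> a + r"
    using a assms(2) by (simp add: field_simps)
  finally show "sqrt (r * \<bar>cos (Im w)\<bar>) * exp (Re w / 2) \<le> norm (exp w - of_real r)"
    using 1 by linarith
qed

lemma norm_hankel_quotient_le:
  assumes "0 < \<alpha>" "\<bar>Im w\<bar> = \<theta>" "\<alpha> * \<theta> \<le> pi" "cos \<theta> < 0" "r > 0"
  shows "norm (hankel_quotient \<alpha> w r) \<le> hankel_bound \<alpha> (cos (\<alpha> * \<theta>)) (Re w) / sqrt (r * \<bar>cos \<theta>\<bar>)"
proof -
  have cw: "cos (Im w) = cos \<theta>" using assms(2) by (metis cos_abs_real)
  have pos: "sqrt (r * \<bar>cos \<theta>\<bar>) > 0" using assms by (simp add: mult_pos_neg)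
  have "norm (hankel_quotient \<alpha> w r)
      \<le> (exp (- cos (\<alpha> * \<theta>) * exp (\<alpha> * Re w)) * exp (Re w)) / (sqrt (r * \<bar>cos \<theta>\<bar>) * exp (Re w / 2))"
    unfolding norm_divide
    using norm_hankel_le[of \<alpha> w \<theta>] norm_exp_minus_real_ge(1)[of w r] assms pos cw
    by (intro frac_le) auto
  also have "\<dots> = hankel_bound \<alpha> (cos (\<alpha> * \<theta>)) (Re w) / sqrt (r * \<bar>cos \<theta>\<bar>)"
  proof -
    have "exp (Re w) = exp (Re w / 2) * exp (Re w / 2)" by (simp flip: exp_add)
    then show ?thesis unfolding hankel_bound_def by simp
  qed
  finally show ?thesis .
qed

lemma borel_measurable_hankel: "(\<lambda>x. hankel \<alpha> (Complex x s)) \<in> borel_measurable borel"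
  and borel_measurable_exp_Complex: "(\<lambda>x. exp (Complex x s)) \<in> borel_measurable borel"
proof -
  have [measurable]: "(\<lambda>x. Complex x s) \<in> borel_measurable borel"
    unfolding Complex_eq by measurable
  have [measurable]: "(exp :: complex \<Rightarrow> complex) \<in> borel_measurable borel"
    by (intro borel_measurable_continuous_onI continuous_intros)
  show "(\<lambda>x. hankel \<alpha> (Complex x s)) \<in> borel_measurable borel" unfolding hankel_def by measurable
  show "(\<lambda>x. exp (Complex x s)) \<in> borel_measurable borel" by measurable
qed

lemma hankel_quotient_integrable:
  assumes "1 / 2 \<le> \<alpha>" "\<bar>s\<bar> = \<theta>" "\<alpha> * \<theta> < pi / 2" "\<theta> \<ge> 0" "cos \<theta> < 0" "r > 0"
  shows "integrable lborel (\<lambda>x. hankel_quotient \<alpha> (Complex x s) r)"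
proof (rule integrable_dominated)
  have "cos (\<alpha> * \<theta>) > 0" using assms by (intro cos_gt_zero_pi) (auto intro: order_less_le_trans[of _ 0])
  then show "integrable lborel (\<lambda>x. hankel_bound \<alpha> (cos (\<alpha> * \<theta>)) x / sqrt (r * \<bar>cos \<theta>\<bar>))"
    using assms by (intro integrable_divide hankel_bound_integrable) auto
  show "AE x in lborel. norm (hankel_quotient \<alpha> (Complex x s) r)
     \<le> norm (hankel_bound \<alpha> (cos (\<alpha> * \<theta>)) x / sqrt (r * \<bar>cos \<theta>\<bar>))"
  proof (rule AE_I2)
    fix x
    have "norm (hankel_quotient \<alpha> (Complex x s) r)
        \<le> hankel_bound \<alpha> (cos (\<alpha> * \<theta>)) (Re (Complex x s)) / sqrt (r * \<bar>cos \<theta>\<bar>)"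
    proof (rule norm_hankel_quotient_le)
      show "0 < \<alpha>" "\<alpha> * \<theta> \<le> pi" using assms(1,3) pi_gt_zero by linarith+
    qed (use assms in auto)
    also have "\<dots> \<le> norm (hankel_bound \<alpha> (cos (\<alpha> * \<theta>)) x / sqrt (r * \<bar>cos \<theta>\<bar>))"
      by (simp only: complex.sel real_norm_def abs_ge_self)
    finally show "norm (hankel_quotient \<alpha> (Complex x s) r)
        \<le> norm (hankel_bound \<alpha> (cos (\<alpha> * \<theta>)) x / sqrt (r * \<bar>cos \<theta>\<bar>))" .
  qed
  show "(\<lambda>x. hankel_quotient \<alpha> (Complex x s) r) \<in> borel_measurable lborel"
    using borel_measurable_hankel[of \<alpha> s] borel_measurable_exp_Complex[of s] by measurable
qed

lemma integral_truncation_limit: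
  fixes f :: "real \<Rightarrow> 'b::{banach, second_countable_topology}"
  assumes f: "integrable lborel f" and N: "filterlim N at_top sequentially"
  shows "(\<lambda>n. LINT x|lborel. indicator {- N n..N n} x *\<^sub>R f x) \<longlonglongrightarrow> (LINT x|lborel. f x)"
proof (rule integral_dominated_convergence[where w = "\<lambda>x. norm (f x)"])
  show "AE x in lborel. (\<lambda>n. indicator {- N n..N n} x *\<^sub>R f x) \<longlonglongrightarrow> f x"
  proof (rule AE_I2)
    fix x :: real
    have "\<forall>\<^sub>F n in sequentially. \<bar>x\<bar> \<le> N n"
      using N unfolding filterlim_at_top by blast
    then have "\<forall>\<^sub>F n in sequentially. f x = indicator {- N n..N n} x *\<^sub>R f x"
      by eventually_elim (auto simp: indicator_def)
    then show "(\<lambda>n. indicator {- N n..N n} x *\<^sub>R f x) \<longlonglongrightarrow> f x"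
      by (rule Lim_transform_eventually[OF tendsto_const])
  qed
  show "AE x in lborel. norm (indicator {- N n..N n} x *\<^sub>R f x) \<le> norm (f x)" for n
    by (intro AE_I2) (auto simp: indicator_def)
qed (use f in \<open>auto intro: borel_measurable_integrable\<close>)

text \<open>On |Im w| < pi the exponential is injective, so \<open>ln r\<close> is the only pole.
  Its residue is exp (-r^\<alpha>), because the factor \<open>exp w\<close> in \<open>hankel\<close>
  cancels the derivative of the denominator. In the limit of long rectangles only the two horizontal
  sides survive.\<close>

theorem exp_powr_contour:
  assumes "1 / 2 \<le> \<alpha>" and \<theta>: "0 < \<theta>" "\<theta> < pi" "\<alpha> * \<theta> < pi / 2" "cos \<theta> < 0" and r: "r > 0"
  defines "H \<equiv> \<lambda>w. hankel_quotient \<alpha> w r"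
  shows "complex_of_real (exp (- (r powr \<alpha>))) =
    ((LINT x|lborel. H (Complex x (- \<theta>))) - (LINT x|lborel. H (Complex x \<theta>))) / (2 * of_real pi * \<i>)"
proof -
  define c where "c = cos (\<alpha> * \<theta>)"
  have \<alpha>: "\<alpha> > 0" using assms(1) by simp
  have c: "c > 0" unfolding c_def using \<alpha> \<theta> by (intro cos_gt_zero_pi) (auto intro: order_less_le_trans[of _ 0])
  define S where "S = {w. \<bar>Im w\<bar> < pi}"
  define p where "p = complex_of_real (ln r)"
  have Seq: "S = {w. Im w < pi} \<inter> {w. - pi < Im w}" by (auto simp: S_def)
  have S: "open S" "connected S"
    unfolding Seq by (intro open_Int open_halfspace_Im_lt open_halfspace_Im_gt)
      (intro convex_connected convex_Int convex_halfspace_Im_lt convex_halfspace_Im_gt)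
  have zero: "w = p" if "w \<in> S" "exp w = of_real r" for w
  proof -
    have "w = Ln (exp w)" using that by (intro Ln_exp[symmetric]) (auto simp: S_def)
    also have "\<dots> = p" using that r by (simp add: p_def Ln_of_real)
    finally show ?thesis .
  qed
  have expp: "exp p = of_real r" unfolding p_def exp_of_real using r by simp
  have holo: "H holomorphic_on S - {p}"
    unfolding H_def hankel_def using zero by (auto intro!: holomorphic_intros)
  have res: "residue H p = complex_of_real (exp (- (r powr \<alpha>)))"
  proof -
    have "residue H p = hankel \<alpha> p / exp p"
      unfolding H_def
    proof (rule residue_simple_pole_deriv[where s = UNIV])
      show "((\<lambda>w. exp w - of_real r) has_field_derivative exp p) (at p)"
        by (auto intro!: derivative_eq_intros)
    qed (use r in \<open>auto simp: hankel_def expp intro!: holomorphic_intros\<close>)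
    also have "\<dots> = exp (- exp (of_real \<alpha> * p))" by (simp add: hankel_def)
    also have "of_real \<alpha> * p = complex_of_real (\<alpha> * ln r)" by (simp add: p_def)
    also have "exp (- exp (complex_of_real (\<alpha> * ln r))) = complex_of_real (exp (- exp (\<alpha> * ln r)))"
      by (simp only: exp_of_real of_real_minus[symmetric])
    also have "exp (\<alpha> * ln r) = r powr \<alpha>" using r by (simp add: powr_def)
    finally show ?thesis .
  qed
  \<comment> \<open>Every half-length exceeds |ln r|, so the pole is enclosed for each
    \<open>n\<close> and the vertical sides stay away from it.\<close>
  define N where "N n = real n + \<bar>ln r\<bar> + 1" for n
  have Npos: "N n > 0" for n by (auto simp: N_def)
  have Nlim: "filterlim N at_top sequentially"
    unfolding N_def by (rule filterlim_at_top_mono[OF filterlim_real_sequentially]) auto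
  have ci: "H contour_integrable_on linepath a b" if "path_image (linepath a b) \<subseteq> S - {p}" for a b
    using that holo by (intro contour_integrable_continuous_linepath)
      (auto intro: continuous_on_subset[OF holomorphic_on_imp_continuous_on])
  define hor where "hor s n = contour_integral (linepath (Complex (- N n) s) (Complex (N n) s)) H" for s n
  define vert where "vert x = contour_integral (linepath (Complex x (- \<theta>)) (Complex x \<theta>)) H" for x
  have rect: "hor (- \<theta>) n - hor \<theta> n + vert (N n) - vert (- N n) = 2 * of_real pi * \<i> * complex_of_real (exp (- (r powr \<alpha>)))" for n
  proof -
    define a1 a3 where "a1 = Complex (- N n) (- \<theta>)" and "a3 = Complex (N n) \<theta>"
    let ?g = "rectpath a1 a3"
    have le: "Re a1 \<le> Re a3" "Im a1 \<le> Im a3" using Npos[of n] \<theta> by (auto simp: a1_def a3_def)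
    have pbox: "p \<in> box a1 a3"
      using \<theta> by (auto simp: in_box_complex_iff a1_def a3_def p_def N_def)
    have cb: "cbox a1 a3 \<subseteq> S"
      using \<theta> by (auto simp: in_cbox_complex_iff a1_def a3_def S_def)
    have img: "path_image ?g \<subseteq> S - {p}"
      using path_image_rectpath_cbox_minus_box[OF le] cb pbox by auto
    have "contour_integral ?g H = complex_of_real (2 * pi) * \<i> * (\<Sum>p\<in>{p}. winding_number ?g p * residue H p)"
    proof (rule Residue_theorem[OF S])
      show "\<forall>z. z \<notin> S \<longrightarrow> winding_number ?g z = 0"
        using cb winding_number_rectpath_outside[OF le] by blast
    qed (use holo img in auto)
    also have "\<dots> = 2 * of_real pi * \<i> * complex_of_real (exp (- (r powr \<alpha>)))"
      using winding_number_rectpath[OF pbox] res by simp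
    \<comment> \<open>The boundary is traversed counterclockwise, so the top and left sides run
      against the direction of \<open>hor\<close> and \<open>vert\<close>.\<close>
    also have "contour_integral ?g H = hor (- \<theta>) n + (vert (N n) + (- hor \<theta> n + - vert (- N n)))"
    proof -
      let ?a2 = "Complex (N n) (- \<theta>)" and ?a4 = "Complex (- N n) \<theta>"
      have pim: "path_image (linepath a1 ?a2) \<subseteq> S - {p}" "path_image (linepath ?a2 a3) \<subseteq> S - {p}"
         "path_image (linepath a3 ?a4) \<subseteq> S - {p}" "path_image (linepath ?a4 a1) \<subseteq> S - {p}"
        using img by (auto simp: rectpath_def Let_def path_image_join a1_def a3_def)
      note cis = pim[THEN ci]
      have "contour_integral ?g H = contour_integral (linepath a1 ?a2) H + (contour_integral (linepath ?a2 a3) H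
          + (contour_integral (linepath a3 ?a4) H + contour_integral (linepath ?a4 a1) H))"
        using cis by (simp add: rectpath_def Let_def a1_def a3_def)
      moreover have "contour_integral (linepath a3 ?a4) H = - hor \<theta> n"
        unfolding hor_def a3_def by (rule contour_integral_reversepath[of "linepath ?a4 a3", simplified, unfolded a3_def]) 
      moreover have "contour_integral (linepath ?a4 a1) H = - vert (- N n)"
        unfolding vert_def a1_def by (rule contour_integral_reversepath[of "linepath a1 ?a4", simplified, unfolded a1_def])
      ultimately show ?thesis by (simp add: hor_def vert_def a1_def a3_def)
    qed
    finally show ?thesis by (simp add: algebra_simps)
  qed
  have horlim: "(\<lambda>n. hor s n) \<longlonglongrightarrow> (LINT x|lborel. H (Complex x s))" if s: "\<bar>s\<bar> = \<theta>" for s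
  proof -
    let ?f = "\<lambda>x. H (Complex x s)"
    have int: "integrable lborel ?f"
      unfolding H_def using hankel_quotient_integrable assms(1) \<theta> r s by simp
    have hor_eq: "hor s n = (LINT x|lborel. indicator {- N n..N n} x *\<^sub>R ?f x)" for n
    proof -
      have "set_integrable lborel {- N n..N n} ?f"
        unfolding set_integrable_def by (intro integrable_mult_indicator int) auto
      from set_borel_integral_eq_integral(2)[OF this] show ?thesis
        unfolding hor_def set_lebesgue_integral_def
        using contour_integral_linepath_same_Im[of "- N n" "N n" s H] Npos[of n] by simp
    qed
    show ?thesis unfolding hor_eq by (rule integral_truncation_limit[OF int Nlim])
  qed
  have segim: "Re w = x \<and> \<bar>Im w\<bar> \<le> \<theta>" if "w \<in> closed_segment (Complex x (- \<theta>)) (Complex x \<theta>)" for w x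
    using that \<theta> by (auto simp: closed_segment_same_Re closed_segment_eq_real_ivl)
  \<comment> \<open>Majorant of the integrand on the vertical segment at abscissa \<open>x\<close>,
    from |exp w - r| \<ge> |exp x - r|. To the right the double exponential makes it vanish, to the
    left the factor \<open>exp x\<close> does, while the denominator tends to
    \<open>r\<close>.\<close>
  define B where "B x = exp (- c * exp (\<alpha> * x)) * exp x / \<bar>exp x - r\<bar>" for x
  have vbound: "norm (vert x) \<le> B x * (2 * \<theta>)" if x: "\<bar>x\<bar> > \<bar>ln r\<bar>" for x
  proof -
    have "exp x \<noteq> r" using x r by auto
    then have d: "\<bar>exp x - r\<bar> > 0" by simp
    have "norm (vert x) \<le> B x * norm (Complex x \<theta> - Complex x (- \<theta>))"
      unfolding vert_def
    proof (rule contour_integral_bound_linepath)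
      show "H contour_integrable_on linepath (Complex x (- \<theta>)) (Complex x \<theta>)"
      proof (rule ci, rule subsetI)
        fix w assume "w \<in> path_image (linepath (Complex x (- \<theta>)) (Complex x \<theta>))"
        then have "Re w = x" "\<bar>Im w\<bar> \<le> \<theta>" using segim[of w x] by auto
        then show "w \<in> S - {p}" using \<theta> x by (auto simp: S_def p_def)
      qed
      show "0 \<le> B x" by (simp add: B_def)
      fix w assume "w \<in> closed_segment (Complex x (- \<theta>)) (Complex x \<theta>)"
      then have w: "Re w = x" "\<bar>Im w\<bar> \<le> \<theta>" using segim by blast+
      have "\<bar>exp x - r\<bar> \<le> norm (exp w - of_real r)"
        using norm_triangle_ineq3[of "exp w" "complex_of_real r"] r w by simp
      then show "norm (H w) \<le> B x"
        unfolding H_def norm_divide B_def c_def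
        using norm_hankel_le[of \<alpha> w \<theta>] \<alpha> \<theta> w d pi_gt_zero by (intro frac_le) auto
    qed
    also have "norm (Complex x \<theta> - Complex x (- \<theta>)) = 2 * \<theta>"
      using \<theta> by (simp add: complex_diff cmod_def real_sqrt_mult)
    finally show ?thesis .
  qed
  have v: "(\<lambda>n. vert (X n)) \<longlonglongrightarrow> 0" if "\<And>n. \<bar>X n\<bar> = N n" "(\<lambda>n. B (X n)) \<longlonglongrightarrow> 0" for X
  proof (rule Lim_null_comparison)
    show "\<forall>\<^sub>F n in sequentially. norm (vert (X n)) \<le> B (X n) * (2 * \<theta>)"
      by (intro always_eventually allI vbound) (use that(1) in \<open>auto simp: N_def\<close>)
    show "(\<lambda>n. B (X n) * (2 * \<theta>)) \<longlonglongrightarrow> 0" by (rule tendsto_mult_left_zero[OF that(2)])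
  qed
  have "(B \<longlongrightarrow> 0) at_top" "(B \<longlongrightarrow> 0) at_bot"
    unfolding B_def using c \<alpha> r by real_asymp+
  then have "(\<lambda>n. B (N n)) \<longlonglongrightarrow> 0" "(\<lambda>n. B (- N n)) \<longlonglongrightarrow> 0"
    using Nlim by (auto intro: filterlim_compose simp: filterlim_uminus_at_top)
  then have v1: "(\<lambda>n. vert (N n)) \<longlonglongrightarrow> 0" and v2: "(\<lambda>n. vert (- N n)) \<longlonglongrightarrow> 0"
    using Npos by (auto intro!: v simp: less_imp_le)
  have "(\<lambda>n. hor (- \<theta>) n - hor \<theta> n + vert (N n) - vert (- N n)) \<longlonglongrightarrow>
     (LINT x|lborel. H (Complex x (- \<theta>))) - (LINT x|lborel. H (Complex x \<theta>)) + 0 - 0"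
    using \<theta> by (intro tendsto_intros horlim v1 v2) auto
  then have "2 * of_real pi * \<i> * complex_of_real (exp (- (r powr \<alpha>)))
     = (LINT x|lborel. H (Complex x (- \<theta>))) - (LINT x|lborel. H (Complex x \<theta>))"
    unfolding rect by (simp add: LIMSEQ_const_iff)
  then show ?thesis by (simp add: field_simps)
qed

section \<open>Multipliers with integrable kernels\<close>

text \<open>The L1 norm of the kernel bounds the multiplier on bounded functions at every point.
  With values in \<open>ennreal\<close>, finiteness can be a conclusion instead of a side
  condition.\<close>

definition kernel_norm :: "(real^'n::finite \<Rightarrow> complex) \<Rightarrow> ennreal" where
  "kernel_norm m = (\<integral>\<^sup>+x. ennreal (norm (inv_fourier m x)) \<partial>lborel)"

text \<open>The parameter carries the symbol and the point of evaluation at once, so the same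
  argument yields measurability of a single kernel and joint measurability of a family in time and
  space.\<close>

lemma borel_measurable_inv_fourier_pair:
  fixes m :: "'a \<Rightarrow> real^'n::finite \<Rightarrow> complex"
  assumes m: "case_prod m \<in> borel_measurable (M \<Otimes>\<^sub>M borel)"
    and g: "g \<in> M \<rightarrow>\<^sub>M borel"
  shows "(\<lambda>p. inv_fourier (m p) (g p)) \<in> borel_measurable M"
proof -
  have inner: "(\<lambda>z::(real^'n) \<times> (real^'n). cis (fst z \<bullet> snd z)) \<in> borel_measurable (borel \<Otimes>\<^sub>M borel)"
    unfolding borel_prod cis_conv_exp by (intro borel_measurable_continuous_onI continuous_intros)
  have c: "(\<lambda>z. cis (g (fst z) \<bullet> snd z)) \<in> borel_measurable (M \<Otimes>\<^sub>M borel)"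
  proof -
    have "(\<lambda>z. (g (fst z), snd z)) \<in> M \<Otimes>\<^sub>M borel \<rightarrow>\<^sub>M borel \<Otimes>\<^sub>M borel"
      by (intro measurable_Pair measurable_compose[OF measurable_fst g] measurable_snd)
    from measurable_compose[OF this inner] show ?thesis by (simp only: fst_conv snd_conv)
  qed
  have "(\<lambda>z. cis (g (fst z) \<bullet> snd z) * case_prod m z) \<in> borel_measurable (M \<Otimes>\<^sub>M borel)"
    by (intro borel_measurable_times c m)
  then have "(\<lambda>(p, \<xi>). cis (g p \<bullet> \<xi>) * m p \<xi>) \<in> borel_measurable (M \<Otimes>\<^sub>M lborel)"
    by (simp add: case_prod_beta)
  then have "(\<lambda>p. LINT \<xi>|lborel. cis (g p \<bullet> \<xi>) * m p \<xi>) \<in> borel_measurable M"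
    by (rule lborel.borel_measurable_lebesgue_integral)
  then show ?thesis unfolding inv_fourier_def by measurable
qed

lemma borel_measurable_inv_fourier [measurable]:
  fixes m :: "real^'n::finite \<Rightarrow> complex"
  assumes m: "m \<in> borel_measurable borel"
  shows "inv_fourier m \<in> borel_measurable borel"
proof (rule borel_measurable_inv_fourier_pair[where m = "\<lambda>_. m" and g = "\<lambda>x. x"])
  show "case_prod (\<lambda>_::real^'n. m) \<in> borel_measurable (borel \<Otimes>\<^sub>M borel)"
  proof -
    have "(\<lambda>z. m (snd z)) \<in> borel_measurable ((borel :: (real^'n) measure) \<Otimes>\<^sub>M borel)"
      by (rule measurable_compose[OF measurable_snd m])
    then show ?thesis by (simp only: case_prod_unfold)
  qed
qed simp

lemma inv_fourier_scale:
  fixes m :: "real^'n::finite \<Rightarrow> complex"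
  assumes [measurable]: "m \<in> borel_measurable borel" and c: "c > 0"
  shows "inv_fourier (\<lambda>\<xi>. m (c *\<^sub>R \<xi>)) x = inv_fourier m (x /\<^sub>R c) / of_real (c ^ CARD('n))"
proof -
  have cc: "c * (inverse c * y) = y" for y
    using c by (simp add: field_simps)
  have "(LINT \<xi>|lborel. cis ((x /\<^sub>R c) \<bullet> \<xi>) * m \<xi>)
      = \<bar>c\<bar> ^ DIM(real^'n) *\<^sub>R (LINT \<xi>|lborel. cis ((x /\<^sub>R c) \<bullet> (0 + c *\<^sub>R \<xi>)) * m (0 + c *\<^sub>R \<xi>))"
  proof (rule lborel_integral_affine)
    show "(\<lambda>\<xi>. cis ((x /\<^sub>R c) \<bullet> \<xi>) * m \<xi>) \<in> borel_measurable borel"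
      by (intro borel_measurable_times borel_measurable_cis_inner assms)
  qed (use c in simp)
  also have "\<dots> = of_real (c ^ CARD('n)) * (LINT \<xi>|lborel. cis (x \<bullet> \<xi>) * m (c *\<^sub>R \<xi>))"
    using c by (simp add: scaleR_conv_of_real[where 'a = complex] cc)
  finally show ?thesis
    unfolding inv_fourier_def using c by simp
qed

text \<open>Dilating the symbol by \<open>c\<close> turns the kernel K(x) into c^(-n) K(x/c), which
  has the same L1 norm. The power laws in time and in the Gaussian parameter rest on this.\<close>

lemma kernel_norm_scale:
  fixes m :: "real^'n::finite \<Rightarrow> complex"
  assumes [measurable]: "m \<in> borel_measurable borel" and c: "c > 0"
  shows "kernel_norm (\<lambda>\<xi>. m (c *\<^sub>R \<xi>)) = kernel_norm m"
proof -
  have "kernel_norm m = ennreal (\<bar>inverse c\<bar> ^ DIM(real^'n)) * (\<integral>\<^sup>+x. ennreal (norm (inv_fourier m (0 + inverse c *\<^sub>R x))) \<partial>lborel)"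
    unfolding kernel_norm_def by (rule lborel_nn_integral_affine) (use c in auto)
  also have "\<dots> = (\<integral>\<^sup>+x. ennreal (\<bar>inverse c\<bar> ^ CARD('n)) * ennreal (norm (inv_fourier m (inverse c *\<^sub>R x))) \<partial>lborel)"
    by (subst nn_integral_cmult) auto
  also have "\<dots> = kernel_norm (\<lambda>\<xi>. m (c *\<^sub>R \<xi>))"
    unfolding kernel_norm_def using c
    by (intro nn_integral_cong)
       (simp add: inv_fourier_scale norm_mult norm_inverse norm_power divide_inverse power_inverse mult.commute flip: ennreal_mult)
  finally show ?thesis by simp
qed

lemma kernel_norm_cmult:
  assumes [measurable]: "m \<in> borel_measurable borel"
  shows "kernel_norm (\<lambda>\<xi>. c * m \<xi>) = ennreal (norm c) * kernel_norm m"
  unfolding kernel_norm_def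
  by (subst nn_integral_cmult[symmetric]) (auto simp: inv_fourier_cmult norm_mult ennreal_mult)

lemma kernel_norm_add:
  assumes "integrable lborel m" "integrable lborel m'"
  shows "kernel_norm (\<lambda>\<xi>. m \<xi> + m' \<xi>) \<le> kernel_norm m + kernel_norm m'"
proof -
  have [measurable]: "m \<in> borel_measurable borel" "m' \<in> borel_measurable borel"
    using assms by auto
  have "kernel_norm (\<lambda>\<xi>. m \<xi> + m' \<xi>) \<le> (\<integral>\<^sup>+x. ennreal (norm (inv_fourier m x)) + ennreal (norm (inv_fourier m' x)) \<partial>lborel)"
    unfolding kernel_norm_def
    by (intro nn_integral_mono) (simp add: inv_fourier_add[OF assms] norm_triangle_ineq flip: ennreal_plus)
  also have "\<dots> = kernel_norm m + kernel_norm m'"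
    unfolding kernel_norm_def by (rule nn_integral_add) auto
  finally show ?thesis .
qed

text \<open>Minkowski's integral inequality. Joint integrability lets Fubini exchange the Fourier
  integral with the superposition; Tonelli then exchanges \<open>x\<close> and \<open>p\<close> for
  the nonnegative norms.\<close>

lemma kernel_norm_integral_le:
  fixes m :: "'a \<Rightarrow> real^'n::finite \<Rightarrow> complex"
  assumes M: "sigma_finite_measure M" and int: "integrable (M \<Otimes>\<^sub>M lborel) (case_prod m)"
  shows "kernel_norm (\<lambda>\<xi>. LINT p|M. m p \<xi>) \<le> (\<integral>\<^sup>+p. kernel_norm (m p) \<partial>M)"
proof -
  interpret pair_sigma_finite M "lborel :: (real^'n) measure"
    by (intro pair_sigma_finite.intro M sigma_finite_lborel)
  have m: "case_prod m \<in> borel_measurable (M \<Otimes>\<^sub>M lborel)"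
    using int by (rule borel_measurable_integrable)
  then have m': "case_prod m \<in> borel_measurable (M \<Otimes>\<^sub>M borel)"
    by (simp cong: measurable_cong_sets)
  define c where "c = complex_of_real (1 / (2 * pi) ^ CARD('n))"
  have meas: "(\<lambda>(p, x). inv_fourier (m p) x) \<in> borel_measurable (M \<Otimes>\<^sub>M lborel)"
  proof -
    have "(\<lambda>z. inv_fourier (m (fst z)) (snd z)) \<in> borel_measurable (M \<Otimes>\<^sub>M (borel :: (real^'n) measure))"
    proof (rule borel_measurable_inv_fourier_pair)
      have "(\<lambda>z. case_prod m (fst (fst z), snd z)) \<in> borel_measurable ((M \<Otimes>\<^sub>M (borel :: (real^'n) measure)) \<Otimes>\<^sub>M borel)"
        by (rule measurable_compose[OF _ m']) simp
      then show "case_prod (\<lambda>z. m (fst z)) \<in> borel_measurable ((M \<Otimes>\<^sub>M (borel :: (real^'n) measure)) \<Otimes>\<^sub>M borel)"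
        by (simp add: case_prod_beta)
    qed simp
    then show ?thesis by (simp add: case_prod_beta cong: measurable_cong_sets)
  qed
  have bound: "ennreal (norm (inv_fourier (\<lambda>\<xi>. LINT p|M. m p \<xi>) x)) \<le> (\<integral>\<^sup>+p. ennreal (norm (inv_fourier (m p) x)) \<partial>M)" for x
  proof -
    let ?f = "\<lambda>p \<xi>. cis (x \<bullet> \<xi>) * m p \<xi>"
    have i: "integrable (M \<Otimes>\<^sub>M lborel) (case_prod ?f)"
    proof (rule integrable_dominated[OF int])
      have "(\<lambda>z. cis (x \<bullet> snd z) * case_prod m z) \<in> borel_measurable (M \<Otimes>\<^sub>M lborel)"
        by (intro borel_measurable_times m) measurable
      then show "case_prod ?f \<in> borel_measurable (M \<Otimes>\<^sub>M lborel)"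
        by (simp add: case_prod_beta)
      show "AE z in M \<Otimes>\<^sub>M lborel. norm (case_prod ?f z) \<le> norm (case_prod m z)"
        by (intro AE_I2) (auto simp: norm_mult split: prod.split)
    qed
    have "inv_fourier (\<lambda>\<xi>. LINT p|M. m p \<xi>) x = c * (LINT \<xi>|lborel. LINT p|M. ?f p \<xi>)"
      unfolding inv_fourier_def c_def by simp
    also have "(LINT \<xi>|lborel. LINT p|M. ?f p \<xi>) = (LINT p|M. LINT \<xi>|lborel. ?f p \<xi>)"
      by (rule Fubini_integral[OF i])
    also have "c * \<dots> = (LINT p|M. inv_fourier (m p) x)"
      unfolding inv_fourier_def c_def by simp
    finally have eq: "inv_fourier (\<lambda>\<xi>. LINT p|M. m p \<xi>) x = (LINT p|M. inv_fourier (m p) x)" .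
    show ?thesis
      unfolding eq
    proof (cases "integrable M (\<lambda>p. inv_fourier (m p) x)")
      case True
      then show "ennreal (norm (LINT p|M. inv_fourier (m p) x)) \<le> (\<integral>\<^sup>+p. ennreal (norm (inv_fourier (m p) x)) \<partial>M)"
        by (rule integral_norm_bound_ennreal)
    qed (simp add: not_integrable_integral_eq)
  qed
  have "kernel_norm (\<lambda>\<xi>. LINT p|M. m p \<xi>) \<le> (\<integral>\<^sup>+x. (\<integral>\<^sup>+p. ennreal (norm (inv_fourier (m p) x)) \<partial>M) \<partial>lborel)"
    unfolding kernel_norm_def by (intro nn_integral_mono bound)
  also have "\<dots> = (\<integral>\<^sup>+p. (\<integral>\<^sup>+x. ennreal (norm (inv_fourier (m p) x)) \<partial>lborel) \<partial>M)"
  proof (rule Fubini')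
    have "(\<lambda>z. ennreal (norm (case z of (p, x) \<Rightarrow> inv_fourier (m p) x))) \<in> borel_measurable (M \<Otimes>\<^sub>M lborel)"
      using meas by measurable
    then show "(\<lambda>(p, x). ennreal (norm (inv_fourier (m p) x))) \<in> borel_measurable (M \<Otimes>\<^sub>M lborel)"
      by (simp add: case_prod_beta)
  qed
  also have "\<dots> = (\<integral>\<^sup>+p. kernel_norm (m p) \<partial>M)"
    unfolding kernel_norm_def ..
  finally show ?thesis .
qed

text \<open>Dominated symbols have pointwise convergent kernels, and Fatou's lemma passes the L1
  bound to the limit. This is how the Gaussian damping is removed.\<close>

lemma kernel_norm_limit:
  fixes m :: "real^'n::finite \<Rightarrow> complex"
  assumes meas: "\<And>k. M k \<in> borel_measurable borel" "m \<in> borel_measurable borel"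
    and w: "integrable lborel w" "\<And>k \<xi>. norm (M k \<xi>) \<le> w \<xi>"
    and lim: "\<And>\<xi>. (\<lambda>k. M k \<xi>) \<longlonglongrightarrow> m \<xi>"
    and bound: "\<And>k. kernel_norm (M k) \<le> B"
  shows "kernel_norm m \<le> B"
proof -
  have inv: "(\<lambda>k. inv_fourier (M k) x) \<longlonglongrightarrow> inv_fourier m x" for x
    unfolding inv_fourier_def
  proof (intro tendsto_mult tendsto_const integral_dominated_convergence)
    show "AE \<xi> in lborel. (\<lambda>k. cis (x \<bullet> \<xi>) * M k \<xi>) \<longlonglongrightarrow> cis (x \<bullet> \<xi>) * m \<xi>"
      by (intro AE_I2 tendsto_mult tendsto_const lim)
    show "AE \<xi> in lborel. norm (cis (x \<bullet> \<xi>) * M k \<xi>) \<le> w \<xi>" for k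
      by (intro AE_I2) (simp add: norm_mult w)
  qed (use meas w in auto)
  have "kernel_norm m = (\<integral>\<^sup>+x. liminf (\<lambda>k. ennreal (norm (inv_fourier (M k) x))) \<partial>lborel)"
    unfolding kernel_norm_def
  proof (rule nn_integral_cong)
    fix x :: "real^'n"
    have "(\<lambda>k. ennreal (norm (inv_fourier (M k) x))) \<longlonglongrightarrow> ennreal (norm (inv_fourier m x))"
      by (intro tendsto_ennrealI tendsto_norm inv)
    then show "ennreal (norm (inv_fourier m x)) = liminf (\<lambda>k. ennreal (norm (inv_fourier (M k) x)))"
      by (intro lim_imp_Liminf[symmetric] trivial_limit_sequentially)
  qed
  also have "\<dots> \<le> liminf (\<lambda>k. kernel_norm (M k))"
    unfolding kernel_norm_def by (rule nn_integral_liminf) (use meas in measurable)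
  also have "\<dots> \<le> B"
    by (rule order_trans[OF Liminf_le_Limsup[OF trivial_limit_sequentially] Limsup_bounded])
       (intro always_eventually allI bound)
  finally show ?thesis .
qed

lemma schwartz_kernel_norm_finite: "m \<in> schwartz \<Longrightarrow> kernel_norm m < \<infinity>"
  using schwartz_integrable[OF schwartz_inv_fourier] unfolding kernel_norm_def integrable_iff_bounded by blast

text \<open>The multiplier \<open>q / (|\<xi>|\<^sup>2 - z)\<close> is a Laplace transform in \<open>|\<xi>|\<^sup>2\<close>, which expresses it by
  Gaussian multipliers.\<close>

lemma laplace_resolvent:
  fixes z :: complex
  assumes "Re z < r"
  shows "integrable lborel (\<lambda>s. indicator {0..} s *\<^sub>R exp (- (of_real s * (of_real r - z))))"
    and "(LINT s|lborel. indicator {0..} s *\<^sub>R exp (- (of_real s * (of_real r - z)))) = 1 / (of_real r - z)"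
    and "(\<integral>\<^sup>+s. ennreal (exp (- (s * (r - Re z)))) * indicator {0..} s \<partial>lborel) = ennreal (1 / (r - Re z))"
proof -
  define a where "a = of_real r - z"
  let ?E = "\<lambda>s::real. indicator {0..} s *\<^sub>R exp (- (of_real s * a))"
  let ?F = "\<lambda>(n::nat) s::real. indicator {0..real n} s *\<^sub>R exp (- (of_real s * a))"
  have Rea: "Re a > 0" using assms by (simp add: a_def)
  then have a0: "a \<noteq> 0" by auto
  have Rea': "r - Re z = Re a" by (simp add: a_def)
  show nn: "(\<integral>\<^sup>+s. ennreal (exp (- (s * (r - Re z)))) * indicator {0..} s \<partial>lborel) = ennreal (1 / (r - Re z))"
    unfolding Rea'
  proof (subst nn_integral_FTC_atLeast[where F = "\<lambda>s. - exp (- (s * Re a)) / Re a" and T = 0])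
    show "((\<lambda>s. - exp (- (s * Re a)) / Re a) \<longlongrightarrow> 0) at_top"
      using Rea by real_asymp
  qed (use Rea in \<open>auto intro!: derivative_eq_intros simp: field_simps\<close>)
  have norm_eq: "ennreal (norm (?E s)) = ennreal (exp (- (s * (r - Re z)))) * indicator {0..} s" for s
    unfolding Rea' by (auto simp: indicator_def)
  have meas: "?E \<in> borel_measurable lborel"
  proof -
    have [measurable]: "(\<lambda>s. exp (- (of_real s * a))) \<in> borel_measurable borel"
      by (intro borel_measurable_continuous_onI continuous_intros)
    show ?thesis by measurable
  qed
  show int: "integrable lborel (\<lambda>s. indicator {0..} s *\<^sub>R exp (- (of_real s * (of_real r - z))))"
    unfolding a_def[symmetric]
  proof (rule integrableI_bounded[OF meas])
    show "(\<integral>\<^sup>+s. ennreal (norm (?E s)) \<partial>lborel) < \<infinity>"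
      unfolding norm_eq nn by simp
  qed
  have "indicator {- real n..real n} s *\<^sub>R ?E s = ?F n s" for n s
    by (auto simp: indicator_def)
  then have lim: "(\<lambda>n. LINT s|lborel. ?F n s) \<longlonglongrightarrow> (LINT s|lborel. ?E s)"
    using integral_truncation_limit[OF int[folded a_def] filterlim_real_sequentially] by simp
  have val: "(LINT s|lborel. ?F n s) = - exp (- (of_real (real n) * a)) / a + 1 / a" for n
  proof -
    have "(LINT s|lborel. ?F n s)
       = (- exp (- (of_real (real n) * a)) / a) - (- exp (- (of_real 0 * a)) / a)"
    proof (rule integral_FTC_Icc)
      show "((\<lambda>s. - exp (- (of_real s * a)) / a) has_vector_derivative exp (- (of_real x * a))) (at x within {0..real n})" for x
      proof -
        have "((\<lambda>w. - exp (- (w * a)) / a) has_field_derivative exp (- (of_real x * a))) (at (of_real x))"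
          using a0 by (auto intro!: derivative_eq_intros simp: field_simps)
        from has_vector_derivative_real_field[OF this] show ?thesis .
      qed
    qed (auto intro!: continuous_intros)
    then show ?thesis by simp
  qed
  have "(\<lambda>n. - exp (- (of_real (real n) * a)) / a + 1 / a) \<longlonglongrightarrow> 0 + 1 / a"
  proof (rule tendsto_add[OF tendsto_norm_zero_cancel tendsto_const])
    have "(\<lambda>n. exp (- (real n * Re a))) \<longlonglongrightarrow> 0"
      using Rea by real_asymp
    then have "(\<lambda>n. exp (- (real n * Re a)) / norm a) \<longlonglongrightarrow> 0"
      by (rule tendsto_divide_zero)
    then show "(\<lambda>n. norm (- exp (- (of_real (real n) * a)) / a)) \<longlonglongrightarrow> 0"
      by (simp add: norm_divide)
  qed
  from LIMSEQ_unique[OF lim[unfolded val] this]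
  show "(LINT s|lborel. indicator {0..} s *\<^sub>R exp (- (of_real s * (of_real r - z)))) = 1 / (of_real r - z)"
    unfolding a_def by simp
qed

abbreviation gauss :: "real \<Rightarrow> 'a::real_normed_vector \<Rightarrow> real" where
  "gauss s \<xi> \<equiv> exp (- (s * (norm \<xi>)\<^sup>2))"

lemma kernel_norm_resolvent_le:
  fixes q :: "real^'n::finite \<Rightarrow> complex"
  assumes [measurable]: "q \<in> borel_measurable borel" and q0: "q 0 = 0"
    and z: "Re z \<le> 0"
    and int: "integrable lborel (\<lambda>\<xi>. norm (q \<xi>) * gauss \<epsilon> \<xi> / ((norm \<xi>)\<^sup>2 - Re z))"
  shows "kernel_norm (\<lambda>\<xi>. q \<xi> * of_real (gauss \<epsilon> \<xi>) / (of_real ((norm \<xi>)\<^sup>2) - z))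
    \<le> (\<integral>\<^sup>+s. ennreal (exp (s * Re z)) * kernel_norm (\<lambda>\<xi>. q \<xi> * of_real (gauss (\<epsilon> + s) \<xi>)) * indicator {0..} s \<partial>lborel)"
proof -
  define m where "m s \<xi> = (indicator {0..} s *\<^sub>R exp (of_real s * z)) * (q \<xi> * of_real (gauss (\<epsilon> + s) \<xi>))" for s :: real and \<xi> :: "real^'n"
  have m_eq: "m s \<xi> = (q \<xi> * of_real (gauss \<epsilon> \<xi>)) * (indicator {0..} s *\<^sub>R exp (- (of_real s * (of_real ((norm \<xi>)\<^sup>2) - z))))" for s \<xi>
  proof -
    have "exp (- (of_real s * (of_real ((norm \<xi>)\<^sup>2) - z))) = exp (of_real s * z) * complex_of_real (gauss s \<xi>)"
      by (simp only: exp_of_real[symmetric] exp_add[symmetric]) (simp add: algebra_simps)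
    moreover have "gauss (\<epsilon> + s) \<xi> = gauss \<epsilon> \<xi> * gauss s \<xi>"
      by (simp add: algebra_simps flip: exp_add)
    ultimately show ?thesis unfolding m_def by (simp add: mult_ac)
  qed
  have val: "(LINT s|lborel. m s \<xi>) = q \<xi> * of_real (gauss \<epsilon> \<xi>) / (of_real ((norm \<xi>)\<^sup>2) - z)" for \<xi>
  proof (cases "\<xi> = 0")
    case True
    then show ?thesis by (simp add: m_def q0)
  next
    case False
    then have "Re z < (norm \<xi>)\<^sup>2" using z by (simp add: order_le_less_trans)
    from laplace_resolvent(2)[OF this] show ?thesis
      by (simp only: m_eq integral_mult_right_zero) simp
  qed
  have [measurable]: "(\<lambda>s. exp (complex_of_real s * z)) \<in> borel_measurable borel"
    by (intro borel_measurable_continuous_onI continuous_intros)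
  have meas: "case_prod m \<in> borel_measurable (lborel \<Otimes>\<^sub>M lborel)"
    unfolding m_def by measurable
  have minf: "integrable (lborel \<Otimes>\<^sub>M lborel) (case_prod m)"
  proof (rule integrableI_bounded[OF meas])
    have "(\<integral>\<^sup>+z. ennreal (norm (case_prod m z)) \<partial>(lborel \<Otimes>\<^sub>M lborel)) = (\<integral>\<^sup>+\<xi>. \<integral>\<^sup>+s. ennreal (norm (m s \<xi>)) \<partial>lborel \<partial>lborel)"
      using meas by (subst lborel_pair.nn_integral_snd[symmetric]) auto
    also have "\<dots> = (\<integral>\<^sup>+\<xi>. ennreal (norm (q \<xi>) * gauss \<epsilon> \<xi> / ((norm \<xi>)\<^sup>2 - Re z)) \<partial>lborel)"
    proof (rule nn_integral_cong)
      fix \<xi> :: "real^'n"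
      show "(\<integral>\<^sup>+s. ennreal (norm (m s \<xi>)) \<partial>lborel) = ennreal (norm (q \<xi>) * gauss \<epsilon> \<xi> / ((norm \<xi>)\<^sup>2 - Re z))"
      proof (cases "\<xi> = 0")
        case True
        then show ?thesis by (simp add: m_def q0)
      next
        case False
        then have lt: "Re z < (norm \<xi>)\<^sup>2" using z by (simp add: order_le_less_trans)
        have "(\<integral>\<^sup>+s. ennreal (norm (m s \<xi>)) \<partial>lborel) = (\<integral>\<^sup>+s. ennreal (norm (q \<xi>) * gauss \<epsilon> \<xi>) * (ennreal (exp (- (s * ((norm \<xi>)\<^sup>2 - Re z)))) * indicator {0..} s) \<partial>lborel)"
          by (intro nn_integral_cong) (auto simp: m_eq norm_mult indicator_def simp flip: ennreal_mult)
        also have "\<dots> = ennreal (norm (q \<xi>) * gauss \<epsilon> \<xi>) * ennreal (1 / ((norm \<xi>)\<^sup>2 - Re z))"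
          by (subst nn_integral_cmult) (auto simp: laplace_resolvent(3)[OF lt])
        also have "\<dots> = ennreal (norm (q \<xi>) * gauss \<epsilon> \<xi> / ((norm \<xi>)\<^sup>2 - Re z))"
          using lt by (simp flip: ennreal_mult)
        finally show ?thesis .
      qed
    qed
    also have "\<dots> < \<infinity>"
    proof -
      have nonneg: "norm (q \<xi>) * gauss \<epsilon> \<xi> / ((norm \<xi>)\<^sup>2 - Re z) \<ge> 0" for \<xi>
        using z by (intro divide_nonneg_nonneg mult_nonneg_nonneg) (auto intro: order_trans[of _ 0])
      show ?thesis
        using int unfolding integrable_iff_bounded real_norm_def abs_of_nonneg[OF nonneg] by blast
    qed
    finally show "(\<integral>\<^sup>+z. ennreal (norm (case_prod m z)) \<partial>(lborel \<Otimes>\<^sub>M lborel)) < \<infinity>" .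
  qed
  have "kernel_norm (\<lambda>\<xi>. LINT s|lborel. m s \<xi>) \<le> (\<integral>\<^sup>+s. kernel_norm (m s) \<partial>lborel)"
    by (rule kernel_norm_integral_le[OF sigma_finite_lborel minf])
  also have "\<dots> = (\<integral>\<^sup>+s. ennreal (exp (s * Re z)) * kernel_norm (\<lambda>\<xi>. q \<xi> * of_real (gauss (\<epsilon> + s) \<xi>)) * indicator {0..} s \<partial>lborel)"
  proof (rule nn_integral_cong)
    fix s :: real
    have "kernel_norm (m s) = ennreal (norm (indicator {0..} s *\<^sub>R exp (of_real s * z))) * kernel_norm (\<lambda>\<xi>. q \<xi> * of_real (gauss (\<epsilon> + s) \<xi>))"
      unfolding m_def by (rule kernel_norm_cmult) measurable
    then show "kernel_norm (m s) = ennreal (exp (s * Re z)) * kernel_norm (\<lambda>\<xi>. q \<xi> * of_real (gauss (\<epsilon> + s) \<xi>)) * indicator {0..} s"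
      by (auto simp: indicator_def)
  qed
  finally show ?thesis unfolding val .
qed

section \<open>The kernel of the projected derivative of the semigroup\<close>

definition leray_deriv_symbol :: "'n::finite \<Rightarrow> 'n \<Rightarrow> 'n \<Rightarrow> real^'n \<Rightarrow> complex" where
  "leray_deriv_symbol i j k \<xi> = complex_of_real (leray_symbol i j \<xi>) * (\<i> * complex_of_real (\<xi> $ k))"

lemma borel_measurable_vec_nth [measurable]: "(\<lambda>\<xi>::real^'n::finite. \<xi> $ k) \<in> borel_measurable borel"
  by (intro borel_measurable_continuous_onI continuous_intros)

lemma borel_measurable_leray_symbol [measurable]: "leray_symbol i j \<in> borel_measurable borel"
  unfolding leray_symbol_def by measurable

lemma borel_measurable_leray_deriv_symbol [measurable]: "leray_deriv_symbol i j k \<in> borel_measurable borel"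
  unfolding leray_deriv_symbol_def by measurable

lemma norm_leray_symbol_le: "norm (leray_symbol i j \<xi>) \<le> 2"
proof -
  have "\<bar>\<xi> $ i * \<xi> $ j\<bar> \<le> norm \<xi> * norm \<xi>"
    unfolding abs_mult by (intro mult_mono component_le_norm_cart) auto
  then have "\<bar>\<xi> $ i * \<xi> $ j / (norm \<xi>)\<^sup>2\<bar> \<le> 1"
    by (cases "\<xi> = 0") (simp_all add: power2_eq_square field_simps)
  moreover have "\<bar>(if i = j then 1 else 0 :: real)\<bar> \<le> 1" by simp
  ultimately show ?thesis
    unfolding leray_symbol_def real_norm_def
    using abs_triangle_ineq4[of "if i = j then 1 else 0" "\<xi> $ i * \<xi> $ j / (norm \<xi>)\<^sup>2"] by linarith
qed

lemma norm_leray_deriv_symbol_le: "norm (leray_deriv_symbol i j k \<xi>) \<le> 2 * norm \<xi>"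
  unfolding leray_deriv_symbol_def norm_mult norm_of_real
  using norm_leray_symbol_le[of i j \<xi>] component_le_norm_cart[of \<xi> k]
  by (simp add: mult_mono)

lemma leray_deriv_symbol_zero [simp]: "leray_deriv_symbol i j k 0 = 0"
  by (simp add: leray_deriv_symbol_def)

lemma leray_symbol_scale:
  assumes "c \<noteq> 0"
  shows "leray_symbol i j (c *\<^sub>R \<xi>) = leray_symbol i j \<xi>"
proof -
  have e1: "(c *\<^sub>R \<xi>) $ i * (c *\<^sub>R \<xi>) $ j = c\<^sup>2 * (\<xi> $ i * \<xi> $ j)"
    by (simp add: power2_eq_square)
  have e2: "(norm (c *\<^sub>R \<xi>))\<^sup>2 = c\<^sup>2 * (norm \<xi>)\<^sup>2"
    by (simp add: power_mult_distrib)
  show ?thesis unfolding leray_symbol_def e1 e2 using assms by simp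
qed

lemma leray_deriv_symbol_scale: "c \<noteq> 0 \<Longrightarrow> leray_deriv_symbol i j k (c *\<^sub>R \<xi>) = of_real c * leray_deriv_symbol i j k \<xi>"
  by (simp add: leray_deriv_symbol_def leray_symbol_scale)

section \<open>Gaussian and resolvent multipliers with the projected derivative\<close>

lemma gaussian_weight_integrable:
  assumes "\<sigma> > 0"
  shows "integrable lborel (\<lambda>\<xi>::real^'n::finite. (1 + norm \<xi>) ^ a * gauss \<sigma> \<xi>)"
proof (rule integrable_rapid_decay)
  let ?N = "2 * CARD('n) + a"
  fix \<xi> :: "real^'n"
  have "(1 + norm \<xi>) ^ (2 * CARD('n)) * norm ((1 + norm \<xi>) ^ a * gauss \<sigma> \<xi>)
     = (1 + norm \<xi>) ^ ?N * gauss \<sigma> \<xi>"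
    by (simp add: power_add abs_mult)
  also have "\<dots> \<le> exp (real ?N * norm \<xi>) * gauss \<sigma> \<xi>"
    by (intro mult_right_mono one_plus_power_le_exp) auto
  also have "\<dots> = exp (real ?N * norm \<xi> - \<sigma> * (norm \<xi>)\<^sup>2)"
    by (simp flip: exp_add)
  \<comment> \<open>The exponent is the maximum over r of N r - \<sigma> r^2, found by completing
    the square.\<close>
  also have "\<dots> \<le> exp ((real ?N)\<^sup>2 / (4 * \<sigma>))"
  proof -
    have "0 \<le> (2 * \<sigma> * norm \<xi> - real ?N)\<^sup>2" by simp
    then have "(4 * \<sigma>) * (real ?N * norm \<xi> - \<sigma> * (norm \<xi>)\<^sup>2) \<le> (real ?N)\<^sup>2"
      by (simp add: power2_eq_square algebra_simps)
    then show ?thesis using assms by (simp add: field_simps)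
  qed
  finally show "(1 + norm \<xi>) ^ (2 * CARD('n)) * norm ((1 + norm \<xi>) ^ a * gauss \<sigma> \<xi>)
     \<le> exp ((real ?N)\<^sup>2 / (4 * \<sigma>))" .
qed measurable

text \<open>Dilation by sqrt s reduces to s = 1 without changing the L1 norm of the kernel;
  homogeneity of degree \<open>d\<close> turns the dilation of \<open>q\<close> into the factor
  s^(-d/2).\<close>

lemma kernel_norm_gaussian_homogeneous:
  fixes q :: "real^'n::finite \<Rightarrow> complex"
  assumes [measurable]: "q \<in> borel_measurable borel" and hom: "\<And>c \<xi>. q (c *\<^sub>R \<xi>) = of_real (c ^ d) * q \<xi>" and s: "s > 0"
  shows "kernel_norm (\<lambda>\<xi>. q \<xi> * of_real (gauss s \<xi>))
    = ennreal (s powr (- real d / 2)) * kernel_norm (\<lambda>\<xi>. q \<xi> * of_real (exp (- (norm \<xi>)\<^sup>2)))"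
proof -
  define c where "c = sqrt s"
  have c: "c > 0" "c\<^sup>2 = s" using s by (auto simp: c_def)
  let ?M = "\<lambda>\<xi>. q \<xi> * of_real (exp (- (norm \<xi>)\<^sup>2))"
  have eq: "q \<xi> * of_real (gauss s \<xi>) = of_real (inverse (c ^ d)) * ?M (c *\<^sub>R \<xi>)" for \<xi>
    using c by (simp add: hom power_mult_distrib)
  have "kernel_norm (\<lambda>\<xi>. q \<xi> * of_real (gauss s \<xi>))
     = ennreal (norm (complex_of_real (inverse (c ^ d)))) * kernel_norm (\<lambda>\<xi>. ?M (c *\<^sub>R \<xi>))"
    unfolding eq by (rule kernel_norm_cmult) measurable
  also have "kernel_norm (\<lambda>\<xi>. ?M (c *\<^sub>R \<xi>)) = kernel_norm ?M"
    by (rule kernel_norm_scale) (use c in measurable)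
  also have "norm (complex_of_real (inverse (c ^ d))) = s powr (- real d / 2)"
  proof -
    have "c ^ d = s powr (real d / 2)"
      unfolding c_def using s by (simp add: powr_half_sqrt[symmetric] powr_powr flip: powr_realpow)
    then show ?thesis using c by (simp add: powr_minus norm_inverse norm_power)
  qed
  finally show ?thesis .
qed

text \<open>The symbol is i \<xi>_k when i = j, and 0 otherwise, minus i \<xi>_i \<xi>_j \<xi>_k /
  |\<xi>|^2. The first part is homogeneous of degree 1. The second is the resolvent at z = 0 applied
  to a cubic symbol, and the integral of (\<sigma> + s)^(-3/2) over s \<ge> 0 equals 2
  \<sigma>^(-1/2); hence the constant \<open>A1 + 2 * A3\<close>.\<close>

lemma kernel_norm_gaussian_leray:
  fixes i j k :: "'n::finite"
  obtains C where "C \<ge> 0" and "\<And>\<sigma>. \<sigma> > 0 \<Longrightarrow>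
    kernel_norm (\<lambda>\<xi>. leray_deriv_symbol i j k \<xi> * of_real (gauss \<sigma> \<xi>)) \<le> ennreal (C * \<sigma> powr (- 1 / 2))"
proof -
  let ?q1 = "\<lambda>\<xi>::real^'n. complex_of_real (\<xi> $ k)"
  let ?q3 = "\<lambda>\<xi>::real^'n. complex_of_real (\<xi> $ i) * (complex_of_real (\<xi> $ j) * complex_of_real (\<xi> $ k))"
  let ?g = "\<lambda>s \<xi>::real^'n. complex_of_real (gauss s \<xi>)"
  define A1 where "A1 = enn2real (kernel_norm (\<lambda>\<xi>::real^'n. ?q1 \<xi> * of_real (exp (- (norm \<xi>)\<^sup>2))))"
  define A3 where "A3 = enn2real (kernel_norm (\<lambda>\<xi>::real^'n. ?q3 \<xi> * of_real (exp (- (norm \<xi>)\<^sup>2))))"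
  have A1: "kernel_norm (\<lambda>\<xi>::real^'n. ?q1 \<xi> * of_real (exp (- (norm \<xi>)\<^sup>2))) = ennreal A1"
    unfolding A1_def using schwartz_kernel_norm_finite[OF schwartz_coord[OF gaussian_schwartz, of k]]
    by (intro ennreal_enn2real[symmetric]) simp
  have A3: "kernel_norm (\<lambda>\<xi>::real^'n. ?q3 \<xi> * of_real (exp (- (norm \<xi>)\<^sup>2))) = ennreal A3"
    unfolding A3_def
    using schwartz_kernel_norm_finite[OF schwartz_coord[OF schwartz_coord[OF schwartz_coord[OF gaussian_schwartz]]], of i j k]
    by (intro ennreal_enn2real[symmetric]) (simp add: mult.assoc)
  have pos: "A1 \<ge> 0" "A3 \<ge> 0" by (auto simp: A1_def A3_def)
  have q1: "kernel_norm (\<lambda>\<xi>. ?q1 \<xi> * ?g s \<xi>) = ennreal (s powr (- 1 / 2) * A1)" if "s > 0" for s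
  proof -
    have "kernel_norm (\<lambda>\<xi>. ?q1 \<xi> * ?g s \<xi>) = ennreal (s powr (- real 1 / 2)) * ennreal A1"
      unfolding A1[symmetric] by (rule kernel_norm_gaussian_homogeneous[OF _ _ that]) auto
    then show ?thesis using pos by (simp add: ennreal_mult)
  qed
  have q3: "kernel_norm (\<lambda>\<xi>. ?q3 \<xi> * ?g s \<xi>) = ennreal (s powr (- 3 / 2) * A3)" if "s > 0" for s
  proof -
    have "kernel_norm (\<lambda>\<xi>. ?q3 \<xi> * ?g s \<xi>) = ennreal (s powr (- real 3 / 2)) * ennreal A3"
      unfolding A3[symmetric]
      by (rule kernel_norm_gaussian_homogeneous[OF _ _ that]) (auto simp: power3_eq_cube mult_ac)
    then show ?thesis using pos by (simp add: ennreal_mult)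
  qed
  have n3: "norm (?q3 \<xi>) \<le> norm \<xi> * (norm \<xi>)\<^sup>2" for \<xi>
    unfolding norm_mult norm_of_real power2_eq_square by (intro mult_mono component_le_norm_cart) auto
  have bd: "kernel_norm (\<lambda>\<xi>. leray_deriv_symbol i j k \<xi> * ?g \<sigma> \<xi>) \<le> ennreal ((A1 + 2 * A3) * \<sigma> powr (- 1 / 2))" if \<sigma>: "\<sigma> > 0" for \<sigma>
  proof -
    have i1: "integrable lborel (\<lambda>\<xi>::real^'n. norm \<xi> * gauss \<sigma> \<xi>)"
      by (rule integrable_dominated[OF gaussian_weight_integrable[OF \<sigma>, of 1]])
         (auto intro!: mult_right_mono)
    have iq1: "integrable lborel (\<lambda>\<xi>. ?q1 \<xi> * ?g \<sigma> \<xi>)"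
      by (rule integrable_dominated[OF i1])
         (auto simp: norm_mult component_le_norm_cart intro!: mult_right_mono)
    have i3': "integrable lborel (\<lambda>\<xi>. norm (?q3 \<xi>) * gauss \<sigma> \<xi> / ((norm \<xi>)\<^sup>2 - Re 0))"
    proof (rule integrable_dominated[OF i1])
      show "AE \<xi> in lborel. norm (norm (?q3 \<xi>) * gauss \<sigma> \<xi> / ((norm \<xi>)\<^sup>2 - Re 0)) \<le> norm (norm \<xi> * gauss \<sigma> \<xi>)"
      proof (rule AE_I2)
        fix \<xi> :: "real^'n"
        have "norm (?q3 \<xi>) / (norm \<xi>)\<^sup>2 \<le> norm \<xi>"
          using n3[of \<xi>] by (cases "\<xi> = 0") (simp_all add: field_simps)
        then have "norm (?q3 \<xi>) / (norm \<xi>)\<^sup>2 * gauss \<sigma> \<xi> \<le> norm \<xi> * gauss \<sigma> \<xi>"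
          by (intro mult_right_mono) auto
        then show "norm (norm (?q3 \<xi>) * gauss \<sigma> \<xi> / ((norm \<xi>)\<^sup>2 - Re 0)) \<le> norm (norm \<xi> * gauss \<sigma> \<xi>)"
          by (simp add: abs_mult)
      qed
    qed measurable
    let ?r3 = "\<lambda>\<xi>. ?q3 \<xi> * ?g \<sigma> \<xi> / (of_real ((norm \<xi>)\<^sup>2) - 0)"
    have ir3: "integrable lborel ?r3"
      by (rule integrable_dominated[OF i3']) (auto simp: norm_mult norm_divide norm_power)
    have "kernel_norm ?r3 \<le> (\<integral>\<^sup>+s. ennreal (exp (s * Re 0)) * kernel_norm (\<lambda>\<xi>. ?q3 \<xi> * ?g (\<sigma> + s) \<xi>) * indicator {0..} s \<partial>lborel)"
      by (rule kernel_norm_resolvent_le[OF _ _ _ i3']) auto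
    also have "\<dots> = (\<integral>\<^sup>+s. ennreal A3 * (ennreal ((\<sigma> + s) powr (- 3 / 2)) * indicator {0..} s) \<partial>lborel)"
    proof (rule nn_integral_cong)
      fix s :: real
      show "ennreal (exp (s * Re 0)) * kernel_norm (\<lambda>\<xi>. ?q3 \<xi> * ?g (\<sigma> + s) \<xi>) * indicator {0..} s
          = ennreal A3 * (ennreal ((\<sigma> + s) powr (- 3 / 2)) * indicator {0..} s)"
      proof (cases "s \<ge> 0")
        case True
        then have p: "\<sigma> + s > 0" using \<sigma> by simp
        show ?thesis unfolding q3[OF p] using True pos by (simp add: ennreal_mult mult.commute)
      qed simp
    qed
    also have "\<dots> = ennreal A3 * ennreal (0 - (- 2 * (\<sigma> + 0) powr (- 1 / 2)))"
    proof (subst nn_integral_cmult)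
      show "ennreal A3 * (\<integral>\<^sup>+s. ennreal ((\<sigma> + s) powr (- 3 / 2)) * indicator {0..} s \<partial>lborel) = ennreal A3 * ennreal (0 - (- 2 * (\<sigma> + 0) powr (- 1 / 2)))"
      proof (subst nn_integral_FTC_atLeast[where F = "\<lambda>s. - 2 * (\<sigma> + s) powr (- 1 / 2)" and T = 0])
        show "((\<lambda>s. - 2 * (\<sigma> + s) powr (- 1 / 2)) \<longlongrightarrow> 0) at_top"
          using \<sigma> by real_asymp
      qed (use \<sigma> in \<open>auto intro!: derivative_eq_intros\<close>)
    qed measurable
    also have "\<dots> = ennreal (2 * A3 * \<sigma> powr (- 1 / 2))"
      using pos by (simp add: mult_ac flip: ennreal_mult)
    finally have r3: "kernel_norm ?r3 \<le> ennreal (2 * A3 * \<sigma> powr (- 1 / 2))" .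
    define \<delta> :: complex where "\<delta> = (if i = j then \<i> else 0)"
    have eq: "leray_deriv_symbol i j k \<xi> * ?g \<sigma> \<xi> = \<delta> * (?q1 \<xi> * ?g \<sigma> \<xi>) + (- \<i>) * ?r3 \<xi>" for \<xi>
      by (simp add: leray_deriv_symbol_def leray_symbol_def \<delta>_def algebra_simps)
    have "kernel_norm (\<lambda>\<xi>. leray_deriv_symbol i j k \<xi> * ?g \<sigma> \<xi>)
       \<le> kernel_norm (\<lambda>\<xi>. \<delta> * (?q1 \<xi> * ?g \<sigma> \<xi>)) + kernel_norm (\<lambda>\<xi>. (- \<i>) * ?r3 \<xi>)"
      unfolding eq by (intro kernel_norm_add integrable_mult_right iq1 ir3)
    also have "kernel_norm (\<lambda>\<xi>. \<delta> * (?q1 \<xi> * ?g \<sigma> \<xi>)) = ennreal (norm \<delta>) * kernel_norm (\<lambda>\<xi>. ?q1 \<xi> * ?g \<sigma> \<xi>)"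
      by (rule kernel_norm_cmult) measurable
    also have "kernel_norm (\<lambda>\<xi>. (- \<i>) * ?r3 \<xi>) = ennreal (norm (- \<i>)) * kernel_norm ?r3"
      by (rule kernel_norm_cmult) measurable
    also have "ennreal (norm \<delta>) * kernel_norm (\<lambda>\<xi>. ?q1 \<xi> * ?g \<sigma> \<xi>) \<le> 1 * ennreal (\<sigma> powr (- 1 / 2) * A1)"
      unfolding q1[OF \<sigma>] by (intro mult_right_mono) (auto simp: \<delta>_def)
    also have "ennreal (norm (- \<i>)) * kernel_norm ?r3 \<le> 1 * ennreal (2 * A3 * \<sigma> powr (- 1 / 2))"
      by (intro mult_mono r3) auto
    also have "1 * ennreal (\<sigma> powr (- 1 / 2) * A1) + 1 * ennreal (2 * A3 * \<sigma> powr (- 1 / 2)) = ennreal ((A1 + 2 * A3) * \<sigma> powr (- 1 / 2))"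
      using pos by (simp add: algebra_simps flip: ennreal_plus)
    finally show ?thesis by (simp add: add_mono)
  qed
  show thesis
    by (rule that[of "A1 + 2 * A3"]) (use pos bd in auto)
qed

text \<open>The Gamma integral at 1/2 after the substitution of \<kappa> s for s; thus
  \<open>K\<close> is Gamma(1/2).\<close>

lemma nn_integral_exp_powr_half:
  obtains K where "K \<ge> 0" and "\<And>\<kappa>. \<kappa> > 0 \<Longrightarrow>
    (\<integral>\<^sup>+s. ennreal (exp (- (\<kappa> * s)) * s powr (- 1 / 2)) * indicator {0..} s \<partial>lborel) = ennreal (K * \<kappa> powr (- 1 / 2))"
proof -
  have "((\<lambda>t::real. t powr (1 / 2 - 1) / exp t) has_integral Gamma (1 / 2)) {0..}"
    by (rule Gamma_integral_real) simp
  from nn_integral_has_integral_lebesgue[OF _ this]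
  have "(\<integral>\<^sup>+t. ennreal (indicator {0..} t * (t powr (1 / 2 - 1) / exp t)) \<partial>lborel) = ennreal (Gamma (1 / 2))"
    by simp
  moreover have "(\<integral>\<^sup>+t. ennreal (indicator {0..} t * (t powr (1 / 2 - 1) / exp t)) \<partial>lborel)
     = (\<integral>\<^sup>+s. ennreal (exp (- s) * s powr (- 1 / 2)) * indicator {0..} s \<partial>lborel)"
  proof (rule nn_integral_cong)
    fix t :: real
    have "t powr (1 / 2 - 1) / exp t = exp (- t) * t powr (- 1 / 2)"
      by (simp add: exp_minus field_simps)
    then show "ennreal (indicator {0..} t * (t powr (1 / 2 - 1) / exp t)) = ennreal (exp (- t) * t powr (- 1 / 2)) * indicator {0..} t"
      by (simp split: split_indicator)
  qed
  ultimately have G: "(\<integral>\<^sup>+s. ennreal (exp (- s) * s powr (- 1 / 2)) * indicator {0..} s \<partial>lborel) = ennreal (Gamma (1 / 2))"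
    by simp
  have Gpos: "Gamma (1 / 2 :: real) \<ge> 0" by (simp add: Gamma_real_nonneg)
  have "(\<integral>\<^sup>+s. ennreal (exp (- (\<kappa> * s)) * s powr (- 1 / 2)) * indicator {0..} s \<partial>lborel) = ennreal (Gamma (1 / 2) * \<kappa> powr (- 1 / 2))"
    if \<kappa>: "\<kappa> > 0" for \<kappa> :: real
  proof -
    have "ennreal (Gamma (1 / 2)) = ennreal \<bar>\<kappa>\<bar> * (\<integral>\<^sup>+s. ennreal (exp (- (0 + \<kappa> * s)) * (0 + \<kappa> * s) powr (- 1 / 2)) * indicator {0..} (0 + \<kappa> * s) \<partial>lborel)"
      unfolding G[symmetric] by (rule nn_integral_real_affine) (use \<kappa> in auto)
    also have "(\<integral>\<^sup>+s. ennreal (exp (- (0 + \<kappa> * s)) * (0 + \<kappa> * s) powr (- 1 / 2)) * indicator {0..} (0 + \<kappa> * s) \<partial>lborel)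
       = (\<integral>\<^sup>+s. ennreal (\<kappa> powr (- 1 / 2)) * (ennreal (exp (- (\<kappa> * s)) * s powr (- 1 / 2)) * indicator {0..} s) \<partial>lborel)"
      using \<kappa> by (intro nn_integral_cong)
        (auto simp: indicator_def zero_le_mult_iff powr_mult mult_ac simp flip: ennreal_mult)
    also have "\<dots> = ennreal (\<kappa> powr (- 1 / 2)) * (\<integral>\<^sup>+s. ennreal (exp (- (\<kappa> * s)) * s powr (- 1 / 2)) * indicator {0..} s \<partial>lborel)"
      by (rule nn_integral_cmult) measurable
    finally have "ennreal (Gamma (1 / 2)) = ennreal (\<bar>\<kappa>\<bar> * \<kappa> powr (- 1 / 2)) * (\<integral>\<^sup>+s. ennreal (exp (- (\<kappa> * s)) * s powr (- 1 / 2)) * indicator {0..} s \<partial>lborel)"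
      using \<kappa> by (simp add: ennreal_mult mult.assoc)
    also have "\<bar>\<kappa>\<bar> * \<kappa> powr (- 1 / 2) = \<kappa> powr (1 / 2)"
      using \<kappa> powr_add[of \<kappa> 1 "- 1 / 2"] by simp
    finally have "ennreal (\<kappa> powr (- 1 / 2)) * ennreal (Gamma (1 / 2)) = ennreal (\<kappa> powr (- 1 / 2) * \<kappa> powr (1 / 2)) * (\<integral>\<^sup>+s. ennreal (exp (- (\<kappa> * s)) * s powr (- 1 / 2)) * indicator {0..} s \<partial>lborel)"
      by (simp add: ennreal_mult mult.assoc)
    also have "\<kappa> powr (- 1 / 2) * \<kappa> powr (1 / 2) = 1"
      using \<kappa> by (simp flip: powr_add)
    finally show ?thesis using Gpos by (simp add: mult.commute flip: ennreal_mult)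
  qed
  then show thesis using Gpos that by blast
qed

text \<open>The estimate (\<epsilon> + s)^(-1/2) \<le> s^(-1/2) discards the damping, so the
  constant is uniform in \<epsilon>. What is left is the integral of exp (s Re z) s^(-1/2), which
  converges because Re z < 0.\<close>

lemma kernel_norm_leray_resolvent:
  fixes i j k :: "'n::finite"
  obtains C where "C \<ge> 0" and "\<And>\<epsilon> z. \<epsilon> > 0 \<Longrightarrow> Re z < 0 \<Longrightarrow>
    kernel_norm (\<lambda>\<xi>. leray_deriv_symbol i j k \<xi> * of_real (gauss \<epsilon> \<xi>) / (of_real ((norm \<xi>)\<^sup>2) - z))
      \<le> ennreal (C * (- Re z) powr (- 1 / 2))"
proof -
  let ?l = "leray_deriv_symbol i j k"
  obtain C where C: "C \<ge> 0" "\<And>\<sigma>. \<sigma> > 0 \<Longrightarrow>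
    kernel_norm (\<lambda>\<xi>. ?l \<xi> * of_real (gauss \<sigma> \<xi>)) \<le> ennreal (C * \<sigma> powr (- 1 / 2))"
    by (rule kernel_norm_gaussian_leray[of i j k]) (rule that)
  obtain K where K: "K \<ge> 0" "\<And>\<kappa>. \<kappa> > 0 \<Longrightarrow>
    (\<integral>\<^sup>+s. ennreal (exp (- (\<kappa> * s)) * s powr (- 1 / 2)) * indicator {0..} s \<partial>lborel) = ennreal (K * \<kappa> powr (- 1 / 2))"
    by (rule nn_integral_exp_powr_half) (rule that)
  have bd: "kernel_norm (\<lambda>\<xi>. ?l \<xi> * of_real (gauss \<epsilon> \<xi>) / (of_real ((norm \<xi>)\<^sup>2) - z))
      \<le> ennreal ((C * K) * (- Re z) powr (- 1 / 2))" if \<epsilon>: "\<epsilon> > 0" and z: "Re z < 0" for \<epsilon> z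
  proof -
    let ?w = "\<lambda>\<xi>::real^'n. 2 / (- Re z) * ((1 + norm \<xi>) ^ 1 * gauss \<epsilon> \<xi>)"
    let ?v = "\<lambda>\<xi>. norm (?l \<xi>) * gauss \<epsilon> \<xi> / ((norm \<xi>)\<^sup>2 - Re z)"
    have "integrable lborel (\<lambda>\<xi>. ?v \<xi>)"
    proof (rule integrable_dominated)
      show "integrable lborel (\<lambda>\<xi>::real^'n. ?w \<xi>)"
        by (intro integrable_mult_right gaussian_weight_integrable \<epsilon>)
      show "AE \<xi> in lborel. norm (?v \<xi>)
          \<le> norm (?w \<xi>)"
      proof (rule AE_I2)
        fix \<xi> :: "real^'n"
        have p: "(norm \<xi>)\<^sup>2 - Re z > 0" using z by (simp add: add_nonneg_pos diff_conv_add_uminus del: add_uminus_conv_diff)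
        have "norm (?l \<xi>) / ((norm \<xi>)\<^sup>2 - Re z) \<le> (2 * (1 + norm \<xi>)) / (- Re z)"
          using norm_leray_deriv_symbol_le[of i j k \<xi>] z by (intro frac_le) auto
        then have "norm (?l \<xi>) / ((norm \<xi>)\<^sup>2 - Re z) * gauss \<epsilon> \<xi> \<le> (2 * (1 + norm \<xi>)) / (- Re z) * gauss \<epsilon> \<xi>"
          by (intro mult_right_mono) auto
        also have "\<dots> = ?w \<xi>"
          by (simp only: power_one_right times_divide_eq_left times_divide_eq_right mult.assoc)
        also have "\<dots> \<le> norm (?w \<xi>)"
          by (simp only: real_norm_def abs_ge_self)
        finally show "norm (?v \<xi>)
          \<le> norm (?w \<xi>)"
          using p by (simp add: abs_mult)
      qed
    qed measurable
    then have "kernel_norm (\<lambda>\<xi>. ?l \<xi> * of_real (gauss \<epsilon> \<xi>) / (of_real ((norm \<xi>)\<^sup>2) - z))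
      \<le> (\<integral>\<^sup>+s. ennreal (exp (s * Re z)) * kernel_norm (\<lambda>\<xi>. ?l \<xi> * of_real (gauss (\<epsilon> + s) \<xi>)) * indicator {0..} s \<partial>lborel)"
      using z by (intro kernel_norm_resolvent_le) auto
    also have "\<dots> \<le> (\<integral>\<^sup>+s. ennreal C * (ennreal (exp (- ((- Re z) * s)) * s powr (- 1 / 2)) * indicator {0..} s) \<partial>lborel)"
    \<comment> \<open>\<open>0 powr (- 1 / 2)\<close> is 0, so the estimate can fail at s = 0; this
      single point is discarded as a null set.\<close>
    proof (rule nn_integral_mono_AE, use AE_lborel_singleton[of "0::real"] in eventually_elim)
      fix s :: real assume s0: "s \<noteq> 0"
      show "ennreal (exp (s * Re z)) * kernel_norm (\<lambda>\<xi>. ?l \<xi> * of_real (gauss (\<epsilon> + s) \<xi>)) * indicator {0..} s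
         \<le> ennreal C * (ennreal (exp (- ((- Re z) * s)) * s powr (- 1 / 2)) * indicator {0..} s)"
      proof (cases "s > 0")
        case True
        have "kernel_norm (\<lambda>\<xi>. ?l \<xi> * of_real (gauss (\<epsilon> + s) \<xi>)) \<le> ennreal (C * (\<epsilon> + s) powr (- 1 / 2))"
          using C(2)[of "\<epsilon> + s"] True \<epsilon> by simp
        also have "\<dots> \<le> ennreal (C * s powr (- 1 / 2))"
          using True \<epsilon> C(1) by (intro ennreal_leI mult_left_mono powr_mono2') auto
        finally have "ennreal (exp (s * Re z)) * kernel_norm (\<lambda>\<xi>. ?l \<xi> * of_real (gauss (\<epsilon> + s) \<xi>))
            \<le> ennreal (exp (s * Re z)) * ennreal (C * s powr (- 1 / 2))"
          by (intro mult_left_mono) auto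
        also have "\<dots> = ennreal C * ennreal (exp (- ((- Re z) * s)) * s powr (- 1 / 2))"
          using C(1) by (simp add: mult_ac flip: ennreal_mult)
        finally show ?thesis using True by simp
      qed (use s0 in \<open>auto simp: indicator_def\<close>)
    qed
    also have "\<dots> = ennreal C * ennreal (K * (- Re z) powr (- 1 / 2))"
      using z by (subst nn_integral_cmult) (auto simp: K(2)[of "- Re z", simplified])
    also have "\<dots> = ennreal ((C * K) * (- Re z) powr (- 1 / 2))"
      using C K by (simp add: mult_ac flip: ennreal_mult)
    finally show ?thesis .
  qed
  show thesis
    by (rule that[of "C * K"]) (use C(1) K(1) bd in auto)
qed

section \<open>Superposition along the contour and the L1 bound of the kernel\<close>

lemma integrable_lborel_product:
  fixes f :: "real \<Rightarrow> real" and g :: "'b::euclidean_space \<Rightarrow> real"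
  assumes f: "integrable lborel f" and g: "integrable lborel g"
  shows "integrable (lborel \<Otimes>\<^sub>M lborel) (\<lambda>(x, y). f x * g y)"
proof -
  have [measurable]: "f \<in> borel_measurable borel" "g \<in> borel_measurable borel"
    using f g by auto
  show ?thesis
  proof (rule integrableI_bounded)
    have "(\<integral>\<^sup>+z. ennreal (norm (case z of (x, y) \<Rightarrow> f x * g y)) \<partial>(lborel \<Otimes>\<^sub>M lborel))
       = (\<integral>\<^sup>+x. \<integral>\<^sup>+y. ennreal (norm (f x)) * ennreal (norm (g y)) \<partial>lborel \<partial>lborel)"
      by (subst lborel.nn_integral_fst[symmetric]) (auto simp: abs_mult ennreal_mult)
    also have "\<dots> = (\<integral>\<^sup>+x. ennreal (norm (f x)) \<partial>lborel) * (\<integral>\<^sup>+y. ennreal (norm (g y)) \<partial>lborel)"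
      by (simp add: nn_integral_cmult nn_integral_multc)
    also have "\<dots> < \<infinity>"
      using f g by (auto simp: integrable_iff_bounded ennreal_mult_less_top)
    finally show "(\<integral>\<^sup>+z. ennreal (norm (case z of (x, y) \<Rightarrow> f x * g y)) \<partial>(lborel \<Otimes>\<^sub>M lborel)) < \<infinity>" .
  qed measurable
qed

text \<open>On the line Re z = -\<kappa> exp x with \<kappa> = |cos \<theta>|. The resolvent bound
  (\<kappa> exp x)^(-1/2) halves the exponent of the Jacobian, leaving the integrable
  \<open>hankel_bound\<close> and no dependence on \<epsilon>. Joint integrability needs the
  pointwise bound of the quotient instead, whose singularity 1/|\<xi>| is cancelled by the
  symbol.\<close>

lemma kernel_norm_hankel_line:
  fixes i j k :: "'n::finite"
  assumes \<alpha>: "1 / 2 \<le> \<alpha>" and \<theta>: "0 < \<theta>" "\<alpha> * \<theta> < pi / 2" "cos \<theta> < 0" and s: "\<bar>s\<bar> = \<theta>"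
  defines "h \<equiv> \<lambda>\<epsilon> x \<xi>. hankel_quotient \<alpha> (Complex x s) ((norm \<xi>)\<^sup>2)
      * (leray_deriv_symbol i j k \<xi> * of_real (gauss \<epsilon> \<xi>))"
  obtains B where "B \<ge> 0"
    and "\<And>\<epsilon>. \<epsilon> > 0 \<Longrightarrow> integrable (lborel \<Otimes>\<^sub>M lborel) (case_prod (h \<epsilon>))"
    and "\<And>\<epsilon>. \<epsilon> > 0 \<Longrightarrow> kernel_norm (\<lambda>\<xi>. LINT x|lborel. h \<epsilon> x \<xi>) \<le> ennreal B"
proof -
  define c where "c = cos (\<alpha> * \<theta>)"
  have \<alpha>0: "\<alpha> > 0" using \<alpha> by simp
  have c: "c > 0" unfolding c_def using \<alpha>0 \<theta> by (intro cos_gt_zero_pi) (auto intro: order_less_le_trans[of _ 0])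
  have \<alpha>\<theta>: "\<alpha> * \<theta> \<le> pi" using \<theta>(2) pi_gt_zero by linarith
  define \<kappa> where "\<kappa> = \<bar>cos \<theta>\<bar>"
  have \<kappa>: "\<kappa> > 0" using \<theta> by (simp add: \<kappa>_def)
  have coss: "cos s = cos \<theta>" using s by (metis cos_abs_real)
  obtain C where C: "C \<ge> 0" "\<And>\<epsilon> z. \<epsilon> > 0 \<Longrightarrow> Re z < 0 \<Longrightarrow>
    kernel_norm (\<lambda>\<xi>. leray_deriv_symbol i j k \<xi> * of_real (gauss \<epsilon> \<xi>) / (of_real ((norm \<xi>)\<^sup>2) - z))
      \<le> ennreal (C * (- Re z) powr (- 1 / 2))"
    by (rule kernel_norm_leray_resolvent[of i j k]) (rule that)
  have hb: "integrable lborel (hankel_bound \<alpha> c)" by (rule hankel_bound_integrable[OF c \<alpha>])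
  have hb0: "hankel_bound \<alpha> c x \<ge> 0" for x by (simp add: hankel_bound_def)
  define B where "B = C * \<kappa> powr (- 1 / 2) * (LINT x|lborel. hankel_bound \<alpha> c x)"
  have B0: "B \<ge> 0" unfolding B_def using C hb0 by (intro mult_nonneg_nonneg integral_nonneg_AE) auto
  note [measurable] = borel_measurable_hankel[of \<alpha> s] borel_measurable_exp_Complex[of s]
  have meas: "case_prod (h \<epsilon>) \<in> borel_measurable (lborel \<Otimes>\<^sub>M lborel)" for \<epsilon>
    unfolding h_def by measurable
  have int: "integrable (lborel \<Otimes>\<^sub>M lborel) (case_prod (h \<epsilon>))" if \<epsilon>: "\<epsilon> > 0" for \<epsilon>
  proof (rule integrable_dominated[OF _ meas])
    \<comment> \<open>The 2 comes from the symbol bound 2|\<xi>|; the zeroth power only gives the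
      Gaussian the shape of \<open>gaussian_weight_integrable\<close>.\<close>
    show "integrable (lborel \<Otimes>\<^sub>M lborel) (\<lambda>(x, \<xi>::real^'n). (hankel_bound \<alpha> c x / sqrt \<kappa>) * (2 * ((1 + norm \<xi>) ^ 0 * gauss \<epsilon> \<xi>)))"
      by (intro integrable_lborel_product integrable_divide hb integrable_mult_right gaussian_weight_integrable \<epsilon>)
    have "norm (h \<epsilon> x \<xi>) \<le> (hankel_bound \<alpha> c x / sqrt \<kappa>) * (2 * ((1 + norm \<xi>) ^ 0 * gauss \<epsilon> \<xi>))" for x and \<xi> :: "real^'n"
    proof (cases "\<xi> = 0")
      case True
      then show ?thesis using hb0[of x] \<kappa> by (simp add: h_def)
    next
      case False
      have "norm (hankel_quotient \<alpha> (Complex x s) ((norm \<xi>)\<^sup>2)) \<le> hankel_bound \<alpha> (cos (\<alpha> * \<theta>)) (Re (Complex x s)) / sqrt ((norm \<xi>)\<^sup>2 * \<bar>cos \<theta>\<bar>)"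
        using False s \<theta> by (intro norm_hankel_quotient_le \<alpha>0 \<alpha>\<theta>) auto
      also have "\<dots> = hankel_bound \<alpha> c x / (norm \<xi> * sqrt \<kappa>)"
        by (simp add: c_def \<kappa>_def real_sqrt_mult)
      finally have 1: "norm (hankel_quotient \<alpha> (Complex x s) ((norm \<xi>)\<^sup>2)) \<le> hankel_bound \<alpha> c x / (norm \<xi> * sqrt \<kappa>)" .
      have "norm (h \<epsilon> x \<xi>) = norm (hankel_quotient \<alpha> (Complex x s) ((norm \<xi>)\<^sup>2)) * (norm (leray_deriv_symbol i j k \<xi>) * gauss \<epsilon> \<xi>)"
        by (simp only: h_def norm_mult norm_of_real abs_exp_cancel)
      also have "\<dots> \<le> hankel_bound \<alpha> c x / (norm \<xi> * sqrt \<kappa>) * ((2 * norm \<xi>) * gauss \<epsilon> \<xi>)"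
        using hb0[of x] \<kappa> by (intro mult_mono 1 norm_leray_deriv_symbol_le) auto
      also have "\<dots> = (hankel_bound \<alpha> c x / sqrt \<kappa>) * (2 * ((1 + norm \<xi>) ^ 0 * gauss \<epsilon> \<xi>))"
        using False by (simp add: field_simps)
      finally show ?thesis .
    qed
    then show "AE z in lborel \<Otimes>\<^sub>M lborel. norm (case_prod (h \<epsilon>) z) \<le> norm (case z of (x, \<xi>) \<Rightarrow> (hankel_bound \<alpha> c x / sqrt \<kappa>) * (2 * ((1 + norm \<xi>) ^ 0 * gauss \<epsilon> \<xi>)))"
      by (intro AE_I2) (auto intro: order_trans[OF _ abs_ge_self])
  qed
  have bd: "kernel_norm (\<lambda>\<xi>. LINT x|lborel. h \<epsilon> x \<xi>) \<le> ennreal B" if \<epsilon>: "\<epsilon> > 0" for \<epsilon>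
  proof -
    have "kernel_norm (\<lambda>\<xi>. LINT x|lborel. h \<epsilon> x \<xi>) \<le> (\<integral>\<^sup>+x. kernel_norm (h \<epsilon> x) \<partial>lborel)"
      by (rule kernel_norm_integral_le[OF sigma_finite_lborel int[OF \<epsilon>]])
    also have "\<dots> \<le> (\<integral>\<^sup>+x. ennreal (C * \<kappa> powr (- 1 / 2)) * ennreal (hankel_bound \<alpha> c x) \<partial>lborel)"
    proof (rule nn_integral_mono)
      fix x :: real
      let ?w = "Complex x s"
      let ?r = "\<lambda>\<xi>. leray_deriv_symbol i j k \<xi> * of_real (gauss \<epsilon> \<xi>) / (of_real ((norm \<xi>)\<^sup>2) - exp ?w)"
      have Re: "Re (exp ?w) = - (\<kappa> * exp x)"
        using \<theta> by (simp add: Re_exp coss \<kappa>_def)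
      \<comment> \<open>The contour integrand has z - r in the denominator, the resolvent r - z; the
        sign is given to \<open>hankel\<close>.\<close>
      have "h \<epsilon> x = (\<lambda>\<xi>. (- hankel \<alpha> ?w) * ?r \<xi>)"
      proof
        fix \<xi> :: "real^'n"
        have "h \<epsilon> x \<xi> = hankel \<alpha> ?w * (leray_deriv_symbol i j k \<xi> * of_real (gauss \<epsilon> \<xi>)) / (- (of_real ((norm \<xi>)\<^sup>2) - exp ?w))"
          unfolding h_def by (simp only: minus_diff_eq times_divide_eq_left)
        also have "\<dots> = (- hankel \<alpha> ?w) * ?r \<xi>"
          by (simp only: divide_minus_right mult_minus_left times_divide_eq_right minus_divide_left)
        finally show "h \<epsilon> x \<xi> = (- hankel \<alpha> ?w) * ?r \<xi>" .
      qed
      then have "kernel_norm (h \<epsilon> x) = ennreal (norm (- hankel \<alpha> ?w)) * kernel_norm ?r"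
        by (simp only:) (rule kernel_norm_cmult, measurable)
      also have "\<dots> \<le> ennreal (exp (- c * exp (\<alpha> * x)) * exp x) * ennreal (C * (\<kappa> * exp x) powr (- 1 / 2))"
      proof (rule mult_mono)
        show "ennreal (norm (- hankel \<alpha> ?w)) \<le> ennreal (exp (- c * exp (\<alpha> * x)) * exp x)"
          using norm_hankel_le[of \<alpha> ?w \<theta>] \<alpha>0 \<alpha>\<theta> s by (intro ennreal_leI) (simp add: c_def)
        show "kernel_norm ?r \<le> ennreal (C * (\<kappa> * exp x) powr (- 1 / 2))"
          using C(2)[OF \<epsilon>, of "exp ?w"] \<kappa> unfolding Re by simp
      qed auto
      also have "\<dots> = ennreal ((exp (- c * exp (\<alpha> * x)) * exp x) * (C * (\<kappa> * exp x) powr (- 1 / 2)))"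
        using C(1) by (simp flip: ennreal_mult)
      also have "(exp (- c * exp (\<alpha> * x)) * exp x) * (C * (\<kappa> * exp x) powr (- 1 / 2)) = (C * \<kappa> powr (- 1 / 2)) * hankel_bound \<alpha> c x"
      proof -
        have p1: "(\<kappa> * exp x) powr (- 1 / 2) = \<kappa> powr (- 1 / 2) * exp (- x / 2)"
          using \<kappa> by (simp add: powr_mult exp_powr_real)
        have p2: "exp (x / 2) = exp x * exp (- x / 2)" by (simp flip: exp_add)
        show ?thesis unfolding hankel_bound_def p1 p2 by (simp only: mult_ac)
      qed
      finally show "kernel_norm (h \<epsilon> x) \<le> ennreal (C * \<kappa> powr (- 1 / 2)) * ennreal (hankel_bound \<alpha> c x)"
        using C(1) hb0[of x] by (simp add: ennreal_mult)
    qed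
    also have "\<dots> = ennreal (C * \<kappa> powr (- 1 / 2)) * (\<integral>\<^sup>+x. ennreal (hankel_bound \<alpha> c x) \<partial>lborel)"
      by (rule nn_integral_cmult) (use hb in auto)
    also have "(\<integral>\<^sup>+x. ennreal (hankel_bound \<alpha> c x) \<partial>lborel) = ennreal (LINT x|lborel. hankel_bound \<alpha> c x)"
      by (rule nn_integral_eq_integral[OF hb]) (use hb0 in auto)
    also have "ennreal (C * \<kappa> powr (- 1 / 2)) * \<dots> = ennreal B"
      unfolding B_def using C(1) hb0 by (intro ennreal_mult[symmetric] integral_nonneg_AE) auto
    finally show ?thesis .
  qed
  show thesis
    by (rule that[OF B0 int bd])
qed

text \<open>Here the exponential rate does not grow with \<open>N\<close>; the factor N^N pays for
  that. A fixed rate is required because at \<alpha> = 1/2 the semigroup symbol decays only like exp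
  (-|\<xi>|).\<close>

lemma one_plus_power_le_exp':
  fixes r :: real
  assumes "r \<ge> 0" "N > 0"
  shows "(1 + r) ^ N \<le> real N ^ N * exp (1 + r)"
proof -
  have "((1 + r) / real N) ^ N \<le> (1 + (1 + r) / real N) ^ N"
    using assms by (intro power_mono) auto
  also have "\<dots> \<le> exp (1 + r)"
    using assms by (intro exp_ge_one_plus_x_over_n_power_n) auto
  finally show ?thesis using assms by (simp add: power_divide pos_divide_le_eq mult.commute)
qed

lemma leray_full_symbol_integrable:
  assumes "1 / 2 \<le> \<alpha>"
  shows "integrable lborel (\<lambda>\<xi>::real^'n::finite. leray_deriv_symbol i j k \<xi> * of_real (exp (- (norm \<xi> powr (2 * \<alpha>)))))"
proof (rule integrable_rapid_decay)
  let ?N = "2 * CARD('n) + 1"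
  fix \<xi> :: "real^'n"
  define r where "r = norm \<xi>"
  have r: "r \<ge> 0" by (simp add: r_def)
  have "r - 1 \<le> r powr (2 * \<alpha>)"
  proof (cases "r \<ge> 1")
    case True
    then have "r powr 1 \<le> r powr (2 * \<alpha>)" using assms by (intro powr_mono) auto
    then show ?thesis using True by simp
  qed (simp add: order_trans[of _ 0])
  then have e: "exp (- (r powr (2 * \<alpha>))) \<le> exp (1 - r)" by simp
  have pow: "(1 + r) ^ ?N \<le> real ?N ^ ?N * exp (1 + r)"
    by (rule one_plus_power_le_exp') (use r in auto)
  have "(1 + norm \<xi>) ^ (2 * CARD('n)) * norm (leray_deriv_symbol i j k \<xi> * of_real (exp (- (norm \<xi> powr (2 * \<alpha>)))))
      \<le> (1 + r) ^ (2 * CARD('n)) * ((2 * (1 + r)) * exp (1 - r))"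
    unfolding norm_mult r_def[symmetric] using norm_leray_deriv_symbol_le[of i j k \<xi>] e r
    by (intro mult_left_mono mult_mono) (auto simp: r_def)
  also have "\<dots> = 2 * ((1 + r) ^ ?N * exp (1 - r))"
    by simp
  also have "\<dots> \<le> 2 * ((real ?N ^ ?N * exp (1 + r)) * exp (1 - r))"
    by (intro mult_left_mono mult_right_mono pow) auto
  also have "\<dots> = 2 * real ?N ^ ?N * exp 2"
    by (simp add: mult.assoc flip: exp_add)
  finally show "(1 + norm \<xi>) ^ (2 * CARD('n)) * norm (leray_deriv_symbol i j k \<xi> * of_real (exp (- (norm \<xi> powr (2 * \<alpha>)))))
      \<le> 2 * real ?N ^ ?N * exp 2" .
qed measurable

text \<open>The contour formula at r = |\<xi>|^2 writes the damped symbol as a difference of two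
  line integrals of resolvent symbols, each of which has a kernel bound independent of the
  damping.\<close>

lemma kernel_norm_leray_unit_time:
  fixes i j k :: "'n::finite"
  assumes \<alpha>: "1 / 2 \<le> \<alpha>" "\<alpha> < 1"
  shows "kernel_norm (\<lambda>\<xi>. leray_deriv_symbol i j k \<xi> * of_real (exp (- (norm \<xi> powr (2 * \<alpha>))))) < \<infinity>"
proof -
  \<comment> \<open>The midpoint of pi/2 and pi/(2\<alpha>), an interval that is nonempty because
    \<alpha> < 1; from \<alpha> \<ge> 1/2 follows \<theta> < pi.\<close>
  define \<theta> where "\<theta> = (pi / 2 + pi / (2 * \<alpha>)) / 2"
  have \<theta>: "pi / 2 < \<theta>" "\<theta> < pi" "\<alpha> * \<theta> < pi / 2"
    unfolding \<theta>_def using \<alpha> pi_gt_zero by (auto simp: field_simps) 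
  have \<theta>0: "0 < \<theta>" using \<theta>(1) pi_gt_zero by linarith
  have cos\<theta>: "cos \<theta> < 0"
    using cos_monotone_0_pi[of "pi / 2" \<theta>] \<theta> by simp
  let ?l = "leray_deriv_symbol i j k"
  let ?m = "\<lambda>\<xi>. ?l \<xi> * of_real (exp (- (norm \<xi> powr (2 * \<alpha>))))"
  define h where "h s \<epsilon> x \<xi> = hankel_quotient \<alpha> (Complex x s) ((norm \<xi>)\<^sup>2)
      * (?l \<xi> * of_real (gauss \<epsilon> \<xi>))" for s \<epsilon> x and \<xi> :: "real^'n"
  obtain B1 where B1: "B1 \<ge> 0" "\<And>\<epsilon>. \<epsilon> > 0 \<Longrightarrow> integrable (lborel \<Otimes>\<^sub>M lborel) (case_prod (h (- \<theta>) \<epsilon>))"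
     "\<And>\<epsilon>. \<epsilon> > 0 \<Longrightarrow> kernel_norm (\<lambda>\<xi>. LINT x|lborel. h (- \<theta>) \<epsilon> x \<xi>) \<le> ennreal B1"
    unfolding h_def by (rule kernel_norm_hankel_line[of \<alpha> \<theta> "- \<theta>" i j k]) (use \<alpha> \<theta>0 \<theta> cos\<theta> in auto)
  obtain B2 where B2: "B2 \<ge> 0" "\<And>\<epsilon>. \<epsilon> > 0 \<Longrightarrow> integrable (lborel \<Otimes>\<^sub>M lborel) (case_prod (h \<theta> \<epsilon>))"
     "\<And>\<epsilon>. \<epsilon> > 0 \<Longrightarrow> kernel_norm (\<lambda>\<xi>. LINT x|lborel. h \<theta> \<epsilon> x \<xi>) \<le> ennreal B2"
    unfolding h_def by (rule kernel_norm_hankel_line[of \<alpha> \<theta> \<theta> i j k]) (use \<alpha> \<theta>0 \<theta> cos\<theta> in auto)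
  define d where "d = 1 / (2 * complex_of_real pi * \<i>)"
  \<comment> \<open>The contour formula requires r > 0. At the origin both sides are 0 because the
    symbol vanishes there.\<close>
  have rep: "?m \<xi> * of_real (gauss \<epsilon> \<xi>) = d * (LINT x|lborel. h (- \<theta>) \<epsilon> x \<xi>) + (- d) * (LINT x|lborel. h \<theta> \<epsilon> x \<xi>)" for \<epsilon> \<xi>
  proof (cases "\<xi> = 0")
    case True
    then show ?thesis by (simp add: h_def)
  next
    case False
    then have r: "(norm \<xi>)\<^sup>2 > 0" by simp
    have "((norm \<xi>)\<^sup>2) powr \<alpha> = norm \<xi> powr (2 * \<alpha>)"
      using False by (simp add: powr_powr flip: powr_numeral)
    from exp_powr_contour[OF \<alpha>(1) \<theta>0 \<theta>(2,3) cos\<theta> r, unfolded this]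
    have E: "complex_of_real (exp (- (norm \<xi> powr (2 * \<alpha>)))) =
      d * (LINT x|lborel. hankel \<alpha> (Complex x (- \<theta>)) / (exp (Complex x (- \<theta>)) - of_real ((norm \<xi>)\<^sup>2)))
      + (- d) * (LINT x|lborel. hankel \<alpha> (Complex x \<theta>) / (exp (Complex x \<theta>) - of_real ((norm \<xi>)\<^sup>2)))"
      by (simp add: d_def diff_divide_distrib)
    show ?thesis
      unfolding h_def integral_mult_left_zero E by (simp add: algebra_simps)
  qed
  have bound: "kernel_norm (\<lambda>\<xi>. ?m \<xi> * of_real (gauss \<epsilon> \<xi>)) \<le> ennreal (norm d) * ennreal B1 + ennreal (norm d) * ennreal B2"
    if \<epsilon>: "\<epsilon> > 0" for \<epsilon>
  proof -
    have i1: "integrable lborel (\<lambda>\<xi>. LINT x|lborel. h (- \<theta>) \<epsilon> x \<xi>)"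
      using lborel_pair.integrable_snd[OF B1(2)[OF \<epsilon>]] by simp
    have i2: "integrable lborel (\<lambda>\<xi>. LINT x|lborel. h \<theta> \<epsilon> x \<xi>)"
      using lborel_pair.integrable_snd[OF B2(2)[OF \<epsilon>]] by simp
    have "kernel_norm (\<lambda>\<xi>. ?m \<xi> * of_real (gauss \<epsilon> \<xi>))
       \<le> kernel_norm (\<lambda>\<xi>. d * (LINT x|lborel. h (- \<theta>) \<epsilon> x \<xi>)) + kernel_norm (\<lambda>\<xi>. (- d) * (LINT x|lborel. h \<theta> \<epsilon> x \<xi>))"
      unfolding rep by (intro kernel_norm_add integrable_mult_right i1 i2)
    also have "kernel_norm (\<lambda>\<xi>. d * (LINT x|lborel. h (- \<theta>) \<epsilon> x \<xi>)) = ennreal (norm d) * kernel_norm (\<lambda>\<xi>. LINT x|lborel. h (- \<theta>) \<epsilon> x \<xi>)"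
      using borel_measurable_integrable[OF i1] by (intro kernel_norm_cmult) simp
    also have "kernel_norm (\<lambda>\<xi>. (- d) * (LINT x|lborel. h \<theta> \<epsilon> x \<xi>)) = ennreal (norm (- d)) * kernel_norm (\<lambda>\<xi>. LINT x|lborel. h \<theta> \<epsilon> x \<xi>)"
      using borel_measurable_integrable[OF i2] by (intro kernel_norm_cmult) simp
    also have "ennreal (norm d) * kernel_norm (\<lambda>\<xi>. LINT x|lborel. h (- \<theta>) \<epsilon> x \<xi>) + ennreal (norm (- d)) * kernel_norm (\<lambda>\<xi>. LINT x|lborel. h \<theta> \<epsilon> x \<xi>)
       \<le> ennreal (norm d) * ennreal B1 + ennreal (norm d) * ennreal B2"
      unfolding norm_minus_cancel by (intro add_mono mult_left_mono B1(3) B2(3) \<epsilon>) auto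
    finally show ?thesis .
  qed
  have "kernel_norm ?m \<le> ennreal (norm d) * ennreal B1 + ennreal (norm d) * ennreal B2"
  \<comment> \<open>The damping parameter runs through 1/(n + 1). Since the Gaussian factor is at
    most 1, the undamped symbol, which is integrable, is the dominating function.\<close>
  proof (rule kernel_norm_limit)
    show "integrable lborel (\<lambda>\<xi>. norm (?m \<xi>))"
      by (intro integrable_norm leray_full_symbol_integrable \<alpha>)
    fix n :: nat
    show "kernel_norm (\<lambda>\<xi>. ?m \<xi> * of_real (exp (- (inverse (real (Suc n)) * (norm \<xi>)\<^sup>2)))) \<le> ennreal (norm d) * ennreal B1 + ennreal (norm d) * ennreal B2"
      by (rule bound) simp
    fix \<xi> :: "real^'n"
    show "norm (?m \<xi> * of_real (exp (- (inverse (real (Suc n)) * (norm \<xi>)\<^sup>2)))) \<le> norm (?m \<xi>)"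
      by (simp add: norm_mult mult_left_le)
  next
    fix \<xi> :: "real^'n"
    have "(\<lambda>n. exp (- (inverse (real (Suc n)) * (norm \<xi>)\<^sup>2))) \<longlonglongrightarrow> exp (- (0 * (norm \<xi>)\<^sup>2))"
      by (intro tendsto_intros LIMSEQ_inverse_real_of_nat)
    then have "(\<lambda>n. ?m \<xi> * of_real (exp (- (inverse (real (Suc n)) * (norm \<xi>)\<^sup>2)))) \<longlonglongrightarrow> ?m \<xi> * of_real (exp (- (0 * (norm \<xi>)\<^sup>2)))"
      by (intro tendsto_mult tendsto_const tendsto_of_real)
    then show "(\<lambda>n. ?m \<xi> * of_real (exp (- (inverse (real (Suc n)) * (norm \<xi>)\<^sup>2)))) \<longlonglongrightarrow> ?m \<xi>" by simp
  qed measurable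
  also have "\<dots> < \<infinity>" by (simp add: ennreal_mult_less_top)
  finally show ?thesis .
qed

text \<open>With c = \<tau>^(1/(2\<alpha>)) the dilation by \<open>c\<close> reduces time \<tau> to
  time 1, and homogeneity of degree one of the symbol leaves the factor 1/c. Summing over all index
  triples gives one constant for all of them.\<close>

theorem leray_kernel_L1:
  assumes \<alpha>: "1 / 2 \<le> \<alpha>" "\<alpha> < 1"
  obtains C where "C \<ge> 0" and "\<And>\<tau> i j (k :: 'n::finite). \<tau> > 0 \<Longrightarrow>
    (\<integral>\<^sup>+x. ennreal (norm (leray_kernel \<alpha> \<tau> i j k x)) \<partial>lborel) \<le> ennreal (C * \<tau> powr (- 1 / (2 * \<alpha>)))"
proof -
  let ?m = "\<lambda>i j (k::'n) \<xi>. leray_deriv_symbol i j k \<xi> * complex_of_real (exp (- (norm \<xi> powr (2 * \<alpha>))))"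
  define A where "A i j k = enn2real (kernel_norm (?m i j k))" for i j k
  have A: "kernel_norm (?m i j k) = ennreal (A i j k)" for i j k
    unfolding A_def using kernel_norm_leray_unit_time[OF \<alpha>, of i j k] by (intro ennreal_enn2real[symmetric]) simp
  have A0: "A i j k \<ge> 0" for i j k by (simp add: A_def)
  define C where "C = (\<Sum>i\<in>UNIV. \<Sum>j\<in>UNIV. \<Sum>k\<in>UNIV. A i j k)"
  have AC: "A i j k \<le> C" for i j k
  proof -
    have "A i j k \<le> (\<Sum>k\<in>UNIV. A i j k)" by (rule member_le_sum) (auto intro: A0)
    also have "\<dots> \<le> (\<Sum>j\<in>UNIV. \<Sum>k\<in>UNIV. A i j k)"
      by (rule member_le_sum[of j _ "\<lambda>j. \<Sum>k\<in>UNIV. A i j k"]) (auto intro: A0 sum_nonneg)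
    also have "\<dots> \<le> C"
      unfolding C_def by (rule member_le_sum[of i _ "\<lambda>i. \<Sum>j\<in>UNIV. \<Sum>k\<in>UNIV. A i j k"]) (auto intro: A0 sum_nonneg)
    finally show ?thesis .
  qed
  have C0: "C \<ge> 0" using A0 AC order_trans by blast
  have "(\<integral>\<^sup>+x. ennreal (norm (leray_kernel \<alpha> \<tau> i j k x)) \<partial>lborel) \<le> ennreal (C * \<tau> powr (- 1 / (2 * \<alpha>)))"
    if \<tau>: "\<tau> > 0" for \<tau> and i j k :: 'n
  proof -
    define c where "c = \<tau> powr (1 / (2 * \<alpha>))"
    have c: "c > 0" using \<tau> by (simp add: c_def)
    have c\<alpha>: "c powr (2 * \<alpha>) = \<tau>" unfolding c_def using \<tau> \<alpha> by (simp add: powr_powr)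
    have eq: "complex_of_real (leray_symbol i j \<xi>) * (\<i> * complex_of_real (\<xi> $ k)) * complex_of_real (exp (- \<tau> * norm \<xi> powr (2 * \<alpha>)))
      = complex_of_real (inverse c) * ?m i j k (c *\<^sub>R \<xi>)" for \<xi>
      using c by (simp add: leray_deriv_symbol_scale powr_mult c\<alpha>) (simp add: leray_deriv_symbol_def)
    have "(\<integral>\<^sup>+x. ennreal (norm (leray_kernel \<alpha> \<tau> i j k x)) \<partial>lborel) = kernel_norm (\<lambda>\<xi>. complex_of_real (inverse c) * ?m i j k (c *\<^sub>R \<xi>))"
      unfolding leray_kernel_def kernel_norm_def eq ..
    also have "\<dots> = ennreal (norm (complex_of_real (inverse c))) * kernel_norm (\<lambda>\<xi>. ?m i j k (c *\<^sub>R \<xi>))"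
      by (rule kernel_norm_cmult) measurable
    also have "kernel_norm (\<lambda>\<xi>. ?m i j k (c *\<^sub>R \<xi>)) = kernel_norm (?m i j k)"
      by (rule kernel_norm_scale) (use c in measurable)
    also have "ennreal (norm (complex_of_real (inverse c))) * kernel_norm (?m i j k) = ennreal (inverse c * A i j k)"
      unfolding A using c A0 by (simp add: norm_inverse ennreal_mult)
    also have "\<dots> \<le> ennreal (C * \<tau> powr (- 1 / (2 * \<alpha>)))"
    proof (rule ennreal_leI)
      have "inverse c = \<tau> powr (- 1 / (2 * \<alpha>))" by (simp add: c_def powr_minus)
      then show "inverse c * A i j k \<le> C * \<tau> powr (- 1 / (2 * \<alpha>))"
        using AC[of i j k] by (simp add: mult.commute mult_right_mono)
    qed
    finally show ?thesis .
  qed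
  with C0 that show thesis by blast
qed

section \<open>Measurability and realness\<close>

lemma borel_measurable_vec:
  fixes f :: "'a \<Rightarrow> 'b::euclidean_space ^ 'n::finite"
  assumes "\<And>i. (\<lambda>x. f x $ i) \<in> borel_measurable M"
  shows "f \<in> borel_measurable M"
  unfolding borel_measurable_euclidean_space[of f]
proof
  fix b :: "'b ^ 'n" assume "b \<in> Basis"
  then obtain i u where "b = axis i u" unfolding Basis_vec_def by auto
  then show "(\<lambda>x. f x \<bullet> b) \<in> borel_measurable M"
    using assms[of i] by (simp add: inner_axis)
qed

text \<open>Complex summability is absolute, so the infinite sum is an integral against counting
  measure; in the non-summable case both default to 0. Measurability of parameter integrals then
  applies.\<close>

lemma borel_measurable_infsum:
  fixes f :: "'i::countable \<Rightarrow> 'a \<Rightarrow> complex"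
  assumes [measurable]: "\<And>j. f j \<in> borel_measurable M"
  shows "(\<lambda>x. \<Sum>\<^sub>\<infinity>j. f j x) \<in> borel_measurable M"
proof -
  have iff: "(\<lambda>j. f j x) summable_on UNIV \<longleftrightarrow> Infinite_Set_Sum.abs_summable_on (\<lambda>j. f j x) UNIV" for x
    unfolding abs_summable_equivalent[symmetric] by (rule summable_on_iff_abs_summable_on_complex)
  have eq: "(\<Sum>\<^sub>\<infinity>j. f j x) = (LINT j|count_space UNIV. f j x)" for x
  proof (cases "(\<lambda>j. f j x) summable_on UNIV")
    case True
    from infsetsum_infsum[OF True[unfolded iff]] show ?thesis by (simp add: infsetsum_def)
  next
    case False
    then show ?thesis
      using False[unfolded iff]
      by (simp add: infsum_not_exists Infinite_Set_Sum.abs_summable_on_def not_integrable_integral_eq)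
  qed
  interpret sigma_finite_measure "count_space (UNIV :: 'i set)"
    by (rule sigma_finite_measure_count_space_countable) simp
  have "(\<lambda>z. f (snd z) (fst z)) \<in> borel_measurable (M \<Otimes>\<^sub>M count_space UNIV)"
    by (rule measurable_compose_countable'[where f = "\<lambda>j z. f j (fst z)" and g = snd and I = UNIV]) auto
  then have "(\<lambda>(x, j). f j x) \<in> borel_measurable (M \<Otimes>\<^sub>M count_space UNIV)"
    by (simp add: case_prod_unfold)
  from borel_measurable_lebesgue_integral[OF this] show ?thesis
    unfolding eq .
qed

lemma borel_measurable_leray_kernel:
  fixes g :: "'a \<Rightarrow> real^'n::finite"
  assumes [measurable]: "t \<in> borel_measurable M" "g \<in> borel_measurable M"
  shows "(\<lambda>p. leray_kernel \<alpha> (t p) i j k (g p)) \<in> borel_measurable M"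
  unfolding leray_kernel_def
  by (rule borel_measurable_inv_fourier_pair[where m = "\<lambda>p \<xi>. complex_of_real (leray_symbol i j \<xi>) *
     (\<i> * complex_of_real (\<xi> $ k)) * complex_of_real (exp (- t p * norm \<xi> powr (2 * \<alpha>)))"]) measurable

lemma borel_measurable_heat_kernel:
  fixes g :: "'a \<Rightarrow> real^'n::finite"
  assumes [measurable]: "t \<in> borel_measurable M" "g \<in> borel_measurable M"
  shows "(\<lambda>p. heat_kernel \<alpha> (t p) (g p)) \<in> borel_measurable M"
  unfolding heat_kernel_def
  by (rule borel_measurable_inv_fourier_pair[where m = "\<lambda>p \<xi>. complex_of_real (exp (- t p * norm \<xi> powr (2 * \<alpha>)))"]) measurable

lemma leray_kernel_real: "leray_kernel \<alpha> \<tau> i j k x \<in> \<real>"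
  unfolding leray_kernel_def
proof (rule inv_fourier_real)
  fix \<xi> :: "real^'a"
  have "leray_symbol i j (- \<xi>) = leray_symbol i j \<xi>" by (simp add: leray_symbol_def)
  then show "cnj (complex_of_real (leray_symbol i j \<xi>) * (\<i> * complex_of_real (\<xi> $ k)) * complex_of_real (exp (- \<tau> * norm \<xi> powr (2 * \<alpha>)))) =
     complex_of_real (leray_symbol i j (- \<xi>)) * (\<i> * complex_of_real ((- \<xi>) $ k)) * complex_of_real (exp (- \<tau> * norm (- \<xi>) powr (2 * \<alpha>)))"
    by simp
qed measurable

lemma heat_kernel_real: "heat_kernel \<alpha> \<tau> (x :: real^'n::finite) \<in> \<real>"
  unfolding heat_kernel_def
proof (rule inv_fourier_real)
  show "(\<lambda>\<xi>::real^'n. complex_of_real (exp (- \<tau> * norm \<xi> powr (2 * \<alpha>)))) \<in> borel_measurable borel"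
    by measurable
qed simp

lemma lebesgue_integral_Reals:
  fixes f :: "'a \<Rightarrow> complex"
  assumes "\<And>x. f x \<in> \<real>"
  shows "(LINT x|M. f x) \<in> \<real>"
proof -
  have "f = (\<lambda>x. complex_of_real (Re (f x)))" using assms by auto
  then have "(LINT x|M. f x) = complex_of_real (LINT x|M. Re (f x))"
    by (metis integral_complex_of_real)
  then show ?thesis by simp
qed

lemma convolution_Reals:
  assumes "\<And>y. K y \<in> \<real>" "\<And>y. g y \<in> \<real>"
  shows "convolution K g x \<in> \<real>"
  unfolding convolution_def by (intro lebesgue_integral_Reals Reals_mult assms)

lemma LP_symbol_schwartz:
  assumes "littlewood_paley \<psi>"
  shows "(\<lambda>\<xi>. complex_of_real (\<psi> ((2 powi (- j)) *\<^sub>R \<xi>))) \<in> schwartz"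
proof (rule test_function_schwartz)
  show "test_function \<psi>" using assms unfolding littlewood_paley_def by (rule conjunct1)
qed simp

lemma LP_proj_measurable:
  assumes "littlewood_paley \<psi>" "tempered T"
  shows "LP_proj \<psi> j T \<in> borel_measurable borel"
  unfolding LP_proj_def fourier_multiplier_def
  by (intro borel_measurable_continuous_onI tempered_translate_continuous assms(2) schwartz_inv_fourier LP_symbol_schwartz assms(1))

lemma LP_proj_real:
  assumes \<psi>: "littlewood_paley \<psi>" and T: "real_distr T"
  shows "LP_proj \<psi> j T x \<in> \<real>"
proof -
  let ?m = "\<lambda>\<xi>. complex_of_real (\<psi> ((2 powi (- j)) *\<^sub>R \<xi>))"
  have S: "inv_fourier ?m \<in> schwartz" by (intro schwartz_inv_fourier LP_symbol_schwartz \<psi>)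
  have r: "inv_fourier ?m y \<in> \<real>" for y
  proof (rule inv_fourier_real)
    show "?m \<in> borel_measurable borel" by (intro schwartz_measurable LP_symbol_schwartz \<psi>)
    \<comment> \<open>The Littlewood-Paley function is radial, hence even, so its kernel is
      real.\<close>
    have "\<psi> (- ((2 powi (- j)) *\<^sub>R \<xi>)) = \<psi> ((2 powi (- j)) *\<^sub>R \<xi>)" for \<xi>
      using \<psi> unfolding littlewood_paley_def by (metis norm_minus_cancel)
    then show "cnj (?m \<xi>) = ?m (- \<xi>)" for \<xi> by simp
  qed
  have "(\<forall>y. inv_fourier ?m (x - y) \<in> \<real>) \<longrightarrow> T (\<lambda>y. inv_fourier ?m (x - y)) \<in> \<real>"
    by (rule T[unfolded real_distr_def, THEN bspec, OF schwartz_reflect_translate(1)[OF S]])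
  then show ?thesis unfolding LP_proj_def fourier_multiplier_def using r by (simp only: simp_thms)
qed

lemma semigroup_at_real:
  assumes "littlewood_paley \<psi>" "real_distr T"
  shows "semigroup_at \<psi> \<alpha> t T x \<in> \<real>"
proof -
  define c where "c j = convolution (heat_kernel \<alpha> t) (LP_proj \<psi> j T) x" for j
  have "c j \<in> \<real>" for j
    unfolding c_def by (intro convolution_Reals heat_kernel_real LP_proj_real assms)
  then have c: "c = (\<lambda>j. complex_of_real (Re (c j)))" by auto
  have "(\<Sum>\<^sub>\<infinity>j. c j) \<in> \<real>"
  proof (cases "c summable_on UNIV")
    case True
    then have "Im (\<Sum>\<^sub>\<infinity>j. c j) = (\<Sum>\<^sub>\<infinity>j. Im (c j))" by (rule infsum_Im[symmetric])
    also have "\<dots> = 0" by (subst c) simp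
    finally show ?thesis by (simp add: complex_is_Real_iff)
  qed (simp add: infsum_not_exists)
  then show ?thesis unfolding semigroup_at_def c_def .
qed

lemma semigroup_at_measurable:
  fixes \<psi> :: "real^'n::finite \<Rightarrow> real"
  assumes "littlewood_paley \<psi>" "tempered T"
  shows "(\<lambda>z. semigroup_at \<psi> \<alpha> (snd z) T (fst z)) \<in> borel_measurable (borel :: ((real^'n) \<times> real) measure)"
  unfolding semigroup_at_def
proof (rule borel_measurable_infsum)
  fix j :: int
  have P: "LP_proj \<psi> j T \<in> borel_measurable borel" by (rule LP_proj_measurable[OF assms])
  have "(\<lambda>w. heat_kernel \<alpha> (snd (fst w)) (snd w) * LP_proj \<psi> j T (fst (fst w) - snd w))
      \<in> borel_measurable ((borel :: ((real^'n) \<times> real) measure) \<Otimes>\<^sub>M (lborel :: (real^'n) measure))"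
  proof (intro borel_measurable_times borel_measurable_heat_kernel)
    show "(\<lambda>w. LP_proj \<psi> j T (fst (fst w) - snd w)) \<in> borel_measurable ((borel :: ((real^'n) \<times> real) measure) \<Otimes>\<^sub>M (lborel :: (real^'n) measure))"
      by (rule measurable_compose[OF _ P]) (simp add: borel_prod[symmetric])
  qed (simp_all add: borel_prod[symmetric])
  then have "(\<lambda>(z, y). heat_kernel \<alpha> (snd z) y * LP_proj \<psi> j T (fst z - y))
      \<in> borel_measurable ((borel :: ((real^'n) \<times> real) measure) \<Otimes>\<^sub>M (lborel :: (real^'n) measure))"
    by (simp add: case_prod_unfold)
  from lborel.borel_measurable_lebesgue_integral[OF this]
  show "(\<lambda>z. convolution (heat_kernel \<alpha> (snd z)) (LP_proj \<psi> j T) (fst z)) \<in> borel_measurable (borel :: ((real^'n) \<times> real) measure)"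
    unfolding convolution_def .
qed

section \<open>The Duhamel operator\<close>

lemma AE_lborel_reflect:
  fixes x :: "'a::euclidean_space"
  assumes "AE y in lborel. P y"
  shows "AE y in lborel. P (x - y)"
proof -
  have eq: "lborel = distr lborel borel (\<lambda>y::'a. x - y)"
    using lborel_affine[of "- 1" x] by (simp add: density_1)
  have "AE y in distr lborel borel (\<lambda>y. x - y). P y"
    by (rule subst[where P = "\<lambda>M. AE y in M. P y", OF eq assms])
  then show ?thesis by (rule AE_distrD[rotated]) simp
qed

text \<open>The null set where \<open>f\<close> is large is carried to a null set by y -> x - y, so
  a bound almost everywhere on \<open>f\<close> controls the convolution at every \<open>x\<close>.
  The passage from essential to pointwise bounds in the fixed point argument happens here.\<close>

lemma integrable_convolution:
  fixes K f :: "real^'n::finite \<Rightarrow> complex"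
  assumes [measurable]: "K \<in> borel_measurable borel" "f \<in> borel_measurable borel"
    and K: "(\<integral>\<^sup>+x. ennreal (norm (K x)) \<partial>lborel) \<le> ennreal A" "A \<ge> 0"
    and f: "AE y in lborel. norm (f y) \<le> B" "B \<ge> 0"
  shows "integrable lborel (\<lambda>y. K y * f (x - y))"
    and "norm (convolution K f x) \<le> A * B"
proof -
  have KI: "integrable lborel K"
    using K(1) by (intro integrableI_bounded) (auto intro: order_le_less_trans)
  have KA: "(LINT y|lborel. norm (K y)) \<le> A"
    using K nn_integral_eq_integral[OF integrable_norm[OF KI]] by simp
  have fr: "AE y in lborel. norm (f (x - y)) \<le> B"
    by (rule AE_lborel_reflect[OF f(1)])
  have ae: "AE y in lborel. norm (K y * f (x - y)) \<le> norm (K y) * B"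
    using fr by eventually_elim (simp add: norm_mult mult_left_mono)
  have KB: "integrable lborel (\<lambda>y. norm (K y) * B)"
    by (intro integrable_mult_left integrable_norm KI)
  show "integrable lborel (\<lambda>y. K y * f (x - y))"
  proof (rule integrable_dominated[OF KB])
    show "AE y in lborel. norm (K y * f (x - y)) \<le> norm (norm (K y) * B)"
      using ae by eventually_elim (use f(2) in \<open>simp add: abs_mult\<close>)
  qed measurable
  have "norm (convolution K f x) \<le> (LINT y|lborel. norm (K y) * B)"
    unfolding convolution_def by (rule norm_lebesgue_integral_le[OF KB ae])
  also have "\<dots> \<le> A * B" using KA f(2) by (simp add: mult_right_mono)
  finally show "norm (convolution K f x) \<le> A * B" .
qed

text \<open>The substitution s = t u reduces to the Beta integral on the unit interval.\<close>

lemma beta_convolution: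
  fixes p q t :: real
  assumes p: "p > 0" and q: "q > 0" and t: "t > 0"
  shows "integrable lborel (\<lambda>s. indicator {0<..<t} s * ((t - s) powr (p - 1) * s powr (q - 1)))"
    and "(LINT s|lborel. indicator {0<..<t} s * ((t - s) powr (p - 1) * s powr (q - 1))) = Beta q p * t powr (p + q - 1)"
proof -
  let ?g = "\<lambda>s. indicator {0<..<t} s * ((t - s) powr (p - 1) * s powr (q - 1))"
  let ?f = "\<lambda>u. indicator {0..1} u *\<^sub>R (u powr (q - 1) * (1 - u) powr (p - 1))"
  have f: "integrable lborel ?f"
    using integrable_Beta[OF q p] unfolding set_integrable_def .
  have fB: "(LINT u|lborel. ?f u) = Beta q p"
    using set_borel_integral_eq_integral(2)[OF integrable_Beta[OF q p]] has_integral_Beta_real[OF q p]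
    by (simp add: set_lebesgue_integral_def integral_unique)
  have eq: "?g (0 + t * u) = t powr (p + q - 2) * ?f u" for u
  proof (cases "0 < u \<and> u < 1")
    case True
    have "(t - t * u) powr (p - 1) = t powr (p - 1) * (1 - u) powr (p - 1)"
      using True t powr_mult[of t "1 - u" "p - 1"] by (simp add: algebra_simps)
    moreover have "(t * u) powr (q - 1) = t powr (q - 1) * u powr (q - 1)"
      using True t by (simp add: powr_mult)
    moreover have "t powr (p + q - 2) = t powr (p - 1) * t powr (q - 1)"
      by (simp flip: powr_add)
    ultimately show ?thesis using True t by (simp add: indicator_def)
  next
    case False
    then have "indicator {0<..<t} (t * u) = (0::real)"
      using t by (auto simp: indicator_def zero_less_mult_iff)
    \<comment> \<open>At u = 0 and u = 1 one of the two factors is \<open>0 powr _\<close>, which is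
      0; so the open and the closed interval give the same function.\<close>
    moreover have "?f u = 0" using False by (auto simp: indicator_def)
    ultimately show ?thesis by simp
  qed
  have "integrable lborel (\<lambda>u. ?g (0 + t * u))"
    unfolding eq by (intro integrable_mult_right f)
  then show "integrable lborel ?g"
    using lborel_integrable_real_affine_iff[of t ?g 0] t by simp
  have "(LINT s|lborel. ?g s) = \<bar>t\<bar> *\<^sub>R (LINT u|lborel. ?g (0 + t * u))"
    by (rule lborel_integral_real_affine) (use t in simp)
  also have "\<dots> = t * (t powr (p + q - 2) * Beta q p)"
    unfolding eq using t by (simp only: integral_mult_right_zero fB) simp
  also have "\<dots> = Beta q p * t powr (p + q - 1)"
    using t powr_add[of t 1 "p + q - 2"] by simp
  finally show "(LINT s|lborel. ?g s) = Beta q p * t powr (p + q - 1)" .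
qed

text \<open>Of the size of the kernel, the fixed point argument knows only this bound. The parameter
  \<open>dim\<close> carries the dimension as a type.\<close>

locale duhamel =
  fixes \<alpha> C :: real and dim :: "'n::finite itself"
  assumes \<alpha>: "1 / 2 < \<alpha>" "\<alpha> < 1" and C0: "C \<ge> 0"
    and kernel: "\<And>\<tau> i j (k :: 'n). \<tau> > 0 \<Longrightarrow>
      (\<integral>\<^sup>+x. ennreal (norm (leray_kernel \<alpha> \<tau> i j k x)) \<partial>lborel) \<le> ennreal (C * \<tau> powr (- 1 / (2 * \<alpha>)))"
begin

definition \<beta> :: real where "\<beta> = 1 - 1 / (2 * \<alpha>)"

text \<open>The decay s^(-2\<beta>) is that of a product of two functions from \<open>GX\<close>.
  Measurability is asked on all of space and time, which suits functions extended by zero to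
  nonpositive times.\<close>

definition tensor_bound :: "real \<Rightarrow> ((real^'n) \<times> real \<Rightarrow> real^'n^'n) \<Rightarrow> bool" where
  "tensor_bound M F \<longleftrightarrow> F \<in> borel_measurable borel \<and> M \<ge> 0 \<and>
    (\<forall>s>0. AE y in lborel. \<forall>j k. \<bar>F (y, s) $ j $ k\<bar> \<le> M * s powr (- 2 * \<beta>))"

definition integrand :: "((real^'n) \<times> real \<Rightarrow> real^'n^'n) \<Rightarrow> real^'n \<Rightarrow> real \<Rightarrow> real \<Rightarrow> 'n \<Rightarrow> complex" where
  "integrand F x t s i = (\<Sum>j\<in>UNIV. \<Sum>k\<in>UNIV.
     convolution (leray_kernel \<alpha> (t - s) i j k) (\<lambda>y. complex_of_real (F (y, s) $ j $ k)) x)"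

lemma V_component: "V_nabla_Pi \<alpha> F (x, t) $ i = (LINT s|lborel. indicator {0<..<t} s *\<^sub>R integrand F x t s i)"
  by (simp add: V_nabla_Pi_def integrand_def set_lebesgue_integral_def)

lemma slice_measurable:
  fixes F :: "(real^'n) \<times> real \<Rightarrow> real^'n^'n"
  assumes "F \<in> borel_measurable borel"
  shows "(\<lambda>y. complex_of_real (F (y, s) $ j $ k)) \<in> borel_measurable borel"
proof -
  have "(\<lambda>y. F (y, s)) \<in> borel_measurable borel"
    by (rule measurable_compose[OF _ assms]) (intro borel_measurable_continuous_onI continuous_intros)
  moreover have "(\<lambda>A::real^'n^'n. A $ j $ k) \<in> borel_measurable borel"
    by (intro borel_measurable_continuous_onI continuous_intros)
  ultimately have "(\<lambda>y. F (y, s) $ j $ k) \<in> borel_measurable borel"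
    by (rule measurable_compose)
  then show ?thesis by measurable
qed

lemma kernel_measurable: "leray_kernel \<alpha> \<tau> i j (k :: 'n) \<in> borel_measurable borel"
  using borel_measurable_leray_kernel[of "\<lambda>_. \<tau>" borel "\<lambda>x. x" \<alpha> i j k] by simp

lemma convolution_bound:
  assumes F: "tensor_bound M F" and s: "0 < s" "s < t"
  shows "integrable lborel (\<lambda>y. leray_kernel \<alpha> (t - s) i j k y * complex_of_real (F (x - y, s) $ j $ k))"
    and "norm (convolution (leray_kernel \<alpha> (t - s) i j k) (\<lambda>y. complex_of_real (F (y, s) $ j $ k)) x)
      \<le> C * M * ((t - s) powr (- 1 / (2 * \<alpha>)) * s powr (- 2 * \<beta>))"
proof -
  have meas: "F \<in> borel_measurable borel" and M: "M \<ge> 0"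
    and ae: "AE y in lborel. \<forall>j k. \<bar>F (y, s) $ j $ k\<bar> \<le> M * s powr (- 2 * \<beta>)"
    using F s unfolding tensor_bound_def by auto
  have ae': "AE y in lborel. norm (complex_of_real (F (y, s) $ j $ k)) \<le> M * s powr (- 2 * \<beta>)"
    using ae by eventually_elim simp
  have K: "(\<integral>\<^sup>+x. ennreal (norm (leray_kernel \<alpha> (t - s) i j k x)) \<partial>lborel) \<le> ennreal (C * (t - s) powr (- 1 / (2 * \<alpha>)))"
    using kernel s by simp
  have nn: "C * (t - s) powr (- 1 / (2 * \<alpha>)) \<ge> 0" "M * s powr (- 2 * \<beta>) \<ge> 0" using C0 M by auto
  note ic = integrable_convolution[OF kernel_measurable slice_measurable[OF meas] K nn(1) ae' nn(2)]
  show "integrable lborel (\<lambda>y. leray_kernel \<alpha> (t - s) i j k y * complex_of_real (F (x - y, s) $ j $ k))"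
    by (rule ic(1))
  show "norm (convolution (leray_kernel \<alpha> (t - s) i j k) (\<lambda>y. complex_of_real (F (y, s) $ j $ k)) x)
      \<le> C * M * ((t - s) powr (- 1 / (2 * \<alpha>)) * s powr (- 2 * \<beta>))"
    using ic(2)[of x] by (simp only: mult_ac)
qed

lemma integrand_bound:
  assumes F: "tensor_bound M F" and s: "0 < s" "s < t"
  shows "norm (integrand F x t s i)
     \<le> (real CARD('n))\<^sup>2 * C * M * ((t - s) powr (- 1 / (2 * \<alpha>)) * s powr (- 2 * \<beta>))"
proof -
  let ?B = "C * M * ((t - s) powr (- 1 / (2 * \<alpha>)) * s powr (- 2 * \<beta>))"
  have "norm (integrand F x t s i) \<le> (\<Sum>j\<in>(UNIV::'n set). \<Sum>k\<in>(UNIV::'n set). ?B)"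
    unfolding integrand_def by (intro sum_norm_le convolution_bound(2)[OF F s])
  also have "\<dots> = (real CARD('n))\<^sup>2 * ?B"
    by (simp add: power2_eq_square)
  finally show ?thesis by (simp only: mult.assoc)
qed

text \<open>Measurability jointly in \<open>x\<close>, \<open>t\<close> and \<open>s\<close>, by
  repeated parameter integrals; it is what makes the Duhamel term measurable in space and time
  together.\<close>

lemma integrand_measurable:
  assumes F: "F \<in> borel_measurable borel"
  shows "(\<lambda>(z, s). integrand F (fst z) (snd z) s i) \<in> borel_measurable ((borel :: ((real^'n) \<times> real) measure) \<Otimes>\<^sub>M lborel)"
proof -
  let ?N = "(borel :: ((real^'n) \<times> real) measure) \<Otimes>\<^sub>M (lborel :: real measure)"
  have "(\<lambda>p. convolution (leray_kernel \<alpha> (snd (fst p) - snd p) i j k) (\<lambda>y. complex_of_real (F (y, snd p) $ j $ k)) (fst (fst p)))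
      \<in> borel_measurable ?N" for j k
  proof -
    have Fjk: "(\<lambda>z. complex_of_real (F z $ j $ k)) \<in> borel_measurable borel"
    proof -
      have "(\<lambda>A::real^'n^'n. complex_of_real (A $ j $ k)) \<in> borel_measurable borel"
        by (intro borel_measurable_continuous_onI continuous_intros)
      from measurable_compose[OF F this] show ?thesis .
    qed
    have "(\<lambda>w. leray_kernel \<alpha> (snd (fst (fst w)) - snd (fst w)) i j k (snd w) * complex_of_real (F (fst (fst (fst w)) - snd w, snd (fst w)) $ j $ k))
       \<in> borel_measurable (?N \<Otimes>\<^sub>M (lborel :: (real^'n) measure))"
    proof (intro borel_measurable_times borel_measurable_leray_kernel)
      show "(\<lambda>w. complex_of_real (F (fst (fst (fst w)) - snd w, snd (fst w)) $ j $ k)) \<in> borel_measurable (?N \<Otimes>\<^sub>M (lborel :: (real^'n) measure))"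
        by (rule measurable_compose[OF _ Fjk]) (simp add: borel_prod[symmetric])
    qed (simp_all add: borel_prod[symmetric])
    then have "(\<lambda>(p, y). leray_kernel \<alpha> (snd (fst p) - snd p) i j k y * complex_of_real (F (fst (fst p) - y, snd p) $ j $ k))
       \<in> borel_measurable (?N \<Otimes>\<^sub>M (lborel :: (real^'n) measure))"
      by (simp add: case_prod_unfold)
    from lborel.borel_measurable_lebesgue_integral[OF this] show ?thesis
      unfolding convolution_def .
  qed
  then have "(\<lambda>p. integrand F (fst (fst p)) (snd (fst p)) (snd p) i) \<in> borel_measurable ?N"
    unfolding integrand_def by (intro borel_measurable_sum)
  then show ?thesis by (simp add: case_prod_unfold)
qed

lemma V_measurable:
  fixes F :: "(real^'n) \<times> real \<Rightarrow> real^'n^'n"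
  assumes F: "F \<in> borel_measurable borel"
  shows "(\<lambda>z. V_nabla_Pi \<alpha> F z $ i) \<in> borel_measurable (borel :: ((real^'n) \<times> real) measure)"
proof -
  let ?N = "(borel :: ((real^'n) \<times> real) measure) \<Otimes>\<^sub>M (lborel :: real measure)"
  have ind: "(\<lambda>p::((real^'n) \<times> real) \<times> real. indicator {0<..<snd (fst p)} (snd p) :: real) \<in> borel_measurable ?N"
  proof -
    have [measurable]: "(\<lambda>p::((real^'n) \<times> real) \<times> real. snd (fst p)) \<in> borel_measurable ?N" "snd \<in> borel_measurable ?N"
      by (simp_all add: borel_prod[symmetric])
    have "(\<lambda>p::((real^'n) \<times> real) \<times> real. if 0 < snd p \<and> snd p < snd (fst p) then 1 else 0 :: real) \<in> borel_measurable ?N"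
      by measurable
    moreover have "(\<lambda>p::((real^'n) \<times> real) \<times> real. indicator {0<..<snd (fst p)} (snd p) :: real) = (\<lambda>p::((real^'n) \<times> real) \<times> real. if 0 < snd p \<and> snd p < snd (fst p) then 1 else 0)"
      by (auto simp: indicator_def fun_eq_iff)
    ultimately show ?thesis by simp
  qed
  have "(\<lambda>p::((real^'n) \<times> real) \<times> real. indicator {0<..<snd (fst p)} (snd p) *\<^sub>R integrand F (fst (fst p)) (snd (fst p)) (snd p) i) \<in> borel_measurable ?N"
    using integrand_measurable[OF F, of i] by (intro borel_measurable_scaleR ind) (simp add: case_prod_unfold)
  then have "(\<lambda>(z, s). indicator {0<..<snd z} s *\<^sub>R integrand F (fst z) (snd z) s i) \<in> borel_measurable ?N"
    by (simp add: case_prod_unfold)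
  from lborel.borel_measurable_lebesgue_integral[OF this]
  have "(\<lambda>z. LINT s|lborel. indicator {0<..<snd z} s *\<^sub>R integrand F (fst z) (snd z) s i) \<in> borel_measurable borel" .
  moreover have "(\<lambda>z. V_nabla_Pi \<alpha> F z $ i) = (\<lambda>z. LINT s|lborel. indicator {0<..<snd z} s *\<^sub>R integrand F (fst z) (snd z) s i)"
    by (rule ext) (metis V_component prod.collapse)
  ultimately show ?thesis by simp
qed

lemma V_real:
  fixes F :: "(real^'n) \<times> real \<Rightarrow> real^'n^'n"
  shows "V_nabla_Pi \<alpha> F (x, t) $ i \<in> \<real>"
  unfolding V_component integrand_def scaleR_conv_of_real
  by (intro lebesgue_integral_Reals Reals_mult Reals_of_real sum_in_Reals convolution_Reals leray_kernel_real)

text \<open>The first inequality is \<alpha> > 1/2 and the second is \<alpha> < 1: they make the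
  singularities at s = t and at s = 0 integrable. The identity expresses scaling criticality, since
  the bilinear term decays exactly like t^(-\<beta>) again.\<close>

lemma exponents: "0 < 1 - 1 / (2 * \<alpha>)" "0 < 1 - 2 * \<beta>" "(1 - 1 / (2 * \<alpha>)) + (1 - 2 * \<beta>) - 1 = - \<beta>"
  using \<alpha> by (auto simp: \<beta>_def field_simps)

text \<open>Two powers of the dimension come from the sum over \<open>j\<close> and
  \<open>k\<close>, the third from bounding the Euclidean norm by the sum of the components.\<close>

definition duhamel_const :: real where "duhamel_const = real CARD('n) ^ 3 * C * Beta (1 - 2 * \<beta>) (1 - 1 / (2 * \<alpha>))"

lemma duhamel_const_nonneg: "duhamel_const \<ge> 0"
  unfolding duhamel_const_def using C0 exponents by (intro mult_nonneg_nonneg) (auto simp: Beta_def Gamma_real_nonneg)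

lemma V_integrable:
  assumes F: "tensor_bound M F" and t: "t > 0"
  shows "integrable lborel (\<lambda>s. indicator {0<..<t} s *\<^sub>R integrand F x t s i)"
    and "norm (V_nabla_Pi \<alpha> F (x, t) $ i) \<le> (real CARD('n))\<^sup>2 * C * M * (Beta (1 - 2 * \<beta>) (1 - 1 / (2 * \<alpha>)) * t powr (- \<beta>))"
proof -
  let ?w = "\<lambda>s. indicator {0<..<t} s * ((t - s) powr (- 1 / (2 * \<alpha>)) * s powr (- 2 * \<beta>))"
  have M: "M \<ge> 0" and meas: "F \<in> borel_measurable borel" using F by (auto simp: tensor_bound_def)
  have w: "integrable lborel ?w" "(LINT s|lborel. ?w s) = Beta (1 - 2 * \<beta>) (1 - 1 / (2 * \<alpha>)) * t powr (- \<beta>)"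
    using beta_convolution[OF exponents(1,2) t] by (simp_all only: exponents(3)) (simp_all add: algebra_simps)
  have cw: "integrable lborel (\<lambda>s. (real CARD('n))\<^sup>2 * C * M * ?w s)"
    by (intro integrable_mult_right w)
  have bound: "norm (indicator {0<..<t} s *\<^sub>R integrand F x t s i) \<le> (real CARD('n))\<^sup>2 * C * M * ?w s" for s
    using integrand_bound[OF F, of s t x i] by (auto simp: indicator_def)
  have ms: "(\<lambda>s. indicator {0<..<t} s *\<^sub>R integrand F x t s i) \<in> borel_measurable lborel"
  proof -
    have "(\<lambda>s. case ((x, t), s) of (z, s) \<Rightarrow> integrand F (fst z) (snd z) s i) \<in> borel_measurable lborel"
      by (rule measurable_compose[OF _ integrand_measurable[OF meas, of i]]) simp
    then show ?thesis by simp
  qed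
  show int: "integrable lborel (\<lambda>s. indicator {0<..<t} s *\<^sub>R integrand F x t s i)"
    by (rule integrable_dominated[OF cw ms]) (intro AE_I2 order_trans[OF bound], simp)
  have "norm (V_nabla_Pi \<alpha> F (x, t) $ i) \<le> (LINT s|lborel. (real CARD('n))\<^sup>2 * C * M * ?w s)"
    unfolding V_component by (rule norm_lebesgue_integral_le[OF cw]) (intro AE_I2 bound)
  then show "norm (V_nabla_Pi \<alpha> F (x, t) $ i) \<le> (real CARD('n))\<^sup>2 * C * M * (Beta (1 - 2 * \<beta>) (1 - 1 / (2 * \<alpha>)) * t powr (- \<beta>))"
    unfolding integral_mult_right_zero w(2) .
qed

definition real_duhamel :: "((real^'n) \<times> real \<Rightarrow> real^'n^'n) \<Rightarrow> (real^'n) \<times> real \<Rightarrow> real^'n" where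
  "real_duhamel F z = (\<chi> i. Re (V_nabla_Pi \<alpha> F z $ i))"

lemma real_duhamel_bound:
  assumes F: "tensor_bound M F" and t: "t > 0"
  shows "norm (real_duhamel F (x, t)) \<le> duhamel_const * M * t powr (- \<beta>)"
proof -
  have "norm (real_duhamel F (x, t)) \<le> (\<Sum>i\<in>UNIV. \<bar>real_duhamel F (x, t) $ i\<bar>)" by (rule norm_le_l1_cart)
  also have "\<dots> \<le> (\<Sum>i\<in>(UNIV::'n set). (real CARD('n))\<^sup>2 * C * M * (Beta (1 - 2 * \<beta>) (1 - 1 / (2 * \<alpha>)) * t powr (- \<beta>)))"
  proof (rule sum_mono)
    fix i
    have "\<bar>real_duhamel F (x, t) $ i\<bar> \<le> norm (V_nabla_Pi \<alpha> F (x, t) $ i)"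
      by (simp add: real_duhamel_def abs_Re_le_cmod)
    also note V_integrable(2)[OF F t, of x i]
    finally show "\<bar>real_duhamel F (x, t) $ i\<bar> \<le> (real CARD('n))\<^sup>2 * C * M * (Beta (1 - 2 * \<beta>) (1 - 1 / (2 * \<alpha>)) * t powr (- \<beta>))" .
  qed
  also have "\<dots> = duhamel_const * M * t powr (- \<beta>)"
    by (simp add: duhamel_const_def power2_eq_square power3_eq_cube)
  finally show ?thesis .
qed

lemma real_duhamel_measurable: "F \<in> borel_measurable borel \<Longrightarrow> real_duhamel F \<in> borel_measurable borel"
  using V_measurable[of F] by (intro borel_measurable_vec) (simp add: real_duhamel_def borel_measurable_Re)

text \<open>Linearity of the two nested integrals, in space and in time, holds because the tensor
  bounds make both summands integrable at each level.\<close>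

lemma real_duhamel_diff:
  assumes F: "tensor_bound M F" and G: "tensor_bound N G" and t: "t > 0"
  shows "real_duhamel F (x, t) - real_duhamel G (x, t) = real_duhamel (\<lambda>z. F z - G z) (x, t)"
proof -
  have conv: "convolution (leray_kernel \<alpha> (t - s) i j k) (\<lambda>y. complex_of_real (F (y, s) $ j $ k)) x
      - convolution (leray_kernel \<alpha> (t - s) i j k) (\<lambda>y. complex_of_real (G (y, s) $ j $ k)) x
     = convolution (leray_kernel \<alpha> (t - s) i j k) (\<lambda>y. complex_of_real ((F (y, s) - G (y, s)) $ j $ k)) x"
    if s: "0 < s" "s < t" for s i j k
    unfolding convolution_def
    using convolution_bound(1)[OF F s, of i j k x] convolution_bound(1)[OF G s, of i j k x]
    by (subst Bochner_Integration.integral_diff[symmetric]) (auto simp: algebra_simps)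
  have "integrand F x t s i - integrand G x t s i = integrand (\<lambda>z. F z - G z) x t s i" if "0 < s" "s < t" for s i
    unfolding integrand_def sum_subtractf[symmetric] conv[OF that] ..
  then have "indicator {0<..<t} s *\<^sub>R integrand F x t s i - indicator {0<..<t} s *\<^sub>R integrand G x t s i
     = indicator {0<..<t} s *\<^sub>R integrand (\<lambda>z. F z - G z) x t s i" for s i
    by (auto simp: indicator_def)
  then have "V_nabla_Pi \<alpha> F (x, t) $ i - V_nabla_Pi \<alpha> G (x, t) $ i = V_nabla_Pi \<alpha> (\<lambda>z. F z - G z) (x, t) $ i" for i
    unfolding V_component
    by (subst Bochner_Integration.integral_diff[symmetric, OF V_integrable(1)[OF F t] V_integrable(1)[OF G t]]) simp
  then show ?thesis
    by (simp add: real_duhamel_def vec_eq_iff flip: minus_complex.simps)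
qed

text \<open>Only times in (0, t) enter the integral. An element of \<open>GX\<close>, which is
  \<open>undefined\<close> at nonpositive times, may therefore be exchanged for its extension by
  zero.\<close>

lemma V_cong:
  fixes F G :: "(real^'n) \<times> real \<Rightarrow> real^'n^'n"
  assumes "\<And>z. z \<in> spacetime \<Longrightarrow> F z = G z"
  shows "V_nabla_Pi \<alpha> F (x, t) = V_nabla_Pi \<alpha> G (x, t)"
proof -
  have "indicator {0<..<t} s *\<^sub>R integrand F x t s i = indicator {0<..<t} s *\<^sub>R integrand G x t s i" for s i
    using assms by (auto simp: indicator_def integrand_def spacetime_def)
  then show ?thesis unfolding vec_eq_iff V_component by (simp only: simp_thms)
qed

end

section \<open>The fixed point\<close>

context duhamel
begin

text \<open>The ball of radius \<delta> in \<open>GX\<close>, for functions measurable everywhere;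
  the exceptional null set may depend on \<open>t\<close>.\<close>

definition sol_bound :: "real \<Rightarrow> ((real^'n) \<times> real \<Rightarrow> real^'n) \<Rightarrow> bool" where
  "sol_bound \<delta> u \<longleftrightarrow> u \<in> borel_measurable borel \<and> (\<forall>t>0. AE x in lborel. norm (u (x, t)) \<le> \<delta> * t powr (- \<beta>))"

lemma powr_beta_square: "t powr (- \<beta>) * t powr (- \<beta>) = t powr (- 2 * \<beta>)"
  by (simp flip: powr_add)

lemma tensor_square_measurable:
  fixes u :: "(real^'n) \<times> real \<Rightarrow> real^'n"
  assumes "u \<in> borel_measurable borel"
  shows "tensor_square u \<in> borel_measurable borel"
proof -
  have c: "(\<lambda>z. u z $ j) \<in> borel_measurable borel" for j
    by (rule measurable_compose[OF assms]) measurable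
  show ?thesis
    unfolding tensor_square_def by (intro borel_measurable_vec) (simp, intro borel_measurable_times c)
qed

text \<open>Splitting the difference of the tensor squares of u and v into u with u - v plus u - v
  with v; each part contributes \<delta> D.\<close>

lemma tensor_square_diff_bound:
  assumes u: "sol_bound \<delta> u" and v: "sol_bound \<delta> v" and "\<delta> \<ge> 0" "D \<ge> 0"
    and d: "\<And>t. t > 0 \<Longrightarrow> AE x in lborel. norm (u (x, t) - v (x, t)) \<le> D * t powr (- \<beta>)"
  shows "tensor_bound (2 * \<delta> * D) (\<lambda>z. tensor_square u z - tensor_square v z)"
  unfolding tensor_bound_def
proof (intro conjI allI impI)
  show "(\<lambda>z. tensor_square u z - tensor_square v z) \<in> borel_measurable borel"
    using u v by (intro borel_measurable_diff tensor_square_measurable) (auto simp: sol_bound_def)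
  show "0 \<le> 2 * \<delta> * D" using assms by simp
  fix s :: real assume s: "s > 0"
  have "AE x in lborel. norm (u (x, s)) \<le> \<delta> * s powr (- \<beta>)" "AE x in lborel. norm (v (x, s)) \<le> \<delta> * s powr (- \<beta>)"
    using u v s by (auto simp: sol_bound_def)
  then show "AE y in lborel. \<forall>j k. \<bar>(tensor_square u (y, s) - tensor_square v (y, s)) $ j $ k\<bar> \<le> 2 * \<delta> * D * s powr (- 2 * \<beta>)"
    using d[OF s]
  proof eventually_elim
    case (elim y)
    show ?case
    proof (intro allI)
      fix j k
      let ?u = "u (y, s)" and ?v = "v (y, s)"
      have eq: "(tensor_square u (y, s) - tensor_square v (y, s)) $ j $ k = ?u $ j * (?u - ?v) $ k + (?u - ?v) $ j * ?v $ k"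
        by (simp add: tensor_square_def algebra_simps)
      have "\<bar>(tensor_square u (y, s) - tensor_square v (y, s)) $ j $ k\<bar>
          \<le> \<bar>?u $ j\<bar> * \<bar>(?u - ?v) $ k\<bar> + \<bar>(?u - ?v) $ j\<bar> * \<bar>?v $ k\<bar>"
        unfolding eq using abs_triangle_ineq[of "?u $ j * (?u - ?v) $ k" "(?u - ?v) $ j * ?v $ k"] by (simp only: abs_mult)
      also have "\<dots> \<le> (\<delta> * s powr (- \<beta>)) * (D * s powr (- \<beta>)) + (D * s powr (- \<beta>)) * (\<delta> * s powr (- \<beta>))"
        by (intro add_mono mult_mono order_trans[OF component_le_norm_cart] elim) (use assms in auto)
      also have "\<dots> = 2 * \<delta> * D * (s powr (- \<beta>) * s powr (- \<beta>))" by simp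
      finally show "\<bar>(tensor_square u (y, s) - tensor_square v (y, s)) $ j $ k\<bar> \<le> 2 * \<delta> * D * s powr (- 2 * \<beta>)"
        unfolding powr_beta_square .
    qed
  qed
qed

lemma tensor_square_bound:
  assumes u: "sol_bound \<delta> u" and \<delta>: "\<delta> \<ge> 0"
  shows "tensor_bound (2 * \<delta> * \<delta>) (tensor_square u)"
proof -
  have z: "sol_bound \<delta> (\<lambda>_. 0)" using \<delta> by (simp add: sol_bound_def)
  have "tensor_square (\<lambda>_. 0) = (\<lambda>_. 0 :: real^'n^'n)" by (simp add: tensor_square_def fun_eq_iff vec_eq_iff)
  then show ?thesis
    using tensor_square_diff_bound[OF u z \<delta> \<delta>] u by (simp add: sol_bound_def)
qed

text \<open>The difference bound gives the factor 2 \<delta> D, and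
  \<open>duhamel_const * \<delta> \<le> 1 / 4\<close> turns it into D/2. The premise on u - v holds
  almost everywhere, the conclusion at every point.\<close>

lemma real_duhamel_contraction:
  assumes u: "sol_bound \<delta> u" and v: "sol_bound \<delta> v" and \<delta>: "\<delta> \<ge> 0" "duhamel_const * \<delta> \<le> 1 / 4" and D: "D \<ge> 0"
    and d: "\<And>t. t > 0 \<Longrightarrow> AE x in lborel. norm (u (x, t) - v (x, t)) \<le> D * t powr (- \<beta>)"
    and t: "t > 0"
  shows "norm (real_duhamel (tensor_square u) (x, t) - real_duhamel (tensor_square v) (x, t)) \<le> D / 2 * t powr (- \<beta>)"
proof -
  have "norm (real_duhamel (tensor_square u) (x, t) - real_duhamel (tensor_square v) (x, t)) \<le> duhamel_const * (2 * \<delta> * D) * t powr (- \<beta>)"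
    unfolding real_duhamel_diff[OF tensor_square_bound[OF u \<delta>(1)] tensor_square_bound[OF v \<delta>(1)] t]
    by (rule real_duhamel_bound[OF tensor_square_diff_bound[OF u v \<delta>(1) D d] t])
  also have "duhamel_const * (2 * \<delta> * D) = (duhamel_const * \<delta>) * (2 * D)" by simp
  also have "(duhamel_const * \<delta>) * (2 * D) * t powr (- \<beta>) \<le> 1 / 4 * (2 * D) * t powr (- \<beta>)"
    by (intro mult_right_mono \<delta>) (use D in auto)
  finally show ?thesis by simp
qed

definition solves :: "((real^'n) \<times> real \<Rightarrow> real^'n) \<Rightarrow> ((real^'n) \<times> real \<Rightarrow> real^'n) \<Rightarrow> bool" where
  "solves a u \<longleftrightarrow> (\<forall>x. \<forall>t>0. u (x, t) = a (x, t) - real_duhamel (tensor_square u) (x, t))"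

text \<open>The contraction is iterated from the trivial bound 2\<delta>: the difference is at most
  2\<delta>/2^n almost everywhere for every \<open>n\<close>, and one further application gives such
  a bound at the given point.\<close>

lemma solution_unique:
  assumes u: "sol_bound \<delta> u" "solves a u" and v: "sol_bound \<delta> v" "solves a v"
    and \<delta>: "\<delta> \<ge> 0" "duhamel_const * \<delta> \<le> 1 / 4" and t: "t > 0"
  shows "u (x, t) = v (x, t)"
proof -
  have step: "norm (u (x, t) - v (x, t)) \<le> D / 2 * t powr (- \<beta>)"
    if "D \<ge> 0" "\<And>t. t > 0 \<Longrightarrow> AE x in lborel. norm (u (x, t) - v (x, t)) \<le> D * t powr (- \<beta>)" "t > 0" for D t x
  proof -
    have "u (x, t) - v (x, t) = - (real_duhamel (tensor_square u) (x, t) - real_duhamel (tensor_square v) (x, t))"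
      using u(2) v(2) that(3) by (simp add: solves_def)
    then show ?thesis
      using real_duhamel_contraction[OF u(1) v(1) \<delta> that(1,2,3), of x] by (simp only: norm_minus_cancel)
  qed
  have ae: "AE x in lborel. norm (u (x, t) - v (x, t)) \<le> (2 * \<delta> * (1 / 2) ^ n) * t powr (- \<beta>)" if "t > 0" for n t
    using that
  proof (induction n arbitrary: t)
    case 0
    have "AE x in lborel. norm (u (x, t)) \<le> \<delta> * t powr (- \<beta>)" "AE x in lborel. norm (v (x, t)) \<le> \<delta> * t powr (- \<beta>)"
      using u(1) v(1) 0 by (auto simp: sol_bound_def)
    then show ?case
    proof eventually_elim
      case (elim x)
      have "norm (u (x, t) - v (x, t)) \<le> norm (u (x, t)) + norm (v (x, t))" by (rule norm_triangle_ineq4)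
      then show ?case using elim by simp
    qed
  next
    case (Suc n)
    have "norm (u (x, t) - v (x, t)) \<le> (2 * \<delta> * (1 / 2) ^ n) / 2 * t powr (- \<beta>)" for x
      by (rule step) (use \<delta> Suc in auto)
    then show ?case by simp
  qed
  have le: "norm (u (x, t) - v (x, t)) \<le> (\<delta> * t powr (- \<beta>)) * (1 / 2) ^ n" for n
    using step[OF _ ae t, of n x] \<delta> by (simp add: mult_ac)
  have "(\<lambda>n. (\<delta> * t powr (- \<beta>)) * (1 / 2) ^ n) \<longlonglongrightarrow> 0"
    by (intro tendsto_mult_right_zero LIMSEQ_power_zero) simp
  from LIMSEQ_le_const[OF this] le have "norm (u (x, t) - v (x, t)) \<le> 0" by blast
  then show ?thesis by simp
qed

text \<open>Picard iteration with geometric convergence at each point of positive time. The linear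
  part takes up half of the radius, and the bilinear term, at most duhamel_const times 2\<delta>^2,
  fits into the other half.\<close>

lemma solution_exists:
  assumes a: "sol_bound (\<delta> / 2) a" and \<delta>: "\<delta> \<ge> 0" "duhamel_const * \<delta> \<le> 1 / 4"
  obtains w where "sol_bound \<delta> w" "solves a w"
proof -
  define T where "T v z = a z - real_duhamel (tensor_square v) z" for v z
  define U where "U m = (T ^^ m) a" for m
  have USuc: "U (Suc m) = T (U m)" for m by (simp add: U_def)
  have am: "a \<in> borel_measurable borel" using a by (simp add: sol_bound_def)
  have Tb: "sol_bound \<delta> (T v)" if v: "sol_bound \<delta> v" for v
    unfolding sol_bound_def
  proof (intro conjI allI impI)
    show "T v \<in> borel_measurable borel"
      unfolding T_def using v am
      by (intro borel_measurable_diff real_duhamel_measurable tensor_square_measurable) (auto simp: sol_bound_def)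
    fix t :: real assume t: "t > 0"
    have "AE x in lborel. norm (a (x, t)) \<le> \<delta> / 2 * t powr (- \<beta>)" using a t by (simp add: sol_bound_def)
    then show "AE x in lborel. norm (T v (x, t)) \<le> \<delta> * t powr (- \<beta>)"
    proof eventually_elim
      case (elim x)
      have "norm (real_duhamel (tensor_square v) (x, t)) \<le> duhamel_const * (2 * \<delta> * \<delta>) * t powr (- \<beta>)"
        by (rule real_duhamel_bound[OF tensor_square_bound[OF v \<delta>(1)] t])
      also have "duhamel_const * (2 * \<delta> * \<delta>) = (duhamel_const * \<delta>) * (2 * \<delta>)" by simp
      also have "(duhamel_const * \<delta>) * (2 * \<delta>) * t powr (- \<beta>) \<le> 1 / 4 * (2 * \<delta>) * t powr (- \<beta>)"
        by (intro mult_right_mono \<delta>) (use \<delta> in auto)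
      finally have "norm (real_duhamel (tensor_square v) (x, t)) \<le> \<delta> / 2 * t powr (- \<beta>)" by simp
      moreover have "norm (T v (x, t)) \<le> norm (a (x, t)) + norm (real_duhamel (tensor_square v) (x, t))"
        unfolding T_def by (rule norm_triangle_ineq4)
      ultimately show ?case using elim by simp
    qed
  qed
  have Ub: "sol_bound \<delta> (U m)" for m
  proof (induction m)
    case 0
    have "AE x in lborel. norm (a (x, t)) \<le> \<delta> * t powr (- \<beta>)" if t: "t > 0" for t
    proof -
      have "AE x in lborel. norm (a (x, t)) \<le> \<delta> / 2 * t powr (- \<beta>)" using a t by (simp add: sol_bound_def)
      moreover have "\<delta> / 2 * t powr (- \<beta>) \<le> \<delta> * t powr (- \<beta>)" using \<delta> by (intro mult_right_mono) auto
      ultimately show ?thesis by (auto elim!: eventually_mono)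
    qed
    then show ?case using am by (simp add: U_def sol_bound_def)
  qed (simp add: USuc Tb)
  \<comment> \<open>The first iterate \<open>a\<close> is bounded only almost everywhere. After the
    shift every increment is a difference of two images under \<open>T\<close>, so it is bounded at
    every point and the limit exists everywhere.\<close>
  define W where "W m = U (Suc m)" for m
  have WSuc: "W (Suc m) = T (W m)" for m by (simp add: W_def USuc)
  have Wb: "sol_bound \<delta> (W m)" for m by (simp add: W_def Ub)
  have Tdiff: "norm (T u (x, t) - T v (x, t)) \<le> D / 2 * t powr (- \<beta>)"
    if "sol_bound \<delta> u" "sol_bound \<delta> v" "D \<ge> 0" "\<And>t. t > 0 \<Longrightarrow> AE x in lborel. norm (u (x, t) - v (x, t)) \<le> D * t powr (- \<beta>)" "t > 0"
    for u v D t x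
  proof -
    have "T u (x, t) - T v (x, t) = - (real_duhamel (tensor_square u) (x, t) - real_duhamel (tensor_square v) (x, t))" by (simp add: T_def)
    then show ?thesis
      using real_duhamel_contraction[OF that(1,2) \<delta> that(3,4,5), of x] by (simp only: norm_minus_cancel)
  qed
  have inc: "norm (W (Suc m) (x, t) - W m (x, t)) \<le> \<delta> * (1 / 2) ^ m * t powr (- \<beta>)" if "t > 0" for m x t
    using that
  proof (induction m arbitrary: x t)
    case 0
    have "AE x in lborel. norm (W 0 (x, t) - U 0 (x, t)) \<le> (2 * \<delta>) * t powr (- \<beta>)" if t: "t > 0" for t
    proof -
      have "AE x in lborel. norm (W 0 (x, t)) \<le> \<delta> * t powr (- \<beta>)" "AE x in lborel. norm (U 0 (x, t)) \<le> \<delta> * t powr (- \<beta>)"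
        using Wb[of 0] Ub[of 0] t by (auto simp: sol_bound_def)
      then show ?thesis
      proof eventually_elim
        case (elim x)
        have "norm (W 0 (x, t) - U 0 (x, t)) \<le> norm (W 0 (x, t)) + norm (U 0 (x, t))" by (rule norm_triangle_ineq4)
        then show ?case using elim by simp
      qed
    qed
    from Tdiff[OF Wb Ub _ this 0] have "norm (T (W 0) (x, t) - T (U 0) (x, t)) \<le> (2 * \<delta>) / 2 * t powr (- \<beta>)"
      using \<delta> by simp
    then show ?case unfolding WSuc by (simp add: W_def USuc)
  next
    case (Suc m)
    have "norm (T (W (Suc m)) (x, t) - T (W m) (x, t)) \<le> (\<delta> * (1 / 2) ^ m) / 2 * t powr (- \<beta>)"
      by (rule Tdiff[OF Wb Wb _ _ Suc.prems]) (use \<delta> Suc.IH in auto)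
    then show ?case by (simp add: WSuc)
  qed
  have conv: "convergent (\<lambda>m. W m (x, t))" if t: "t > 0" for x t
  proof -
    have "summable (\<lambda>m. W (Suc m) (x, t) - W m (x, t))"
    proof (rule summable_comparison_test')
      show "summable (\<lambda>m. \<delta> * (1 / 2) ^ m * t powr (- \<beta>))"
        by (intro summable_mult summable_mult2 summable_geometric) simp
      show "norm (W (Suc m) (x, t) - W m (x, t)) \<le> \<delta> * (1 / 2) ^ m * t powr (- \<beta>)" if "0 \<le> m" for m
        by (rule inc[OF t])
    qed
    then have "convergent (\<lambda>m. W m (x, t) - W 0 (x, t))"
      unfolding summable_iff_convergent sum_lessThan_telescope[of "\<lambda>m. W m (x, t)"] .
    then obtain L where "(\<lambda>m. W m (x, t) - W 0 (x, t)) \<longlonglongrightarrow> L" by (auto simp: convergent_def)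
    from tendsto_add[OF this tendsto_const[of "W 0 (x, t)"]]
    have "(\<lambda>m. W m (x, t)) \<longlonglongrightarrow> L + W 0 (x, t)" by simp
    then show ?thesis by (auto simp: convergent_def)
  qed
  \<comment> \<open>The value 0 at nonpositive times, where convergence is not known, keeps the
    limit measurable on the whole space.\<close>
  define w where "w z = (if z \<in> spacetime then lim (\<lambda>m. W m z) else 0)" for z
  have wlim: "(\<lambda>m. W m (x, t)) \<longlonglongrightarrow> w (x, t)" if t: "t > 0" for x t
    using conv[OF t, of x] t by (simp add: w_def spacetime_def convergent_LIMSEQ_iff)
  \<comment> \<open>Keeping the subtracted term of the geometric sum makes the induction on
    \<open>k\<close> close.\<close>
  have tail: "norm (W (m + k) (x, t) - W m (x, t)) \<le> 2 * \<delta> * ((1 / 2) ^ m - (1 / 2) ^ (m + k)) * t powr (- \<beta>)" if t: "t > 0" for m k x t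
  proof (induction k)
    case (Suc k)
    have "norm (W (m + Suc k) (x, t) - W m (x, t)) \<le> norm (W (Suc (m + k)) (x, t) - W (m + k) (x, t)) + norm (W (m + k) (x, t) - W m (x, t))"
      using norm_triangle_ineq[of "W (Suc (m + k)) (x, t) - W (m + k) (x, t)" "W (m + k) (x, t) - W m (x, t)"] by simp
    also have "\<dots> \<le> \<delta> * (1 / 2) ^ (m + k) * t powr (- \<beta>) + 2 * \<delta> * ((1 / 2) ^ m - (1 / 2) ^ (m + k)) * t powr (- \<beta>)"
      by (intro add_mono inc t Suc)
    also have "\<dots> = 2 * \<delta> * ((1 / 2) ^ m - (1 / 2) ^ (m + Suc k)) * t powr (- \<beta>)"
      by (simp add: algebra_simps)
    finally show ?case .
  qed simp
  have wW: "norm (w (x, t) - W m (x, t)) \<le> 2 * \<delta> * (1 / 2) ^ m * t powr (- \<beta>)" if t: "t > 0" for m x t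
  proof (rule LIMSEQ_le_const2)
    show "(\<lambda>k. norm (W (k + m) (x, t) - W m (x, t))) \<longlonglongrightarrow> norm (w (x, t) - W m (x, t))"
      by (intro tendsto_norm tendsto_diff tendsto_const LIMSEQ_ignore_initial_segment wlim t)
    have "norm (W (k + m) (x, t) - W m (x, t)) \<le> 2 * \<delta> * (1 / 2) ^ m * t powr (- \<beta>)" for k
    proof -
      have "2 * \<delta> * ((1 / 2) ^ m - (1 / 2) ^ (m + k)) * t powr (- \<beta>) \<le> 2 * \<delta> * (1 / 2) ^ m * t powr (- \<beta>)"
        using \<delta> by (intro mult_right_mono mult_left_mono) auto
      then show ?thesis using tail[OF t, where m = m and k = k and x = x] by (simp add: add.commute)
    qed
    then show "\<exists>N. \<forall>k\<ge>N. norm (W (k + m) (x, t) - W m (x, t)) \<le> 2 * \<delta> * (1 / 2) ^ m * t powr (- \<beta>)" by blast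
  qed
  have sp: "spacetime \<in> sets (borel :: ((real^'n) \<times> real) measure)"
    unfolding spacetime_def by (intro borel_open open_Times) auto
  have wm: "w \<in> borel_measurable borel"
  proof (rule borel_measurable_LIMSEQ_metric)
    show "(\<lambda>z. indicator spacetime z *\<^sub>R W m z) \<in> borel_measurable borel" for m
      using Wb[of m] sp by (intro borel_measurable_scaleR borel_measurable_indicator) (auto simp: sol_bound_def)
    show "(\<lambda>m. indicator spacetime z *\<^sub>R W m z) \<longlonglongrightarrow> w z" for z
    proof (cases "z \<in> spacetime")
      case True
      then show ?thesis using wlim[of "snd z" "fst z"] by (auto simp: spacetime_def)
    qed (simp add: w_def)
  qed
  have wb: "sol_bound \<delta> w"
    unfolding sol_bound_def
  proof (intro conjI allI impI wm)
    fix t :: real assume t: "t > 0"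
    have "AE x in lborel. \<forall>m. norm (W m (x, t)) \<le> \<delta> * t powr (- \<beta>)"
      unfolding AE_all_countable using Wb t by (auto simp: sol_bound_def)
    then show "AE x in lborel. norm (w (x, t)) \<le> \<delta> * t powr (- \<beta>)"
    proof eventually_elim
      case (elim x)
      show ?case by (rule LIMSEQ_le_const2[OF tendsto_norm[OF wlim[OF t]]]) (use elim in blast)
    qed
  qed
  have "solves a w"
    unfolding solves_def
  proof (intro allI impI)
    fix x :: "real^'n" and t :: real assume t: "t > 0"
    \<comment> \<open>W (m + 1) = T (W m) is close to both w and T w, each time within \<delta>/2^m
      up to the weight: on one side by the tail estimate, on the other by the contraction.\<close>
    have le: "norm (w (x, t) - T w (x, t)) \<le> (2 * \<delta> * t powr (- \<beta>)) * (1 / 2) ^ m" for m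
    proof -
      have "norm (T (W m) (x, t) - T w (x, t)) \<le> (2 * \<delta> * (1 / 2) ^ m) / 2 * t powr (- \<beta>)"
      proof (rule Tdiff[OF Wb wb _ _ t])
        show "AE x in lborel. norm (W m (x, t) - w (x, t)) \<le> 2 * \<delta> * (1 / 2) ^ m * t powr (- \<beta>)" if "t > 0" for t
          using wW[OF that] by (simp add: norm_minus_commute)
      qed (use \<delta> in simp)
      moreover have "norm (w (x, t) - W (Suc m) (x, t)) \<le> 2 * \<delta> * (1 / 2) ^ Suc m * t powr (- \<beta>)"
        by (rule wW[OF t])
      moreover have "norm (w (x, t) - T w (x, t)) \<le> norm (w (x, t) - W (Suc m) (x, t)) + norm (T (W m) (x, t) - T w (x, t))"
        unfolding WSuc using norm_triangle_ineq[of "w (x, t) - T (W m) (x, t)" "T (W m) (x, t) - T w (x, t)"] by simp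
      ultimately show ?thesis by (simp add: mult_ac)
    qed
    have "(\<lambda>n. (2 * \<delta> * t powr (- \<beta>)) * (1 / 2) ^ n) \<longlonglongrightarrow> 0"
      by (intro tendsto_mult_right_zero LIMSEQ_power_zero) simp
    from LIMSEQ_le_const[OF this] le have "norm (w (x, t) - T w (x, t)) \<le> 0" by blast
    then show "w (x, t) = a (x, t) - real_duhamel (tensor_square w) (x, t)" by (simp add: T_def)
  qed
  with wb that show thesis by blast
qed

lemma real_duhamel_tensor_square_cong:
  assumes "\<And>z. z \<in> spacetime \<Longrightarrow> u z = v z"
  shows "real_duhamel (tensor_square u) (x, t) = real_duhamel (tensor_square v) (x, t)"
proof -
  have "V_nabla_Pi \<alpha> (tensor_square u) (x, t) = V_nabla_Pi \<alpha> (tensor_square v) (x, t)"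
    by (rule V_cong) (simp add: tensor_square_def assms)
  then show ?thesis by (simp add: real_duhamel_def)
qed

lemma solves_cong:
  assumes "\<And>z. z \<in> spacetime \<Longrightarrow> u z = v z"
  shows "solves a u \<longleftrightarrow> solves a v"
  unfolding solves_def using real_duhamel_tensor_square_cong[OF assms] assms by (simp add: spacetime_def)

end

text \<open>The essential supremum of a non-measurable function is infinite by definition, so a
  finite bound also forces measurability of the norm; hence the first conjunct on the right.\<close>

lemma weighted_Linf_norm_le_iff:
  fixes f :: "real^'n::finite \<Rightarrow> 'b::real_normed_vector"
  assumes w: "w > 0" and c: "c \<ge> 0"
  shows "ennreal w * Linf_norm f \<le> ennreal c \<longleftrightarrow>
     (\<lambda>x. ennreal (norm (f x))) \<in> borel_measurable borel \<and> (AE x in lborel. norm (f x) \<le> c / w)"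
proof -
  have "ennreal w * Linf_norm f \<le> ennreal c \<longleftrightarrow> Linf_norm f \<le> ennreal (c / w)"
  proof (cases "Linf_norm f")
    case (real r)
    then show ?thesis using w c by (simp add: field_simps flip: ennreal_mult)
  next
    case top
    then show ?thesis using w by (simp add: ennreal_mult_top top_unique)
  qed
  also have "\<dots> \<longleftrightarrow> (\<lambda>x. ennreal (norm (f x))) \<in> borel_measurable borel \<and> (AE x in lborel. norm (f x) \<le> c / w)"
  proof
    assume L: "Linf_norm f \<le> ennreal (c / w)"
    have "(\<lambda>x. ennreal (norm (f x))) \<in> borel_measurable lborel"
    proof (rule ccontr)
      assume "(\<lambda>x. ennreal (norm (f x))) \<notin> borel_measurable lborel"
      then have "Linf_norm f = top" unfolding Linf_norm_def by (rule esssup_non_measurable)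
      then show False using L by (simp add: top_unique)
    qed
    moreover have "AE x in lborel. ennreal (norm (f x)) \<le> Linf_norm f"
      unfolding Linf_norm_def by (rule esssup_AE)
    then have "AE x in lborel. norm (f x) \<le> c / w"
    proof eventually_elim
      case (elim x)
      then have "ennreal (norm (f x)) \<le> ennreal (c / w)" using L by (rule order_trans)
      then show ?case using w c by (simp add: ennreal_le_iff)
    qed
    ultimately show "(\<lambda>x. ennreal (norm (f x))) \<in> borel_measurable borel \<and> (AE x in lborel. norm (f x) \<le> c / w)"
      by simp
  next
    assume "(\<lambda>x. ennreal (norm (f x))) \<in> borel_measurable borel \<and> (AE x in lborel. norm (f x) \<le> c / w)"
    then show "Linf_norm f \<le> ennreal (c / w)"
      unfolding Linf_norm_def by (intro esssup_I) (auto elim!: eventually_mono intro: ennreal_leI)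
  qed
  finally show ?thesis .
qed

theorem theorem1p4:
  fixes \<alpha> :: real and \<psi> :: "real^'n::finite \<Rightarrow> real"
  assumes "1 / 2 < \<alpha>" and "\<alpha> < 1" and "littlewood_paley \<psi>"
  shows "\<exists>\<epsilon>>0. \<exists>\<delta>>0. \<forall>u0 :: ('n distr)^'n.
    (\<forall>i. u0 $ i \<in> besov \<psi> \<alpha> \<and> real_distr (u0 $ i)) \<and> divergence_free u0 \<and>
    besov_norm \<psi> \<alpha> u0 \<le> ennreal \<epsilon> \<longrightarrow>
    (\<exists>!u. u \<in> GX \<alpha> \<and> GX_norm \<alpha> u \<le> ennreal \<delta> \<and> mild_solution \<psi> \<alpha> u0 u)"
proof -
  have "1 / 2 \<le> \<alpha>" using assms(1) by simp
  from leray_kernel_L1[OF this assms(2)]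
  obtain C where C: "C \<ge> 0" "\<And>\<tau> i j (k :: 'n). \<tau> > 0 \<Longrightarrow>
    (\<integral>\<^sup>+x. ennreal (norm (leray_kernel \<alpha> \<tau> i j k x)) \<partial>lborel) \<le> ennreal (C * \<tau> powr (- 1 / (2 * \<alpha>)))"
    by blast
  interpret duhamel \<alpha> C "TYPE('n)"
    by unfold_locales (use assms C in auto)
  \<comment> \<open>The summand 1 keeps the denominator positive even if
    \<open>duhamel_const\<close> is 0, and the 4 yields the smallness that halves distances.\<close>
  define \<delta> where "\<delta> = 1 / (4 * (duhamel_const + 1))"
  have \<delta>: "\<delta> > 0" "duhamel_const * \<delta> \<le> 1 / 4"
    using duhamel_const_nonneg by (simp_all add: \<delta>_def field_simps)
  then have \<delta>0: "\<delta> \<ge> 0" by simp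
  have wt: "c / t powr (1 - 1 / (2 * \<alpha>)) = c * t powr (- \<beta>)" for c t
    unfolding \<beta>_def[symmetric] by (simp only: powr_minus divide_inverse)
  have GX_iff: "GX_norm \<alpha> u \<le> ennreal c \<longleftrightarrow> (\<forall>t>0. (\<lambda>x. ennreal (norm (u (x, t)))) \<in> borel_measurable borel \<and>
      (AE x in lborel. norm (u (x, t)) \<le> c * t powr (- \<beta>)))" if "c \<ge> 0" for c and u :: "(real^'n) \<times> real \<Rightarrow> real^'n"
    unfolding GX_norm_def SUP_le_iff
    using that by (simp add: weighted_Linf_norm_le_iff wt Ball_def)
  have sp: "spacetime \<in> sets (borel :: ((real^'n) \<times> real) measure)"
    unfolding spacetime_def by (intro borel_open open_Times) auto
  have main: "\<exists>!u. u \<in> GX \<alpha> \<and> GX_norm \<alpha> u \<le> ennreal \<delta> \<and> mild_solution \<psi> \<alpha> u0 u"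
    if u0: "\<And>i. u0 $ i \<in> besov \<psi> \<alpha>" "\<And>i. real_distr (u0 $ i)" "besov_norm \<psi> \<alpha> u0 \<le> ennreal (\<delta> / 2)"
    for u0 :: "('n distr)^'n"
  proof -
    define a :: "(real^'n) \<times> real \<Rightarrow> real^'n" where "a z = (\<chi> i. Re (semigroup_at \<psi> \<alpha> (snd z) (u0 $ i) (fst z)))" for z
    have temp: "tempered (u0 $ i)" for i using u0(1)[of i] by (simp add: besov_def)
    have S_eq: "semigroup_at \<psi> \<alpha> t (u0 $ i) x = complex_of_real (a (x, t) $ i)" for t x i
      using semigroup_at_real[OF assms(3) u0(2)[of i], of \<alpha> t x] by (simp add: a_def)
    have V_eq: "V_nabla_Pi \<alpha> F (x, t) $ i = complex_of_real (real_duhamel F (x, t) $ i)" for F :: "(real^'n) \<times> real \<Rightarrow> real^'n^'n" and x t i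
      using V_real[of F x t i] by (simp add: real_duhamel_def)
    \<comment> \<open>All components on both sides are real, so the equation in complex vectors is
      equivalent to the one between real parts.\<close>
    have mild_iff: "mild_solution \<psi> \<alpha> u0 u \<longleftrightarrow> solves a u" for u
      unfolding mild_solution_def solves_def vec_eq_iff semigroup_vec_def
      by (simp add: S_eq V_eq flip: of_real_diff)
    have norm_a: "norm (semigroup_vec \<psi> \<alpha> t u0 x) = norm (a (x, t))" for x t
      by (simp add: norm_vec_def semigroup_vec_def S_eq)
    have am: "a \<in> borel_measurable borel"
    proof (rule borel_measurable_vec)
      show "(\<lambda>z. a z $ i) \<in> borel_measurable borel" for i
        using semigroup_at_measurable[OF assms(3) temp[of i], of \<alpha>] by (simp add: a_def borel_measurable_Re)
    qed
    have ab: "sol_bound (\<delta> / 2) a"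
      unfolding sol_bound_def
    proof (intro conjI am allI impI)
      fix t :: real assume t: "t > 0"
      have "ennreal (t powr (1 - 1 / (2 * \<alpha>))) * Linf_norm (semigroup_vec \<psi> \<alpha> t u0) \<le> ennreal (\<delta> / 2)"
        using u0(3) t unfolding besov_norm_def SUP_le_iff by simp
      then show "AE x in lborel. norm (a (x, t)) \<le> \<delta> / 2 * t powr (- \<beta>)"
        using t \<delta>0 by (simp add: weighted_Linf_norm_le_iff wt norm_a)
    qed
    \<comment> \<open>Membership in \<open>GX\<close> gives measurability only on
      \<open>spacetime\<close>; extension by zero makes it global, as \<open>sol_bound\<close>
      demands.\<close>
    define ext where "ext u z = indicator spacetime z *\<^sub>R u z" for u :: "(real^'n) \<times> real \<Rightarrow> real^'n" and z
    have ext_eq: "ext u z = u z" if "z \<in> spacetime" for u z using that by (simp add: ext_def)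
    have GX_sol: "sol_bound \<delta> (ext u) \<and> solves a (ext u)"
      if "u \<in> GX \<alpha>" "GX_norm \<alpha> u \<le> ennreal \<delta>" "mild_solution \<psi> \<alpha> u0 u" for u
    proof
      have "ext u \<in> borel_measurable borel"
        using that(1) sp unfolding GX_def ext_def[abs_def] by (simp add: borel_measurable_restrict_space_iff)
      then show "sol_bound \<delta> (ext u)"
        using that(2) \<delta>0 unfolding sol_bound_def by (simp add: GX_iff ext_def spacetime_def)
      show "solves a (ext u)"
        using that(3) solves_cong[of "ext u" u a] ext_eq unfolding mild_iff by blast
    qed
    obtain w where w: "sol_bound \<delta> w" "solves a w"
      by (rule solution_exists[OF ab \<delta>0 \<delta>(2)])
    \<comment> \<open>Back from the global function to the representative in
      \<open>extensional spacetime\<close>, for which uniqueness is an equality of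
      functions.\<close>
    define u where "u = restrict w spacetime"
    have uw: "u z = w z" if "z \<in> spacetime" for z using that by (simp add: u_def)
    have wmeas: "w \<in> borel_measurable borel" using w(1) by (simp add: sol_bound_def)
    have un: "GX_norm \<alpha> u \<le> ennreal \<delta>"
      unfolding GX_iff[OF \<delta>0]
    proof (intro allI impI conjI)
      fix t :: real assume t: "t > 0"
      have eq: "u (x, t) = w (x, t)" for x using t by (intro uw) (simp add: spacetime_def)
      have "(\<lambda>x. w (x, t)) \<in> borel_measurable borel"
        by (rule measurable_compose[OF _ wmeas]) (intro borel_measurable_continuous_onI continuous_intros)
      then show "(\<lambda>x. ennreal (norm (u (x, t)))) \<in> borel_measurable borel"
        unfolding eq by measurable
      show "AE x in lborel. norm (u (x, t)) \<le> \<delta> * t powr (- \<beta>)"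
        unfolding eq using w(1) t by (simp add: sol_bound_def)
    qed
    have uG: "u \<in> GX \<alpha>"
      unfolding GX_def
    proof (intro CollectI conjI)
      show "u \<in> extensional spacetime" by (simp add: u_def)
      have "w \<in> borel_measurable (restrict_space borel spacetime)"
        by (rule measurable_restrict_space1[OF wmeas])
      then show "u \<in> borel_measurable (restrict_space borel spacetime)"
        by (subst measurable_cong[of _ u w]) (auto simp: space_restrict_space uw)
      show "GX_norm \<alpha> u < \<infinity>" using un by (rule order_le_less_trans) simp
    qed
    have um: "mild_solution \<psi> \<alpha> u0 u"
      unfolding mild_iff using w(2) solves_cong[OF uw] by simp
    show ?thesis
    proof (rule ex1I[of _ u])
      show "u \<in> GX \<alpha> \<and> GX_norm \<alpha> u \<le> ennreal \<delta> \<and> mild_solution \<psi> \<alpha> u0 u"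
        using uG un um by blast
      fix v assume v: "v \<in> GX \<alpha> \<and> GX_norm \<alpha> v \<le> ennreal \<delta> \<and> mild_solution \<psi> \<alpha> u0 v"
      have "v (x, t) = u (x, t)" if t: "t > 0" for x t
      proof -
        have "ext v (x, t) = ext u (x, t)"
          using solution_unique[of \<delta> "ext v" a "ext u" t x] GX_sol[of v] GX_sol[of u] uG un um v \<delta>0 \<delta>(2) t by blast
        then show ?thesis using t by (simp add: ext_def spacetime_def)
      qed
      then have "v z = u z" if "z \<in> spacetime" for z
        using that by (cases z) (auto simp: spacetime_def)
      then show "v = u"
        using v uG by (intro extensionalityI[of v spacetime u]) (auto simp: GX_def)
    qed
  qed
  show ?thesis
    \<comment> \<open>The data receive half of the radius, as required by
      \<open>solution_exists\<close>.\<close>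
    by (intro exI[of _ "\<delta> / 2"] exI[of _ \<delta>] conjI allI impI) (use \<delta> main in auto)
qed

end
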